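(* Let $X^\delta\subset X$ and $Y^\delta\subset Y$ be closed non-trivial subspaces, either both finite dimensional, or $X^\delta=X$ and $Y^\delta=Y$, with $X^\delta\subset Y^\delta$. Let $(\ell,u_0)\in Y'\times H$, let $u\in X$ be the solution of $\mathrm{d}_tu+Au=\ell$, $\gamma_0u=u_0$, and let $(\theta^\delta,u^\delta)\in Y^\delta\times X^\delta$ be the solution of $$N^\delta(\theta^\delta,u^\delta)=\big((E_Y^\delta)'\ell,\,-(E_X^\delta)'(\ell+\gamma_0'u_0)\big).$$ Let $\varrho>0$ and suppose that, with $\theta_\delta:=A^{-1}(\ell-\mathrm{d}_tE_X^\delta u^\delta)\in Y$, $$\|\theta_\delta-E_Y^\delta\theta^\delta\|_Y\le\varrho\Big(\|\theta^\delta-u^\delta\|_{Y^\delta}+\tfrac{\sqrt{1+L_A^2}}{m_A}\|u_0-\gamma_0E_X^\delta u^\delta\|_H\Big).$$ Then, for $u\notin X^\delta$, $$\frac{m_A}{\sqrt{1+L_A^2+m_A^2}}\le\frac{\|u-E_X^\delta u^\delta\|_X}{\sqrt{\|\theta^\delta-u^\delta\|_{Y^\delta}^2+\|u_0-\gamma_0^\delta u^\delta\|_H^2}}\le L_{B_e^{-1}}\sqrt{L_A^2(\varrho+1)^2+\Big(L_A\varrho\tfrac{\sqrt{1+L_A^2}}{m_A}+1\Big)^2},$$ where $L_{B_e^{-1}}:=\tfrac1{m_S}(1+\tfrac1{m_A})$ and $m_S:=\min(1,m_A,\tfrac{m_A}{L_A^2})$.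
   Context: All linear spaces are over $\mathbb R$. $V\hookrightarrow H\simeq H'\hookrightarrow V'$ is a Gelfand triple of Hilbert spaces, $T>0$, $\Xi:=(0,T)$. Set $Y:=L_2(\Xi;V)$ and $X:=L_2(\Xi;V)\cap H^1(\Xi;V')$. It is known that $X\hookrightarrow C(\overline\Xi;H)$, and $\gamma_t\colon X\to H$ denotes the trace $w\mapsto w(t)$. Define $\mathrm{d}_t\colon X\to Y'$ by $(\mathrm{d}_t w)(v):=\int_\Xi (\tfrac{\mathrm{d}w}{\mathrm{d}t}(t))(v(t))\,\mathrm{d}t$. $X$ is equipped with the norm $\|w\|_X:=\sqrt{\|w\|_Y^2+\|\mathrm{d}_tw\|_{Y'}^2+\|\gamma_Tw\|_H^2}$. For a.e. $t\in\Xi$, $A(t)\colon V\to V'$ is a possibly nonlinear operator, and $A\colon Y\to Y'$ is defined by $(Aw)(v):=\int_\Xi (A(t)w(t))(v(t))\,\mathrm{d}t$. It is assumed that $A\colon Y\to Y'$ is Lipschitz continuous, $\|Aw-Av\|_{Y'}\le L_A\|w-v\|_Y$, and strongly monotone, $(Aw-Av)(w-v)\ge m_A\|w-v\|_Y^2$, for all $w,v\in Y$, with constants $L_A,m_A>0$; hence $A$ is invertible. It is known that then for every $(\ell,u_0)\in Y'\times H$ there is a unique $u\in X$ with $\mathrm{d}_tu+Au=\ell$, $\gamma_0u=u_0$. Primes denote duals/adjoints, and functionals in $Y'$ are viewed in $X'$ by restriction. $E_X^\delta\colon X^\delta\to X$ and $E_Y^\delta\colon Y^\delta\to Y$ are the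 trivial embeddings (so $(E_Y^\delta)'$, $(E_X^\delta)'$ restrict functionals to $Y^\delta$, $X^\delta$). $Y^\delta$ is equipped with $\|\cdot\|_{Y^\delta}:=\|E_Y^\delta\cdot\|_Y$ and $(Y^\delta)'$ with the dual norm. Set $A_Y^\delta:=(E_Y^\delta)'AE_Y^\delta$, $A_X^\delta:=(E_X^\delta)'AE_X^\delta$, $\mathrm{d}_t^\delta:=(E_Y^\delta)'\mathrm{d}_tE_X^\delta$, $\gamma_t^\delta:=\gamma_tE_X^\delta$, and define $N^\delta\colon Y^\delta\times X^\delta\to(Y^\delta)'\times(X^\delta)'$ by $$N^\delta(\theta,u):=\big(A_Y^\delta\theta+\mathrm{d}_t^\delta u,\ (\mathrm{d}_t^\delta)'\theta-(A_X^\delta u+(\gamma_T^\delta)'\gamma_T^\delta u)\big).$$ This operator is invertible. Note that $\theta_\delta$ (lower index) and $\theta^\delta$ (upper index) denote different objects. *)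

theory Defs
  imports "HOL-Analysis.Analysis"
begin

text \<open>
  Elements of the Bochner spaces are represented by functions rather than by classes modulo
  almost everywhere equality; the norms below are therefore seminorms as far as HOL equality is
  concerned. All notions are invariant under changes on null sets, and a \<open>closed\<close> subspace
  in the sense below automatically contains with a function every a.e. equal one.

  \<^verbatim>\<open>V\<close> and \<^verbatim>\<open>H\<close> are arbitrary (possibly nonseparable) real Hilbert
  spaces. As the library's Bochner integral asks for second countability, strong measurability is
  introduced here; only real-valued integrals occur.
\<close>

abbreviation Xi :: "real \<Rightarrow> real measure" where
  "Xi T \<equiv> lebesgue_on {0<..<T}"


subsection \<open>Bochner spaces\<close>

definition strongly_measurable :: "'a measure \<Rightarrow> ('a \<Rightarrow> 'b::topological_space) \<Rightarrow> bool" where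
  "strongly_measurable M f \<longleftrightarrow>
     (\<exists>s. (\<forall>i::nat. simple_function M (s i)) \<and> (AE x in M. (\<lambda>i. s i x) \<longlonglongrightarrow> f x))"

definition L2 :: "real \<Rightarrow> (real \<Rightarrow> 'b::real_normed_vector) set" where
  "L2 T = {f. strongly_measurable (Xi T) f \<and> integrable (Xi T) (\<lambda>t. (norm (f t))\<^sup>2)}"

definition L2_norm :: "real \<Rightarrow> (real \<Rightarrow> 'b::real_normed_vector) \<Rightarrow> real" where
  "L2_norm T f = sqrt (LINT t|Xi T. (norm (f t))\<^sup>2)"

text \<open>\<open>C\<^sub>c\<^sup>\<infinity>(0,T)\<close>, extended by zero to the real line.\<close>

definition test_functions :: "real \<Rightarrow> (real \<Rightarrow> real) set" where
  "test_functions T = {\<phi>. (\<forall>k x. ((deriv ^^ k) \<phi>) differentiable (at x)) \<and>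
     (\<exists>a b. 0 < a \<and> b < T \<and> (\<forall>x. x \<notin> {a..b} \<longrightarrow> \<phi> x = 0))}"

text \<open>
  The identity \<open>\<integral> \<phi>'(t) f(t) dt = - \<integral> \<phi>(t) g(t) dt\<close> between elements of \<open>V'\<close> is expressed by
  evaluating both functionals at every \<open>v \<in> V\<close>; evaluation commutes with the Bochner integral.
\<close>

definition weak_deriv ::
  "real \<Rightarrow> (real \<Rightarrow> 'v::real_normed_vector \<Rightarrow>\<^sub>L real) \<Rightarrow> (real \<Rightarrow> 'v \<Rightarrow>\<^sub>L real) \<Rightarrow> bool" where
  "weak_deriv T f g \<longleftrightarrow> (\<forall>\<phi>\<in>test_functions T. \<forall>v.
     (LINT t|Xi T. deriv \<phi> t * blinfun_apply (f t) v) =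
     - (LINT t|Xi T. \<phi> t * blinfun_apply (g t) v))"

definition H1_dual :: "real \<Rightarrow> (real \<Rightarrow> 'v::real_normed_vector \<Rightarrow>\<^sub>L real) set" where
  "H1_dual T = {f \<in> L2 T. \<exists>g \<in> L2 T. weak_deriv T f g}"


subsection \<open>Gelfand triple\<close>

text \<open>\<open>\<iota>\<close> is the embedding of \<open>V\<close> into \<open>H\<close>; \<open>h \<in> H \<simeq> H'\<close> acts on \<open>V\<close> by \<open>v \<mapsto> \<langle>h, \<iota> v\<rangle>\<close>.\<close>

definition gelfand_triple ::
  "('v::{real_inner,complete_space} \<Rightarrow>\<^sub>L 'h::{real_inner,complete_space}) \<Rightarrow> bool" where
  "gelfand_triple \<iota> \<longleftrightarrow>
     inj (blinfun_apply \<iota>) \<and> closure (range (blinfun_apply \<iota>)) = UNIV"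

definition H_to_Vdual ::
  "('v::{real_inner,complete_space} \<Rightarrow>\<^sub>L 'h::{real_inner,complete_space}) \<Rightarrow> 'h \<Rightarrow> 'v \<Rightarrow>\<^sub>L real" where
  "H_to_Vdual \<iota> h = blinfun_inner_right h o\<^sub>L \<iota>"

definition V_to_Vdual ::
  "('v::{real_inner,complete_space} \<Rightarrow>\<^sub>L 'h::{real_inner,complete_space}) \<Rightarrow> 'v \<Rightarrow> 'v \<Rightarrow>\<^sub>L real" where
  "V_to_Vdual \<iota> v = H_to_Vdual \<iota> (blinfun_apply \<iota> v)"


subsection \<open>Seminormed function spaces and their duals\<close>

definition lin_subspace :: "(real \<Rightarrow> 'v::real_vector) set \<Rightarrow> bool" where
  "lin_subspace S \<longleftrightarrow> (\<lambda>t. 0) \<in> S \<and>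
     (\<forall>x\<in>S. \<forall>y\<in>S. (\<lambda>t. x t + y t) \<in> S) \<and>
     (\<forall>c. \<forall>x\<in>S. (\<lambda>t. c *\<^sub>R x t) \<in> S)"

definition closed_subspace ::
  "(real \<Rightarrow> 'v::real_vector) set \<Rightarrow> ((real \<Rightarrow> 'v) \<Rightarrow> real) \<Rightarrow> (real \<Rightarrow> 'v) set \<Rightarrow> bool" where
  "closed_subspace Z N S \<longleftrightarrow> S \<subseteq> Z \<and> lin_subspace S \<and>
     (\<forall>xs x. (\<forall>n::nat. xs n \<in> S) \<and> x \<in> Z \<and> (\<lambda>n. N (\<lambda>t. xs n t - x t)) \<longlonglongrightarrow> 0 \<longrightarrow> x \<in> S)"

definition nontrivial_space :: "real \<Rightarrow> (real \<Rightarrow> 'v::real_vector) set \<Rightarrow> bool" where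
  "nontrivial_space T S \<longleftrightarrow> (\<exists>x\<in>S. \<not> (AE t in Xi T. x t = 0))"

definition finite_dimensional :: "real \<Rightarrow> (real \<Rightarrow> 'v::real_vector) set \<Rightarrow> bool" where
  "finite_dimensional T S \<longleftrightarrow> (\<exists>B. finite B \<and> B \<subseteq> S \<and>
     (\<forall>x\<in>S. \<exists>c. AE t in Xi T. x t = (\<Sum>b\<in>B. c b *\<^sub>R b t)))"

text \<open>
  Functionals on a space \<open>S\<close> of functions are extensional, i.e. \<open>undefined\<close> outside \<open>S\<close>, so that
  HOL equality is equality of functionals and \<open>restrict\<close> is the adjoint of a trivial embedding.
\<close>

definition dual_space ::
  "(real \<Rightarrow> 'v::real_vector) set \<Rightarrow> ((real \<Rightarrow> 'v) \<Rightarrow> real) \<Rightarrow> ((real \<Rightarrow> 'v) \<Rightarrow> real) set" where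
  "dual_space S N = {f \<in> extensional S.
     (\<forall>x\<in>S. \<forall>y\<in>S. f (\<lambda>t. x t + y t) = f x + f y) \<and>
     (\<forall>c. \<forall>x\<in>S. f (\<lambda>t. c *\<^sub>R x t) = c * f x) \<and>
     (\<exists>C. \<forall>x\<in>S. \<bar>f x\<bar> \<le> C * N x)}"

definition dual_norm ::
  "(real \<Rightarrow> 'v::real_vector) set \<Rightarrow> ((real \<Rightarrow> 'v) \<Rightarrow> real) \<Rightarrow> ((real \<Rightarrow> 'v) \<Rightarrow> real) \<Rightarrow> real" where
  "dual_norm S N f = (SUP x\<in>{x\<in>S. N x \<le> 1}. \<bar>f x\<bar>)"


subsection \<open>The spaces \<open>Y\<close> and \<open>X\<close>, time derivative and traces\<close>

abbreviation Y_space :: "real \<Rightarrow> (real \<Rightarrow> 'v::{real_inner,complete_space}) set" where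
  "Y_space T \<equiv> L2 T"

abbreviation Y_norm :: "real \<Rightarrow> (real \<Rightarrow> 'v::{real_inner,complete_space}) \<Rightarrow> real" where
  "Y_norm T \<equiv> L2_norm T"

abbreviation Y_dual :: "real \<Rightarrow> ((real \<Rightarrow> 'v::{real_inner,complete_space}) \<Rightarrow> real) set" where
  "Y_dual T \<equiv> dual_space (Y_space T) (Y_norm T)"

abbreviation Y_dual_norm ::
  "real \<Rightarrow> ((real \<Rightarrow> 'v::{real_inner,complete_space}) \<Rightarrow> real) \<Rightarrow> real" where
  "Y_dual_norm T \<equiv> dual_norm (Y_space T) (Y_norm T)"

definition X_space ::
  "('v::{real_inner,complete_space} \<Rightarrow>\<^sub>L 'h::{real_inner,complete_space}) \<Rightarrow> real \<Rightarrow> (real \<Rightarrow> 'v) set" where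
  "X_space \<iota> T = {w \<in> L2 T. (\<lambda>t. V_to_Vdual \<iota> (w t)) \<in> H1_dual T}"

text \<open>The weak derivative of \<open>w \<in> X\<close> is unique up to null sets, so any choice will do.\<close>

definition time_deriv ::
  "('v::{real_inner,complete_space} \<Rightarrow>\<^sub>L 'h::{real_inner,complete_space}) \<Rightarrow> real \<Rightarrow>
   (real \<Rightarrow> 'v) \<Rightarrow> real \<Rightarrow> 'v \<Rightarrow>\<^sub>L real" where
  "time_deriv \<iota> T w = (SOME g. g \<in> L2 T \<and> weak_deriv T (\<lambda>t. V_to_Vdual \<iota> (w t)) g)"

definition d_t ::
  "('v::{real_inner,complete_space} \<Rightarrow>\<^sub>L 'h::{real_inner,complete_space}) \<Rightarrow> real \<Rightarrow>
   (real \<Rightarrow> 'v) \<Rightarrow> (real \<Rightarrow> 'v) \<Rightarrow> real" where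
  "d_t \<iota> T w = (\<lambda>v\<in>Y_space T. LINT t|Xi T. blinfun_apply (time_deriv \<iota> T w t) (v t))"

text \<open>\<open>\<gamma>\<^sub>t w\<close> is the value at \<open>t\<close> of the representative of \<open>w\<close> in \<open>C([0,T];H)\<close>.\<close>

definition time_trace ::
  "('v::{real_inner,complete_space} \<Rightarrow>\<^sub>L 'h::{real_inner,complete_space}) \<Rightarrow> real \<Rightarrow>
   real \<Rightarrow> (real \<Rightarrow> 'v) \<Rightarrow> 'h" where
  "time_trace \<iota> T t w = (SOME c. continuous_on {0..T} c \<and>
     (AE s in Xi T. c s = blinfun_apply \<iota> (w s))) t"

definition X_norm ::
  "('v::{real_inner,complete_space} \<Rightarrow>\<^sub>L 'h::{real_inner,complete_space}) \<Rightarrow> real \<Rightarrow>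
   (real \<Rightarrow> 'v) \<Rightarrow> real" where
  "X_norm \<iota> T w = sqrt ((Y_norm T w)\<^sup>2 + (Y_dual_norm T (d_t \<iota> T w))\<^sup>2 + (norm (time_trace \<iota> T T w))\<^sup>2)"


subsection \<open>The nonlinear operator\<close>

definition op_A ::
  "real \<Rightarrow> (real \<Rightarrow> 'v::{real_inner,complete_space} \<Rightarrow> 'v \<Rightarrow>\<^sub>L real) \<Rightarrow>
   (real \<Rightarrow> 'v) \<Rightarrow> (real \<Rightarrow> 'v) \<Rightarrow> real" where
  "op_A T A w = (\<lambda>v\<in>Y_space T. LINT t|Xi T. blinfun_apply (A t (w t)) (v t))"

text \<open>
  The integrability requirement says that the integral defining \<open>(A w)(v)\<close> exists; the library
  assigns the value 0 to integrals that do not.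
\<close>

definition maps_Y_to_Y_dual ::
  "real \<Rightarrow> (real \<Rightarrow> 'v::{real_inner,complete_space} \<Rightarrow> 'v \<Rightarrow>\<^sub>L real) \<Rightarrow> bool" where
  "maps_Y_to_Y_dual T A \<longleftrightarrow> (\<forall>w\<in>Y_space T.
     (\<forall>v\<in>Y_space T. integrable (Xi T) (\<lambda>t. blinfun_apply (A t (w t)) (v t))) \<and>
     op_A T A w \<in> Y_dual T)"

definition lipschitz_A ::
  "real \<Rightarrow> (real \<Rightarrow> 'v::{real_inner,complete_space} \<Rightarrow> 'v \<Rightarrow>\<^sub>L real) \<Rightarrow> real \<Rightarrow> bool" where
  "lipschitz_A T A L \<longleftrightarrow> (\<forall>w\<in>Y_space T. \<forall>v\<in>Y_space T.
     Y_dual_norm T (\<lambda>z\<in>Y_space T. op_A T A w z - op_A T A v z) \<le> L * Y_norm T (\<lambda>t. w t - v t))"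

definition strongly_monotone_A ::
  "real \<Rightarrow> (real \<Rightarrow> 'v::{real_inner,complete_space} \<Rightarrow> 'v \<Rightarrow>\<^sub>L real) \<Rightarrow> real \<Rightarrow> bool" where
  "strongly_monotone_A T A m \<longleftrightarrow> (\<forall>w\<in>Y_space T. \<forall>v\<in>Y_space T.
     op_A T A w (\<lambda>t. w t - v t) - op_A T A v (\<lambda>t. w t - v t) \<ge> m * (Y_norm T (\<lambda>t. w t - v t))\<^sup>2)"


subsection \<open>The discrete saddle-point operator\<close>

context
  fixes \<iota> :: "'v::{real_inner,complete_space} \<Rightarrow>\<^sub>L 'h::{real_inner,complete_space}"
    and T :: real
    and A :: "real \<Rightarrow> 'v \<Rightarrow> 'v \<Rightarrow>\<^sub>L real"
    and S :: "(real \<Rightarrow> 'v) set"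
begin

text \<open>\<open>(E\<^sup>\<delta>)' A E\<^sup>\<delta>\<close> for \<open>S = Y\<^sup>\<delta>\<close> and \<open>S = X\<^sup>\<delta>\<close>.\<close>

definition A_delta :: "(real \<Rightarrow> 'v) \<Rightarrow> (real \<Rightarrow> 'v) \<Rightarrow> real" where
  "A_delta w = restrict (op_A T A w) S"

definition d_t_delta :: "(real \<Rightarrow> 'v) \<Rightarrow> (real \<Rightarrow> 'v) \<Rightarrow> real" where
  "d_t_delta w = restrict (d_t \<iota> T w) S"

text \<open>The adjoints act on functionals on \<open>X\<^sup>\<delta>\<close>, hence \<open>S = X\<^sup>\<delta>\<close> in the following two.\<close>

definition d_t_delta_adj :: "(real \<Rightarrow> 'v) \<Rightarrow> (real \<Rightarrow> 'v) \<Rightarrow> real" where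
  "d_t_delta_adj \<theta> = (\<lambda>w\<in>S. d_t \<iota> T w \<theta>)"

definition time_trace_delta_adj :: "real \<Rightarrow> 'h \<Rightarrow> (real \<Rightarrow> 'v) \<Rightarrow> real" where
  "time_trace_delta_adj t h = (\<lambda>w\<in>S. inner h (time_trace \<iota> T t w))"

end

definition N_delta ::
  "('v::{real_inner,complete_space} \<Rightarrow>\<^sub>L 'h::{real_inner,complete_space}) \<Rightarrow> real \<Rightarrow>
   (real \<Rightarrow> 'v \<Rightarrow> 'v \<Rightarrow>\<^sub>L real) \<Rightarrow> (real \<Rightarrow> 'v) set \<Rightarrow> (real \<Rightarrow> 'v) set \<Rightarrow>
   (real \<Rightarrow> 'v) \<times> (real \<Rightarrow> 'v) \<Rightarrow> ((real \<Rightarrow> 'v) \<Rightarrow> real) \<times> ((real \<Rightarrow> 'v) \<Rightarrow> real)" where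
  "N_delta \<iota> T A Y\<delta> X\<delta> = (\<lambda>(\<theta>, u).
     ((\<lambda>v\<in>Y\<delta>. A_delta T A Y\<delta> \<theta> v + d_t_delta \<iota> T Y\<delta> u v),
      (\<lambda>w\<in>X\<delta>. d_t_delta_adj \<iota> T X\<delta> \<theta> w -
         (A_delta T A X\<delta> u w + time_trace_delta_adj \<iota> T X\<delta> T (time_trace \<iota> T T u) w))))"


subsection \<open>Constants\<close>

definition m_S :: "real \<Rightarrow> real \<Rightarrow> real" where
  "m_S L_A m_A = Min {1, m_A, m_A / L_A\<^sup>2}"

definition L_Be_inv :: "real \<Rightarrow> real \<Rightarrow> real" where
  "L_Be_inv L_A m_A = 1 / m_S L_A m_A * (1 + 1 / m_A)"

end

theory Submission
  imports Defs "HOL-Computational_Algebra.Polynomial" "HOL-Real_Asymp.Real_Asymp"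
begin

text \<open>
  Let \<open>e = u - u\<delta>\<close>. Both estimates rest on integration by parts on \<open>X\<close>,
  \<open>2 (d\<^sub>t w)(w) = \<parallel>\<gamma>\<^sub>T w\<parallel>\<^sup>2 - \<parallel>\<gamma>\<^sub>0 w\<parallel>\<^sup>2\<close> (\<open>integration_by_parts_X\<close>).

  For the lower bound, this identity and Young's inequality give \<open>\<parallel>\<gamma>\<^sub>0 e\<parallel> \<le> \<parallel>e\<parallel>\<^sub>X\<close>
  (\<open>initial_trace_le_X_norm\<close>). The first discrete equation says that
  \<open>A \<theta>\<delta> - A u\<delta> = d\<^sub>t e + A u - A u\<delta>\<close> on \<open>Y\<delta>\<close>; it may be tested with \<open>\<theta>\<delta> - u\<delta>\<close> because
  \<open>X\<delta> \<subseteq> Y\<delta>\<close>, and strong monotonicity yields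
  \<open>m\<^sub>A \<parallel>\<theta>\<delta> - u\<delta>\<parallel>\<^sub>Y \<le> \<parallel>d\<^sub>t e\<parallel> + L\<^sub>A \<parallel>e\<parallel>\<^sub>Y\<close>.

  For the upper bound, the point is that \<open>d\<^sub>t e = A \<theta>\<^sub>\<delta> - A u\<close>. Strong monotonicity for the pair
  \<open>(u, u\<delta>)\<close> controls \<open>\<parallel>e\<parallel>\<^sub>Y\<^sup>2\<close>, and for the pair \<open>(u, \<theta>\<^sub>\<delta>)\<close> it controls
  \<open>\<parallel>u - \<theta>\<^sub>\<delta>\<parallel>\<^sub>Y\<^sup>2\<close>, which by Lipschitz continuity is at least \<open>\<parallel>d\<^sub>t e\<parallel>\<^sup>2 / L\<^sub>A\<^sup>2\<close>. Adding the two and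
  integrating by parts leads to
  \<open>m\<^sub>S \<parallel>e\<parallel>\<^sub>X\<^sup>2 \<le> (A \<theta>\<^sub>\<delta> - A u\<delta>)(e) + (d\<^sub>t e)(\<theta>\<^sub>\<delta> - u\<delta>) + \<parallel>\<gamma>\<^sub>0 e\<parallel>\<^sup>2\<close>.
  Hence \<open>\<parallel>e\<parallel>\<^sub>X\<close> is bounded by \<open>\<parallel>\<theta>\<^sub>\<delta> - u\<delta>\<parallel>\<^sub>Y\<close> and \<open>\<parallel>\<gamma>\<^sub>0 e\<parallel>\<close>, and the saturation hypothesis replaces
  \<open>\<theta>\<^sub>\<delta>\<close> by \<open>\<theta>\<delta>\<close>. If the denominator of the quotient vanished, this bound would give
  \<open>\<parallel>e\<parallel>\<^sub>X = 0\<close> and so \<open>u \<in> X\<delta>\<close> by closedness.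

  Most of the work is the analysis of \<open>X\<close> behind the integration by parts: the existence of a
  representative in \<open>C([0,T]; H)\<close> and the energy identity, for spaces \<open>V\<close> and \<open>H\<close> that may be
  nonseparable. The argument reduces everything to scalar functions of time:
  \<^item> A scalar \<open>f\<close> with weak derivative \<open>\<gamma>\<close> satisfies \<open>f(t) - f(s) = \<integral>\<^sub>s\<^sup>t \<gamma>\<close> for all \<open>s \<le> t\<close>
    outside a null set: test with smooth ramps and use Lebesgue points
    (\<open>weak_derivative_increments\<close>).
  \<^item> Applied to \<open>\<langle>\<iota> w(t), \<iota> v\<rangle>\<close> for the countably many values \<open>v\<close> of a sequence of simple functions
    converging to \<open>w\<close>, this gives \<open>\<langle>\<iota> w(t) - \<iota> w(s), \<iota> w(r)\<rangle> = \<integral>\<^sub>s\<^sup>t w'(w(r))\<close> for all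
    \<open>r, s, t\<close> outside one null set (\<open>increments_against_values\<close>).
  \<^item> Summing the cases \<open>r = s\<close> and \<open>r = t\<close> over a fine partition turns
    \<open>\<parallel>\<iota> w(b)\<parallel>\<^sup>2 - \<parallel>\<iota> w(a)\<parallel>\<^sup>2\<close> into a Riemann sum for \<open>2 \<integral>\<^sub>a\<^sup>b w'(w)\<close>. It converges because the
    partition points can be chosen where \<open>w\<close> is close to a continuous function that is close to \<open>w\<close> in
    the mean (\<open>energy_identity_off_null_set\<close>).
  \<^item> The energy identity bounds \<open>\<parallel>\<iota> w(t) - \<iota> w(s)\<parallel>\<close> through an intermediate time at which
    \<open>\<parallel>w\<parallel>\<^sup>2\<close> is at most its mean over \<open>[s,t]\<close>; this makes \<open>\<iota> w\<close> uniformly continuous off a null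
    set, so that it extends to \<open>[0,T]\<close> (\<open>uniformly_continuous_off_null_set\<close>).
\<close>

section \<open>Smooth ramp functions\<close>

text \<open>
  The derivative is existentially quantified rather than \<open>deriv f\<close>, so that closure under sums,
  products and affine substitutions follows by induction from the rules for derivatives.
\<close>

primrec times_differentiable :: "nat \<Rightarrow> (real \<Rightarrow> real) \<Rightarrow> bool" where
  "times_differentiable 0 f \<longleftrightarrow> True"
| "times_differentiable (Suc k) f \<longleftrightarrow>
     (\<exists>f'. (\<forall>x. (f has_real_derivative f' x) (at x)) \<and> times_differentiable k f')"

lemma times_differentiable_imp_iterated_deriv:
  "times_differentiable (Suc k) f \<Longrightarrow> ((deriv ^^ k) f) differentiable (at x)"
proof (induction k arbitrary: f)
  case 0
  then show ?case by (auto simp: real_differentiable_def)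
next
  case (Suc k)
  then obtain f' where f': "\<And>x. (f has_real_derivative f' x) (at x)" "times_differentiable (Suc k) f'"
    unfolding times_differentiable.simps(2)[of "Suc k"] by blast
  have "deriv f = f'"
    using f'(1) by (auto intro: DERIV_imp_deriv)
  then show ?case
    using Suc.IH[OF f'(2)] by (simp add: funpow_swap1)
qed

lemma times_differentiable_lower:
  "times_differentiable (Suc k) f \<Longrightarrow> times_differentiable k f"
proof (induction k arbitrary: f)
  case (Suc k)
  then show ?case unfolding times_differentiable.simps(2)[of "Suc k"] by auto
qed simp

lemma times_differentiable_add:
  "times_differentiable k f \<Longrightarrow> times_differentiable k g \<Longrightarrow> times_differentiable k (\<lambda>x. f x + g x)"
proof (induction k arbitrary: f g)
  case (Suc k)
  then obtain f' g' where "\<And>x. (f has_real_derivative f' x) (at x)" "times_differentiable k f'"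
    "\<And>x. (g has_real_derivative g' x) (at x)" "times_differentiable k g'" by auto
  then show ?case using Suc.IH
    by (auto intro!: exI[of _ "\<lambda>x. f' x + g' x"] DERIV_add)
qed simp

lemma times_differentiable_mult:
  "times_differentiable k f \<Longrightarrow> times_differentiable k g \<Longrightarrow> times_differentiable k (\<lambda>x. f x * g x)"
proof (induction k arbitrary: f g)
  case (Suc k)
  then obtain f' g' where *: "\<And>x. (f has_real_derivative f' x) (at x)" "times_differentiable k f'"
    "\<And>x. (g has_real_derivative g' x) (at x)" "times_differentiable k g'" by auto
  have "times_differentiable k (\<lambda>x. f' x * g x + g' x * f x)"
    using Suc * times_differentiable_lower by (intro times_differentiable_add Suc.IH) auto
  moreover have "((\<lambda>x. f x * g x) has_real_derivative f' x * g x + g' x * f x) (at x)" for x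
    using * by (intro DERIV_mult) auto
  ultimately show ?case by (auto intro!: exI[of _ "\<lambda>x. f' x * g x + g' x * f x"])
qed simp

lemma times_differentiable_const: "times_differentiable k (\<lambda>x. c)"
  by (induction k arbitrary: c) (auto intro!: exI[of _ "\<lambda>x. 0"])

lemma times_differentiable_affine:
  "times_differentiable k f \<Longrightarrow> times_differentiable k (\<lambda>x. f (p * x + q))"
proof (induction k arbitrary: f)
  case (Suc k)
  then obtain f' where *: "\<And>x. (f has_real_derivative f' x) (at x)" "times_differentiable k f'" by auto
  have "((\<lambda>x. f (p * x + q)) has_real_derivative f' (p * x + q) * p) (at x)" for x
  proof (rule DERIV_chain2[of f "f' (p * x + q)" "\<lambda>x. p * x + q" x p])
    show "((\<lambda>x. p * x + q) has_real_derivative p) (at x)"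
      using DERIV_add[OF DERIV_cmult_Id DERIV_const] by simp
  qed (rule *(1))
  moreover have "times_differentiable k (\<lambda>x. f' (p * x + q) * p)"
    by (rule times_differentiable_mult[OF Suc.IH[OF *(2)] times_differentiable_const])
  ultimately show ?case by (auto intro!: exI[of _ "\<lambda>x. f' (p * x + q) * p"])
qed simp

text \<open>
  The functions \<open>p(1/x) exp(-1/x)\<close>, extended by zero: a class that contains the usual flat function
  (\<open>p = 1\<close>) and is closed under differentiation.
\<close>

definition flat_exp :: "real poly \<Rightarrow> real \<Rightarrow> real" where
  "flat_exp p x = (if x > 0 then poly p (1 / x) * exp (- (1 / x)) else 0)"

lemma poly_times_exp_minus_tendsto_0:
  fixes p :: "real poly"
  shows "((\<lambda>y. poly p y * exp (- y)) \<longlongrightarrow> 0) at_top"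
proof -
  have "((\<lambda>y. \<Sum>i\<le>degree p. coeff p i * (y ^ i / exp y)) \<longlongrightarrow> (\<Sum>i\<le>degree p. coeff p i * 0)) at_top"
    by (intro tendsto_sum tendsto_mult tendsto_const tendsto_power_div_exp_0)
  then show ?thesis
    by (simp add: poly_altdef sum_distrib_right exp_minus divide_inverse mult.assoc)
qed

lemma flat_exp_has_derivative:
  "(flat_exp p has_real_derivative flat_exp (monom 1 2 * (p - pderiv p)) x) (at x)"
proof -
  consider "x > 0" | "x < 0" | "x = 0" by linarith
  then show ?thesis
  proof cases
    case 1
    have "((\<lambda>x. poly p (1 / x) * exp (- (1 / x))) has_real_derivative
            flat_exp (monom 1 2 * (p - pderiv p)) x) (at x)"
      using 1
      by (auto intro!: derivative_eq_intros DERIV_chain2[of "poly p"] poly_DERIV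
          simp: flat_exp_def poly_monom field_simps power2_eq_square)
    then show ?thesis
      by (rule has_field_derivative_transform_within_open[where S="{0<..}"])
         (use 1 in \<open>auto simp: flat_exp_def\<close>)
  next
    case 2
    have "((\<lambda>x. 0) has_real_derivative flat_exp (monom 1 2 * (p - pderiv p)) x) (at x)"
      using 2 by (simp add: flat_exp_def)
    then show ?thesis
      by (rule has_field_derivative_transform_within_open[where S="{..<0}"])
         (use 2 in \<open>auto simp: flat_exp_def\<close>)
  next
    case 3
    have "((\<lambda>h. flat_exp p h / h) \<longlongrightarrow> 0) (at 0)"
    proof (rule filterlim_split_at_real)
      show "((\<lambda>h. flat_exp p h / h) \<longlongrightarrow> 0) (at_left 0)"
        by (rule tendsto_eventually) (auto simp: flat_exp_def eventually_at_left_field intro: exI[of _ "-1"])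
      have "((\<lambda>h. poly (pCons 0 p) (inverse h) * exp (- inverse h)) \<longlongrightarrow> 0) (at_right 0)"
        by (rule filterlim_compose[OF poly_times_exp_minus_tendsto_0 filterlim_inverse_at_top_right])
      then show "((\<lambda>h. flat_exp p h / h) \<longlongrightarrow> 0) (at_right 0)"
        by (rule Lim_transform_eventually)
           (auto simp: eventually_at_right_field flat_exp_def field_simps intro: exI[of _ 1])
    qed
    then show ?thesis
      using 3 by (simp add: DERIV_def flat_exp_def)
  qed
qed

lemma times_differentiable_flat_exp: "times_differentiable k (flat_exp p)"
  by (induction k arbitrary: p) (use flat_exp_has_derivative in auto)

text \<open>
  An antiderivative of the bump \<open>exp(-1/x) exp(-1/(1-x))\<close> on \<open>(0,1)\<close>, divided by its total increase.
\<close>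

lemma smooth_step_exists:
  obtains \<sigma> \<rho> :: "real \<Rightarrow> real" and B where
    "\<And>k. times_differentiable k \<sigma>" "\<And>x. (\<sigma> has_real_derivative \<rho> x) (at x)"
    "\<And>x. x \<le> 0 \<Longrightarrow> \<sigma> x = 0" "\<And>x. x \<ge> 1 \<Longrightarrow> \<sigma> x = 1" "\<And>x. 0 \<le> \<sigma> x \<and> \<sigma> x \<le> 1"
    "\<And>x. x \<notin> {0<..<1} \<Longrightarrow> \<rho> x = 0" "\<And>x. \<bar>\<rho> x\<bar> \<le> B" "continuous_on UNIV \<rho>"
proof -
  define r where "r x = flat_exp 1 x * flat_exp 1 ((-1) * x + 1)" for x
  have r_smooth: "times_differentiable k r" for k
    unfolding r_def[abs_def]
    by (rule times_differentiable_mult[OF times_differentiable_flat_exp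
        times_differentiable_affine[OF times_differentiable_flat_exp]])
  have r_cont: "continuous_on A r" for A
  proof -
    obtain r' where "\<And>x. (r has_real_derivative r' x) (at x)"
      using r_smooth[of 1] by auto
    then show ?thesis by (meson DERIV_isCont continuous_at_imp_continuous_on)
  qed
  have r_pos: "r x > 0" if "0 < x" "x < 1" for x
    using that by (simp add: r_def flat_exp_def)
  have r_zero: "r x = 0" if "x \<notin> {0<..<1}" for x
    using that by (auto simp: r_def flat_exp_def)
  have r_nonneg: "r x \<ge> 0" for x
    using r_pos[of x] r_zero[of x] by fastforce
  define F where "F x = integral {-1..x} r" for x
  have F_zero: "F x = 0" if "x \<le> 0" for x
  proof -
    have "F x = integral {-1..x} (\<lambda>_. 0)"
      unfolding F_def by (rule integral_cong) (use that r_zero in auto)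
    then show ?thesis by simp
  qed
  have F_deriv: "(F has_real_derivative r x) (at x)" for x
  proof (cases "x < 0")
    case True
    have "((\<lambda>x. 0) has_real_derivative r x) (at x)"
      using True r_zero by simp
    then show ?thesis
      by (rule has_field_derivative_transform_within_open[where S="{..<0}"]) (use True F_zero in auto)
  next
    case False
    have "(F has_real_derivative r x) (at x within {-1..x+1})"
      unfolding F_def by (rule integral_has_real_derivative) (use False r_cont in auto)
    moreover have "at x within {-1..x+1} = at x"
      by (rule at_within_Icc_at) (use False in auto)
    ultimately show ?thesis by simp
  qed
  have F_mono: "F x \<le> F y" if "x \<le> y" for x y
    using that F_deriv r_nonneg by (intro DERIV_nonneg_imp_nondecreasing[of x y F]) blast+
  have "\<exists>z. 0 < z \<and> z < 1 \<and> F 1 - F 0 = (1 - 0) * r z"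
    by (rule MVT2) (use F_deriv in auto)
  then have F1: "F 1 > 0" using r_pos F_zero[of 0] by auto
  have F_ge: "F x = F 1" if "x \<ge> 1" for x
  proof (cases "x = 1")
    case False
    then have "\<exists>z. 1 < z \<and> z < x \<and> F x - F 1 = (x - 1) * r z"
      by (intro MVT2) (use F_deriv that in auto)
    then show ?thesis using r_zero by auto
  qed simp
  have F_bd: "0 \<le> F x \<and> F x \<le> F 1" for x
    using F_mono[of "min x 0" x] F_mono[of x "max x 1"] F_zero[of "min x 0"] F_ge[of "max x 1"] by auto
  obtain B where B: "\<And>x. x \<in> {0..1} \<Longrightarrow> r x \<le> B"
    using continuous_attains_sup[of "{0..1::real}" r] r_cont by (metis atLeastAtMost_iff compact_Icc empty_iff order.refl zero_le_one)
  have Bx: "r x \<le> B" for x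
    using B[of x] B[of 0] r_zero[of x] r_zero[of 0] by (cases "x \<in> {0<..<1}") auto
  have F_smooth: "times_differentiable k F" for k
    using F_deriv r_smooth by (cases k) auto
  show thesis
  proof (rule that[of "\<lambda>x. F x * (1 / F 1)" "\<lambda>x. r x * (1 / F 1)" "B * (1 / F 1)"])
    show "times_differentiable k (\<lambda>x. F x * (1 / F 1))" for k
      by (rule times_differentiable_mult[OF F_smooth times_differentiable_const])
    show "((\<lambda>x. F x * (1 / F 1)) has_real_derivative r x * (1 / F 1)) (at x)" for x
      by (rule DERIV_cmult_right[OF F_deriv])
    show "continuous_on UNIV (\<lambda>x. r x * (1 / F 1))"
      by (intro continuous_intros r_cont)
    show "\<bar>r x * (1 / F 1)\<bar> \<le> B * (1 / F 1)" for x
      using Bx[of x] r_nonneg[of x] F1 by (simp add: field_simps abs_mult)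
    show "F x * (1 / F 1) = 1" if "x \<ge> 1" for x
      using F_ge[OF that] F1 by simp
    show "0 \<le> F x * (1 / F 1) \<and> F x * (1 / F 1) \<le> 1" for x
      using F_bd[of x] F1 by simp
    show "F x * (1 / F 1) = 0" if "x \<le> 0" for x
      using F_zero[OF that] by simp
    show "r x * (1 / F 1) = 0" if "x \<notin> {0<..<1}" for x
      using r_zero[OF that] by simp
  qed
qed

text \<open>
  The ramp \<open>\<sigma>((t - a)/\<epsilon>) - \<sigma>((t - b)/\<epsilon>)\<close> rises from 0 to 1 on \<open>[a, a+\<epsilon>]\<close> and falls back on
  \<open>[b, b+\<epsilon>]\<close>. As \<open>\<epsilon> \<rightarrow> 0\<close> it tends to the indicator of an interval, while its derivative is the
  difference of two one-sided mollifiers.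
\<close>

lemma ramp_functions:
  obtains \<rho> :: "real \<Rightarrow> real" and B where
    "continuous_on UNIV \<rho>" "\<And>x. \<bar>\<rho> x\<bar> \<le> B" "\<And>x. x \<notin> {0<..<1} \<Longrightarrow> \<rho> x = 0"
    "\<And>x \<epsilon>. \<epsilon> > 0 \<Longrightarrow> ((\<lambda>t. \<rho> ((t - x) / \<epsilon>) / \<epsilon>) has_integral 1) {x..x + \<epsilon>}"
    "\<And>T a b \<epsilon>. \<lbrakk>0 < a; 0 < \<epsilon>; a + \<epsilon> < b; b + \<epsilon> < T\<rbrakk> \<Longrightarrow> \<exists>\<phi>\<in>test_functions T.
       (\<forall>t. deriv \<phi> t = \<rho> ((t - a) / \<epsilon>) / \<epsilon> - \<rho> ((t - b) / \<epsilon>) / \<epsilon>) \<and>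
       (\<forall>t. \<bar>\<phi> t\<bar> \<le> 1) \<and> (\<forall>t\<in>{a+\<epsilon>..b}. \<phi> t = 1) \<and> (\<forall>t. t \<le> a \<or> b + \<epsilon> \<le> t \<longrightarrow> \<phi> t = 0)"
proof (rule smooth_step_exists)
  fix \<sigma> \<rho> :: "real \<Rightarrow> real" and B
  assume smooth: "\<And>k. times_differentiable k \<sigma>" and deriv: "\<And>x. (\<sigma> has_real_derivative \<rho> x) (at x)"
    and zero: "\<And>x. x \<le> 0 \<Longrightarrow> \<sigma> x = 0" and one: "\<And>x. x \<ge> 1 \<Longrightarrow> \<sigma> x = 1"
    and range: "\<And>x. 0 \<le> \<sigma> x \<and> \<sigma> x \<le> 1"
    and \<rho>: "\<And>x. x \<notin> {0<..<1} \<Longrightarrow> \<rho> x = 0" "\<And>x. \<bar>\<rho> x\<bar> \<le> B" "continuous_on UNIV \<rho>"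
  have scaled_deriv: "((\<lambda>t. \<sigma> ((t - x) / \<epsilon>)) has_real_derivative \<rho> ((t - x) / \<epsilon>) / \<epsilon>) (at t)"
    if "\<epsilon> > 0" for x \<epsilon> t
  proof -
    have "((\<lambda>t. (t - x) / \<epsilon>) has_real_derivative 1 / \<epsilon>) (at t)"
      using that by (auto intro!: derivative_eq_intros)
    from DERIV_chain2[OF deriv this] show ?thesis by simp
  qed
  show thesis
  proof (rule that[OF \<rho>(3,2,1)])
    fix x \<epsilon> :: real assume "\<epsilon> > 0"
    have "((\<lambda>t. \<rho> ((t - x) / \<epsilon>) / \<epsilon>) has_integral \<sigma> ((x + \<epsilon> - x) / \<epsilon>) - \<sigma> ((x - x) / \<epsilon>)) {x..x + \<epsilon>}"
      using \<open>\<epsilon> > 0\<close> scaled_deriv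
      by (intro fundamental_theorem_of_calculus)
         (auto simp: has_real_derivative_iff_has_vector_derivative[symmetric] intro: DERIV_subset)
    then show "((\<lambda>t. \<rho> ((t - x) / \<epsilon>) / \<epsilon>) has_integral 1) {x..x + \<epsilon>}"
      using \<open>\<epsilon> > 0\<close> zero one by simp
  next
    fix T a b \<epsilon> :: real
    assume *: "0 < a" "0 < \<epsilon>" "a + \<epsilon> < b" "b + \<epsilon> < T"
    define \<phi> where "\<phi> t = \<sigma> ((t - a) / \<epsilon>) + (-1) * \<sigma> ((t - b) / \<epsilon>)" for t
    have "times_differentiable k (\<lambda>t. \<sigma> ((1 / \<epsilon>) * t + (- (x / \<epsilon>))))" for k x
      by (rule times_differentiable_affine[OF smooth])
    then have "times_differentiable k (\<lambda>t. \<sigma> ((t - x) / \<epsilon>))" for k x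
      by (simp add: diff_divide_distrib)
    then have "times_differentiable k \<phi>" for k
      unfolding \<phi>_def[abs_def]
      by (intro times_differentiable_add times_differentiable_mult[OF times_differentiable_const])
    then have "((deriv ^^ k) \<phi>) differentiable (at x)" for k x
      by (blast intro: times_differentiable_imp_iterated_deriv)
    then have all: "\<forall>k x. ((deriv ^^ k) \<phi>) differentiable (at x)" by blast
    have out: "\<phi> t = 0" if "t \<le> a \<or> b + \<epsilon> \<le> t" for t
      using that * zero one by (auto simp: \<phi>_def field_simps)
    have "\<forall>t. t \<notin> {a..b + \<epsilon>} \<longrightarrow> \<phi> t = 0"
      using out by (metis atLeastAtMost_iff linear)
    then have "\<phi> \<in> test_functions T"
      unfolding test_functions_def using * all by blast
    moreover have "deriv \<phi> t = \<rho> ((t - a) / \<epsilon>) / \<epsilon> - \<rho> ((t - b) / \<epsilon>) / \<epsilon>" for t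
    proof -
      have "(\<phi> has_real_derivative (\<rho> ((t - a) / \<epsilon>) / \<epsilon> + (-1) * (\<rho> ((t - b) / \<epsilon>) / \<epsilon>))) (at t)"
        unfolding \<phi>_def[abs_def] using *(2) by (intro DERIV_add DERIV_cmult scaled_deriv)
      then show ?thesis by (simp add: DERIV_imp_deriv)
    qed
    moreover have "\<bar>\<phi> t\<bar> \<le> 1" for t
      using range[of "(t - a) / \<epsilon>"] range[of "(t - b) / \<epsilon>"] by (auto simp: \<phi>_def)
    moreover have "\<phi> t = 1" if "t \<in> {a+\<epsilon>..b}" for t
      using that * zero one by (auto simp: \<phi>_def field_simps)
    ultimately show "\<exists>\<phi>\<in>test_functions T.
       (\<forall>t. deriv \<phi> t = \<rho> ((t - a) / \<epsilon>) / \<epsilon> - \<rho> ((t - b) / \<epsilon>) / \<epsilon>) \<and>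
       (\<forall>t. \<bar>\<phi> t\<bar> \<le> 1) \<and> (\<forall>t\<in>{a+\<epsilon>..b}. \<phi> t = 1) \<and> (\<forall>t. t \<le> a \<or> b + \<epsilon> \<le> t \<longrightarrow> \<phi> t = 0)"
      using out by blast
  qed
qed

section \<open>Weak derivatives of scalar functions\<close>

lemma absolutely_integrable_continuous_mult:
  fixes g h :: "real \<Rightarrow> real"
  assumes "h absolutely_integrable_on {a..b}" "continuous_on {a..b} g"
  shows "(\<lambda>t. g t * h t) absolutely_integrable_on {a..b}"
proof (rule absolutely_integrable_bounded_measurable_product_real[OF _ _ _ assms(1)])
  show "g \<in> borel_measurable (lebesgue_on {a..b})"
    using assms(2) by (intro continuous_imp_measurable_on_sets_lebesgue) auto
  show "bounded (g ` {a..b})"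
    using assms(2) by (intro compact_imp_bounded compact_continuous_image) auto
qed auto

text \<open>
  The averages of \<open>\<bar>f - q\<bar>\<close> over shrinking intervals converge to \<open>\<bar>f(x) - q\<bar>\<close> off a null set for each
  \<open>q\<close>, hence off one null set for all rational \<open>q\<close>; then let \<open>q\<close> approach \<open>f(x)\<close>.
\<close>

lemma lebesgue_points:
  fixes f :: "real \<Rightarrow> real"
  assumes f: "f absolutely_integrable_on {a..b}"
  obtains N where "negligible N"
    "\<And>x. x \<in> {a..<b} - N \<Longrightarrow>
       ((\<lambda>h. (1 / h) * integral {x..x + h} (\<lambda>t. \<bar>f t - f x\<bar>)) \<longlongrightarrow> 0) (at_right 0)"
proof -
  define F where "F t = (if t \<in> {a..b} then f t else 0)" for t
  have F: "(\<lambda>t. \<bar>F t - q\<bar>) integrable_on {c..d}" for q c d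
  proof -
    have "F absolutely_integrable_on UNIV"
      unfolding F_def using f by (simp only: absolutely_integrable_restrict_UNIV)
    then have "F absolutely_integrable_on {c..d}"
      by (rule absolutely_integrable_on_subinterval) auto
    then have "(\<lambda>t. F t - q) absolutely_integrable_on {c..d}"
      by (rule set_integral_diff(1)[OF _ absolutely_integrable_continuous_real[OF continuous_on_const]])
    then show ?thesis
      by (simp add: absolutely_integrable_on_def)
  qed
  have "\<exists>N. negligible N \<and> (\<forall>x e. x \<notin> N \<longrightarrow> 0 < e \<longrightarrow> (\<exists>d>0. \<forall>h. 0 < h \<and> h < d \<longrightarrow>
      \<bar>(1 / h) * integral {x..x + h} (\<lambda>t. \<bar>F t - q\<bar>) - \<bar>F x - q\<bar>\<bar> < e))" for q
  proof -
    obtain N where "negligible N" and N: "\<And>x e. \<lbrakk>x \<notin> N; 0 < e\<rbrakk> \<Longrightarrow> \<exists>d>0. \<forall>h. 0 < h \<and> h < d \<longrightarrow>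
         norm (integral (cbox x (x + h *\<^sub>R One)) (\<lambda>t. \<bar>F t - q\<bar>) /\<^sub>R h ^ DIM(real) - \<bar>F x - q\<bar>) < e"
      using integrable_ccontinuous_explicit[of "\<lambda>t. \<bar>F t - q\<bar>"] F by (metis cbox_interval)
    then show ?thesis
      by (intro exI[of _ N]) (simp add: divide_inverse)
  qed
  then obtain N where N: "\<And>q. negligible (N q)"
    "\<And>q x e. \<lbrakk>x \<notin> N q; 0 < e\<rbrakk> \<Longrightarrow> (\<exists>d>0. \<forall>h. 0 < h \<and> h < d \<longrightarrow>
      \<bar>(1 / h) * integral {x..x + h} (\<lambda>t. \<bar>F t - q\<bar>) - \<bar>F x - q\<bar>\<bar> < e)"
    by metis
  show thesis
  proof (rule that[of "\<Union>q\<in>\<rat>. N q"])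
    show "negligible (\<Union>q\<in>\<rat>. N q)"
      using N(1) countable_rat by (intro negligible_countable_Union) auto
  next
    fix x assume x: "x \<in> {a..<b} - (\<Union>q\<in>\<rat>. N q)"
    show "((\<lambda>h. (1 / h) * integral {x..x + h} (\<lambda>t. \<bar>f t - f x\<bar>)) \<longlongrightarrow> 0) (at_right 0)"
    proof (rule tendstoI)
      fix e :: real assume "e > 0"
      obtain q where q: "q \<in> \<rat>" "\<bar>F x - q\<bar> < e / 3"
      proof -
        obtain q where "q \<in> \<rat>" "F x - e/3 < q" "q < F x"
          using Rats_dense_in_real[of "F x - e/3" "F x"] \<open>e > 0\<close> by auto
        then show thesis by (intro that[of q]) auto
      qed
      obtain d where d: "d > 0" "\<And>h. 0 < h \<Longrightarrow> h < d \<Longrightarrow>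
          \<bar>(1 / h) * integral {x..x + h} (\<lambda>t. \<bar>F t - q\<bar>) - \<bar>F x - q\<bar>\<bar> < e/3"
        using N(2)[of x q "e/3"] x q \<open>e > 0\<close> by auto
      have "dist ((1 / h) * integral {x..x + h} (\<lambda>t. \<bar>f t - f x\<bar>)) 0 < e"
        if h: "0 < h" "h < min d (b - x)" for h
      proof -
        have eq: "integral {x..x + h} (\<lambda>t. \<bar>f t - f x\<bar>) = integral {x..x + h} (\<lambda>t. \<bar>F t - F x\<bar>)"
          by (rule integral_cong) (use h x in \<open>auto simp: F_def\<close>)
        also have "\<dots> \<le> integral {x..x + h} (\<lambda>t. \<bar>F t - q\<bar> + \<bar>F x - q\<bar>)"
          by (intro integral_le F integrable_add integrable_const_ivl) auto
        also have "\<dots> = integral {x..x + h} (\<lambda>t. \<bar>F t - q\<bar>) + h * \<bar>F x - q\<bar>"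
          using F h by (subst integral_add) auto
        finally have upper: "(1 / h) * integral {x..x + h} (\<lambda>t. \<bar>f t - f x\<bar>)
            \<le> (1 / h) * integral {x..x + h} (\<lambda>t. \<bar>F t - q\<bar>) + \<bar>F x - q\<bar>"
          using h by (simp add: field_simps)
        have "0 \<le> integral {x..x + h} (\<lambda>t. \<bar>f t - f x\<bar>)"
          unfolding eq by (intro integral_nonneg F) auto
        then have "0 \<le> (1 / h) * integral {x..x + h} (\<lambda>t. \<bar>f t - f x\<bar>)"
          using h by simp
        moreover have "\<bar>(1 / h) * integral {x..x + h} (\<lambda>t. \<bar>F t - q\<bar>) - \<bar>F x - q\<bar>\<bar> < e/3"
          using d(2)[of h] h by simp
        ultimately show ?thesis
          using q(2) upper unfolding dist_real_def by linarith
      qed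
      moreover have "eventually (\<lambda>h. 0 < h \<and> h < min d (b - x)) (at_right 0)"
        using d(1) x by (intro eventually_at_rightI[of 0 "min d (b - x)"]) auto
      ultimately show "eventually (\<lambda>h. dist ((1 / h) * integral {x..x + h} (\<lambda>t. \<bar>f t - f x\<bar>)) 0 < e) (at_right 0)"
        by (auto elim: eventually_mono)
    qed
  qed
qed

text \<open>
  As the mollifier has mass 1 and is at most \<open>B/\<epsilon>\<close>, the error is at most \<open>B\<close> times the mean of
  \<open>\<bar>f - f(x)\<bar>\<close> over \<open>[x, x+\<epsilon>]\<close>.
\<close>

lemma mollification_tendsto:
  fixes f \<rho> :: "real \<Rightarrow> real"
  assumes f: "f absolutely_integrable_on {a..b}" and x: "x \<in> {a..<b}"
    and point: "((\<lambda>h. (1 / h) * integral {x..x + h} (\<lambda>t. \<bar>f t - f x\<bar>)) \<longlongrightarrow> 0) (at_right 0)"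
    and \<rho>: "continuous_on UNIV \<rho>" "\<And>x. \<bar>\<rho> x\<bar> \<le> B" "\<And>x. x \<notin> {0<..<1} \<Longrightarrow> \<rho> x = 0"
      "\<And>\<epsilon>. \<epsilon> > 0 \<Longrightarrow> ((\<lambda>t. \<rho> ((t - x) / \<epsilon>) / \<epsilon>) has_integral 1) {x..x + \<epsilon>}"
  shows "((\<lambda>\<epsilon>. integral {a..b} (\<lambda>t. \<rho> ((t - x) / \<epsilon>) / \<epsilon> * f t)) \<longlongrightarrow> f x) (at_right 0)"
proof -
  have "((\<lambda>\<epsilon>. integral {a..b} (\<lambda>t. \<rho> ((t - x) / \<epsilon>) / \<epsilon> * f t) - f x) \<longlongrightarrow> 0) (at_right 0)"
  proof (rule Lim_null_comparison)
    have "((\<lambda>h. B * ((1 / h) * integral {x..x + h} (\<lambda>t. \<bar>f t - f x\<bar>))) \<longlongrightarrow> B * 0) (at_right 0)"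
      by (intro tendsto_mult tendsto_const point)
    then show "((\<lambda>h. B * ((1 / h) * integral {x..x + h} (\<lambda>t. \<bar>f t - f x\<bar>))) \<longlongrightarrow> 0) (at_right 0)"
      by simp
    have "norm (integral {a..b} (\<lambda>t. \<rho> ((t - x) / \<epsilon>) / \<epsilon> * f t) - f x)
        \<le> B * ((1 / \<epsilon>) * integral {x..x + \<epsilon>} (\<lambda>t. \<bar>f t - f x\<bar>))" if \<epsilon>: "0 < \<epsilon>" "\<epsilon> < b - x" for \<epsilon>
    proof -
      let ?r = "\<lambda>t. \<rho> ((t - x) / \<epsilon>) / \<epsilon>"
      have sub: "{x..x + \<epsilon>} \<subseteq> {a..b}" using \<epsilon> x by auto
      have r_cont: "continuous_on A ?r" for A
        by (intro continuous_intros continuous_on_compose2[OF \<rho>(1)]) (use \<epsilon> in auto)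
      have prod: "(\<lambda>t. ?r t * g t) integrable_on {x..x + \<epsilon>}"
        if "g absolutely_integrable_on {x..x + \<epsilon>}" for g
        using absolutely_integrable_continuous_mult[OF that r_cont]
        by (rule set_lebesgue_integral_eq_integral(1))
      have f': "f absolutely_integrable_on {x..x + \<epsilon>}"
        using absolutely_integrable_on_subinterval[OF f sub] .
      have diff': "(\<lambda>t. f t - f x) absolutely_integrable_on {x..x + \<epsilon>}"
        by (intro set_integral_diff f' absolutely_integrable_continuous_real continuous_intros)
      have "integral {a..b} (\<lambda>t. ?r t * f t) = integral {a..b} (\<lambda>t. if t \<in> {x..x+\<epsilon>} then ?r t * f t else 0)"
        by (rule integral_cong) (use \<rho>(3) \<epsilon> in \<open>auto simp: field_simps\<close>)
      also have "\<dots> = integral {x..x + \<epsilon>} (\<lambda>t. ?r t * f t)"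
        using sub by (simp only: integral_restrict_Int Int_absorb2)
      finally have "integral {a..b} (\<lambda>t. ?r t * f t) - f x
          = integral {x..x + \<epsilon>} (\<lambda>t. ?r t * f t) - integral {x..x + \<epsilon>} (\<lambda>t. ?r t * f x)"
        using integral_unique[OF has_integral_mult_left[OF \<rho>(4)[OF \<epsilon>(1)], of "f x"]] by simp
      also have "\<dots> = integral {x..x + \<epsilon>} (\<lambda>t. ?r t * (f t - f x))"
        unfolding right_diff_distrib
        by (rule integral_diff[symmetric])
           (intro prod f' absolutely_integrable_continuous_real continuous_on_const)+
      also have "norm \<dots> \<le> integral {x..x + \<epsilon>} (\<lambda>t. (B / \<epsilon>) * \<bar>f t - f x\<bar>)"
      proof (rule integral_norm_bound_integral[OF prod[OF diff']])
        show "(\<lambda>t. (B / \<epsilon>) * \<bar>f t - f x\<bar>) integrable_on {x..x + \<epsilon>}"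
          using diff' by (intro integrable_on_mult_right) (auto simp: absolutely_integrable_on_def)
        show "norm (?r t * (f t - f x)) \<le> (B / \<epsilon>) * \<bar>f t - f x\<bar>" for t
          using \<rho>(2)[of "(t - x) / \<epsilon>"] \<epsilon>
          by (auto simp: abs_mult intro!: mult_right_mono divide_right_mono)
      qed
      finally show ?thesis by simp
    qed
    moreover have "eventually (\<lambda>h. 0 < h \<and> h < b - x) (at_right 0)"
      using x by (intro eventually_at_rightI[of 0 "b - x"]) auto
    ultimately show "eventually (\<lambda>\<epsilon>. norm (integral {a..b} (\<lambda>t. \<rho> ((t - x) / \<epsilon>) / \<epsilon> * f t) - f x)
        \<le> B * ((1 / \<epsilon>) * integral {x..x + \<epsilon>} (\<lambda>t. \<bar>f t - f x\<bar>))) (at_right 0)"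
      by (auto elim: eventually_mono)
  qed
  then show ?thesis by (rule LIM_zero_cancel)
qed

text \<open>
  Testing with the ramp over \<open>[a,b]\<close>, the left side tends to \<open>f(a) - f(b)\<close> when \<open>a\<close> and \<open>b\<close> are
  Lebesgue points of \<open>f\<close>, and the right side to \<open>- \<integral>\<^sub>a\<^sup>b \<gamma>\<close> by dominated convergence.
\<close>

lemma weak_derivative_increments:
  fixes f \<gamma> :: "real \<Rightarrow> real"
  assumes f: "f absolutely_integrable_on {0..T}" and \<gamma>: "\<gamma> absolutely_integrable_on {0..T}"
    and weak: "\<And>\<phi>. \<phi> \<in> test_functions T \<Longrightarrow>
      integral {0..T} (\<lambda>t. deriv \<phi> t * f t) = - integral {0..T} (\<lambda>t. \<phi> t * \<gamma> t)"
  obtains N where "negligible N"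
    "\<And>s t. \<lbrakk>s \<in> {0<..<T} - N; t \<in> {0<..<T} - N; s \<le> t\<rbrakk> \<Longrightarrow> f t - f s = integral {s..t} \<gamma>"
proof (rule lebesgue_points[OF f], rule ramp_functions)
  fix N \<rho> B
  assume "negligible N" and N: "\<And>x. x \<in> {0..<T} - N \<Longrightarrow>
       ((\<lambda>h. (1 / h) * integral {x..x + h} (\<lambda>t. \<bar>f t - f x\<bar>)) \<longlongrightarrow> 0) (at_right 0)"
    and \<rho>: "continuous_on UNIV \<rho>" "\<And>x. \<bar>\<rho> x\<bar> \<le> B" "\<And>x. x \<notin> {0<..<1} \<Longrightarrow> \<rho> x = 0"
    "\<And>x \<epsilon>. \<epsilon> > 0 \<Longrightarrow> ((\<lambda>t. \<rho> ((t - x) / \<epsilon>) / \<epsilon>) has_integral 1) {x..x + \<epsilon>}"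
    and ramp: "\<And>T a b \<epsilon>. \<lbrakk>0 < a; 0 < \<epsilon>; a + \<epsilon> < b; b + \<epsilon> < T\<rbrakk> \<Longrightarrow> \<exists>\<phi>\<in>test_functions T.
       (\<forall>t. deriv \<phi> t = \<rho> ((t - a) / \<epsilon>) / \<epsilon> - \<rho> ((t - b) / \<epsilon>) / \<epsilon>) \<and>
       (\<forall>t. \<bar>\<phi> t\<bar> \<le> 1) \<and> (\<forall>t\<in>{a+\<epsilon>..b}. \<phi> t = 1) \<and> (\<forall>t. t \<le> a \<or> b + \<epsilon> \<le> t \<longrightarrow> \<phi> t = 0)"
  have "f b - f a = integral {a..b} \<gamma>"
    if a: "a \<in> {0<..<T} - N" and b: "b \<in> {0<..<T} - N" and "a < b" for a b
  proof -
    define \<epsilon> where "\<epsilon> n = min (b - a) (T - b) / (real n + 2)" for n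
    have m: "min (b - a) (T - b) > 0" using a b \<open>a < b\<close> by auto
    have \<epsilon>: "\<epsilon> n > 0" "\<epsilon> n < min (b - a) (T - b)" for n
    proof -
      show "\<epsilon> n > 0" unfolding \<epsilon>_def using m by (intro divide_pos_pos) auto
      have "\<epsilon> n * (real n + 2) = min (b - a) (T - b)" unfolding \<epsilon>_def by simp
      moreover have "\<epsilon> n * 1 < \<epsilon> n * (real n + 2)"
        by (rule mult_strict_left_mono) (use \<open>\<epsilon> n > 0\<close> in auto)
      ultimately show "\<epsilon> n < min (b - a) (T - b)" by linarith
    qed
    have "\<epsilon> \<longlonglongrightarrow> 0"
      unfolding \<epsilon>_def by real_asymp
    then have \<epsilon>_lim: "filterlim \<epsilon> (at_right 0) sequentially"
      using \<epsilon>(1) by (intro tendsto_imp_filterlim_at_right) auto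
    have moll: "(\<lambda>n. integral {0..T} (\<lambda>t. \<rho> ((t - x) / \<epsilon> n) / \<epsilon> n * f t)) \<longlonglongrightarrow> f x"
      if "x \<in> {0<..<T} - N" for x
      using that by (intro filterlim_compose[OF mollification_tendsto[OF f _ N \<rho>] \<epsilon>_lim]) auto
    have "\<exists>\<phi>\<in>test_functions T.
       (\<forall>t. deriv \<phi> t = \<rho> ((t - a) / \<epsilon> n) / \<epsilon> n - \<rho> ((t - b) / \<epsilon> n) / \<epsilon> n) \<and>
       (\<forall>t. \<bar>\<phi> t\<bar> \<le> 1) \<and> (\<forall>t\<in>{a+\<epsilon> n..b}. \<phi> t = 1) \<and> (\<forall>t. t \<le> a \<or> b + \<epsilon> n \<le> t \<longrightarrow> \<phi> t = 0)" for n
      using \<epsilon>[of n] a by (intro ramp) auto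
    then obtain \<phi> where \<phi>: "\<And>n. \<phi> n \<in> test_functions T"
      "\<And>n t. deriv (\<phi> n) t = \<rho> ((t - a) / \<epsilon> n) / \<epsilon> n - \<rho> ((t - b) / \<epsilon> n) / \<epsilon> n"
      "\<And>n t. \<bar>\<phi> n t\<bar> \<le> 1" "\<And>n t. t \<in> {a + \<epsilon> n..b} \<Longrightarrow> \<phi> n t = 1"
      "\<And>n t. t \<le> a \<or> b + \<epsilon> n \<le> t \<Longrightarrow> \<phi> n t = 0"
      by metis
    have \<phi>_cont: "continuous_on A (\<phi> n)" for n A
    proof -
      have "((deriv ^^ 0) (\<phi> n)) differentiable (at x)" for x
        using \<phi>(1)[of n] unfolding test_functions_def by blast
      then show ?thesis
        by (auto intro!: continuous_at_imp_continuous_on differentiable_imp_continuous_within)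
    qed
    have \<rho>_cont: "continuous_on A (\<lambda>t. \<rho> ((t - x) / \<epsilon> n) / \<epsilon> n)" for x n A
      by (intro continuous_intros continuous_on_compose2[OF \<rho>(1)]) (use \<epsilon>(1)[of n] in auto)
    have "integral {0..T} (\<lambda>t. deriv (\<phi> n) t * f t)
        = integral {0..T} (\<lambda>t. \<rho> ((t - a) / \<epsilon> n) / \<epsilon> n * f t)
          - integral {0..T} (\<lambda>t. \<rho> ((t - b) / \<epsilon> n) / \<epsilon> n * f t)" for n
      unfolding \<phi>(2) left_diff_distrib
      by (intro integral_diff set_lebesgue_integral_eq_integral(1)[OF absolutely_integrable_continuous_mult[OF f]] \<rho>_cont)
    then have "(\<lambda>n. integral {0..T} (\<lambda>t. deriv (\<phi> n) t * f t)) \<longlonglongrightarrow> f a - f b"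
      using moll[OF a] moll[OF b] by (simp add: tendsto_diff)
    then have "(\<lambda>n. - integral {0..T} (\<lambda>t. \<phi> n t * \<gamma> t)) \<longlonglongrightarrow> f a - f b"
      using weak[OF \<phi>(1)] by simp
    moreover have "(\<lambda>n. - integral {0..T} (\<lambda>t. \<phi> n t * \<gamma> t)) \<longlonglongrightarrow>
        - integral {0..T} (\<lambda>t. if t \<in> {a<..b} then \<gamma> t else 0)"
    proof (intro tendsto_minus dominated_convergence(2)[where h="\<lambda>t. \<bar>\<gamma> t\<bar>"])
      show "(\<lambda>t. \<phi> n t * \<gamma> t) integrable_on {0..T}" for n
        by (intro set_lebesgue_integral_eq_integral(1)[OF absolutely_integrable_continuous_mult[OF \<gamma>]] \<phi>_cont)
      show "(\<lambda>t. \<bar>\<gamma> t\<bar>) integrable_on {0..T}"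
        using \<gamma> by (simp add: absolutely_integrable_on_def)
      show "norm (\<phi> n t * \<gamma> t) \<le> \<bar>\<gamma> t\<bar>" for n t
        using mult_right_mono[OF \<phi>(3)[of n t], of "\<bar>\<gamma> t\<bar>"] by (simp add: abs_mult)
      fix t assume "t \<in> {0..T}"
      have ev: "eventually (\<lambda>n. \<epsilon> n < d) sequentially" if "d > 0" for d
        using order_tendstoD(2)[OF \<open>\<epsilon> \<longlonglongrightarrow> 0\<close> that] .
      consider "t \<le> a" | "a < t" "t \<le> b" | "b < t" by linarith
      then have "eventually (\<lambda>n. \<phi> n t * \<gamma> t = (if t \<in> {a<..b} then \<gamma> t else 0)) sequentially"
      proof cases
        case 1
        then show ?thesis using \<phi>(5) by auto
      next
        case 2
        then have "eventually (\<lambda>n. \<epsilon> n < t - a) sequentially" by (intro ev) auto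
        then show ?thesis by (rule eventually_mono) (use 2 \<phi>(4) in auto)
      next
        case 3
        then have "eventually (\<lambda>n. \<epsilon> n < t - b) sequentially" by (intro ev) auto
        then show ?thesis by (rule eventually_mono) (use 3 \<phi>(5) in auto)
      qed
      then show "(\<lambda>n. \<phi> n t * \<gamma> t) \<longlonglongrightarrow> (if t \<in> {a<..b} then \<gamma> t else 0)"
        by (rule tendsto_eventually)
    qed
    ultimately have "f a - f b = - integral {0..T} (\<lambda>t. if t \<in> {a<..b} then \<gamma> t else 0)"
      by (rule LIMSEQ_unique)
    also have "integral {0..T} (\<lambda>t. if t \<in> {a<..b} then \<gamma> t else 0) = integral ({a<..b} \<inter> {0..T}) \<gamma>"
      by (rule integral_restrict_Int)
    also have "\<dots> = integral {a..b} \<gamma>"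
    proof (rule integral_subset_negligible)
      have "{a..b} - {a<..b} \<inter> {0..T} \<subseteq> {a}" using a b by auto
      then show "negligible ({a..b} - {a<..b} \<inter> {0..T})" using negligible_subset by blast
    qed auto
    finally show ?thesis by simp
  qed
  moreover have "f t - f t = integral {t..t} \<gamma>" for t
    by simp
  ultimately show thesis
    by (intro that[OF \<open>negligible N\<close>]) (metis order_le_less)
qed

section \<open>Strong measurability and square integrable functions\<close>

lemma sets_Xi: "{0<..<T} \<in> sets (lebesgue :: real measure)"
  by simp

lemma finite_measure_Xi: "finite_measure (Xi T)"
  by (rule finite_measure_lebesgue_on) simp

lemma strongly_measurable_compose2:
  assumes f: "strongly_measurable M f" and g: "strongly_measurable M g"
    and h: "\<And>X Y p q. X \<longlonglongrightarrow> p \<Longrightarrow> Y \<longlonglongrightarrow> q \<Longrightarrow> (\<lambda>n. h (X n) (Y n)) \<longlonglongrightarrow> h p q"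
  shows "strongly_measurable M (\<lambda>x. h (f x) (g x))"
proof -
  obtain s r where s: "\<And>i::nat. simple_function M (s i)" "AE x in M. (\<lambda>i. s i x) \<longlonglongrightarrow> f x"
    and r: "\<And>i::nat. simple_function M (r i)" "AE x in M. (\<lambda>i. r i x) \<longlonglongrightarrow> g x"
    using f g unfolding strongly_measurable_def by blast
  have "AE x in M. (\<lambda>i. h (s i x) (r i x)) \<longlonglongrightarrow> h (f x) (g x)"
    using s(2) r(2) by eventually_elim (rule h)
  then show ?thesis
    unfolding strongly_measurable_def
    using simple_function_compose2[OF s(1) r(1), of h] by (intro exI[of _ "\<lambda>i x. h (s i x) (r i x)"]) auto
qed

lemma strongly_measurable_compose:
  assumes "strongly_measurable M f" "\<And>X p. X \<longlonglongrightarrow> p \<Longrightarrow> (\<lambda>n. h (X n)) \<longlonglongrightarrow> h p"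
  shows "strongly_measurable M (\<lambda>x. h (f x))"
  using strongly_measurable_compose2[OF assms(1) assms(1), of "\<lambda>a b. h a"] assms(2) by blast

text \<open>
  Completeness of the Lebesgue measure is what allows the simple functions to converge only almost
  everywhere.
\<close>

lemma strongly_measurable_imp_borel_measurable:
  fixes f :: "'a::euclidean_space \<Rightarrow> real"
  assumes f: "strongly_measurable (lebesgue_on S) f" and S: "S \<in> sets lebesgue"
  shows "f \<in> borel_measurable (lebesgue_on S)"
proof -
  obtain s where s: "\<And>i::nat. simple_function (lebesgue_on S) (s i)"
      "AE x in lebesgue_on S. (\<lambda>i. s i x) \<longlonglongrightarrow> f x"
    using f unfolding strongly_measurable_def by blast
  have S': "S \<inter> space lebesgue \<in> sets lebesgue" using S by simp
  have "(\<lambda>x. indicator S x *\<^sub>R s i x) \<in> borel_measurable lebesgue" for i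
    using borel_measurable_simple_function[OF s(1)[of i]] borel_measurable_restrict_space_iff[OF S'] by blast
  then have "(\<lambda>x. lim (\<lambda>i. indicator S x *\<^sub>R s i x)) \<in> borel_measurable lebesgue"
    by (rule borel_measurable_lim_metric)
  moreover have "AE x in lebesgue. lim (\<lambda>i. indicator S x *\<^sub>R s i x) = indicator S x *\<^sub>R f x"
    using s(2) unfolding AE_restrict_space_iff[OF S']
    by eventually_elim (auto simp: indicator_def intro: limI)
  ultimately have "(\<lambda>x. indicator S x *\<^sub>R f x) \<in> borel_measurable lebesgue"
    by (rule borel_measurable_AE)
  then show ?thesis
    using borel_measurable_restrict_space_iff[OF S', of f] by blast
qed

lemma borel_measurable_imp_strongly_measurable:
  fixes f :: "'a \<Rightarrow> real"
  assumes "f \<in> borel_measurable M"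
  shows "strongly_measurable M f"
  using borel_measurable_implies_sequence_metric[OF assms, of 0]
  unfolding strongly_measurable_def by (auto intro: AE_I2)

lemma L2_norm_measurable:
  fixes f :: "real \<Rightarrow> 'b::real_normed_vector"
  assumes "strongly_measurable (Xi T) f"
  shows "(\<lambda>t. norm (f t)) \<in> borel_measurable (Xi T)"
  by (rule strongly_measurable_imp_borel_measurable[OF strongly_measurable_compose[OF assms]])
     (auto intro: tendsto_norm)

lemma L2D:
  assumes "f \<in> L2 T"
  shows "strongly_measurable (Xi T) f" "(\<lambda>t. norm (f t)) \<in> borel_measurable (Xi T)"
    "integrable (Xi T) (\<lambda>t. (norm (f t))\<^sup>2)"
  using assms L2_norm_measurable unfolding L2_def by auto

lemma L2I:
  assumes "strongly_measurable (Xi T) f" "integrable (Xi T) h"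
    "AE t in Xi T. (norm (f t))\<^sup>2 \<le> h t"
  shows "f \<in> L2 T"
proof -
  have "integrable (Xi T) (\<lambda>t. (norm (f t))\<^sup>2)"
  proof (rule Bochner_Integration.integrable_bound[OF assms(2)])
    show "(\<lambda>t. (norm (f t))\<^sup>2) \<in> borel_measurable (Xi T)"
      using L2_norm_measurable[OF assms(1)] by measurable
    show "AE t in Xi T. norm ((norm (f t))\<^sup>2) \<le> norm (h t)"
      using assms(3) by eventually_elim (smt (verit) real_norm_def zero_le_power2)
  qed
  then show ?thesis using assms(1) by (simp add: L2_def)
qed

lemma L2_norm_nonneg: "L2_norm T f \<ge> 0"
  by (simp add: L2_norm_def)

lemma L2_norm_power2: "(L2_norm T f)\<^sup>2 = (LINT t|Xi T. (norm (f t))\<^sup>2)"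
  by (simp add: L2_norm_def)

lemma norm_add_power2_le: "(norm (x + y))\<^sup>2 \<le> 2 * (norm x)\<^sup>2 + 2 * (norm y)\<^sup>2"
proof -
  have "(norm (x + y))\<^sup>2 \<le> (norm x + norm y)\<^sup>2"
    by (intro power_mono norm_triangle_ineq) simp
  also have "\<dots> \<le> 2 * (norm x)\<^sup>2 + 2 * (norm y)\<^sup>2"
    using sum_squares_bound[of "norm x" "norm y"] by (simp add: power2_sum)
  finally show ?thesis .
qed

lemma L2_add:
  assumes "f \<in> L2 T" "g \<in> L2 T"
  shows "(\<lambda>t. f t + g t) \<in> L2 T"
proof (rule L2I)
  show "strongly_measurable (Xi T) (\<lambda>t. f t + g t)"
    by (rule strongly_measurable_compose2[OF L2D(1) L2D(1)]) (auto intro: assms tendsto_add)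
  show "integrable (Xi T) (\<lambda>t. 2 * (norm (f t))\<^sup>2 + 2 * (norm (g t))\<^sup>2)"
    using L2D(3)[OF assms(1)] L2D(3)[OF assms(2)] by auto
qed (simp add: norm_add_power2_le)

lemma L2_scaleR:
  assumes "f \<in> L2 T" shows "(\<lambda>t. c *\<^sub>R f t) \<in> L2 T"
proof (rule L2I)
  show "strongly_measurable (Xi T) (\<lambda>t. c *\<^sub>R f t)"
    by (rule strongly_measurable_compose[OF L2D(1)[OF assms]]) (auto intro: tendsto_intros)
  show "integrable (Xi T) (\<lambda>t. c\<^sup>2 * (norm (f t))\<^sup>2)"
    using L2D(3)[OF assms] by auto
qed (simp add: power_mult_distrib)

lemma L2_diff:
  assumes "f \<in> L2 T" "g \<in> L2 T"
  shows "(\<lambda>t. f t - g t) \<in> L2 T"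
  using L2_add[OF assms(1) L2_scaleR[OF assms(2), of "-1"]] by simp

lemma L2_const: "(\<lambda>t. v) \<in> L2 T"
  by (rule L2I[where h="\<lambda>_. (norm v)\<^sup>2"])
     (auto simp: strongly_measurable_def finite_measure.integrable_const[OF finite_measure_Xi]
       intro!: exI[of _ "\<lambda>_ _. v"])

lemma L2_norm_scaleR: "L2_norm T (\<lambda>t. c *\<^sub>R f t) = \<bar>c\<bar> * L2_norm T f"
  by (simp add: L2_norm_def power_mult_distrib real_sqrt_mult)

lemma L2_norm_diff_commute: "L2_norm T (\<lambda>t. f t - g t) = L2_norm T (\<lambda>t. g t - f t)"
  by (simp add: L2_norm_def norm_minus_commute)

text \<open>
  The optimal parameter is \<open>k = sqrt (B / A)\<close>; the perturbation by \<open>d\<close> in the proof covers the cases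
  \<open>A = 0\<close> and \<open>B = 0\<close> as well.
\<close>

lemma le_sqrt_mult_sqrt:
  fixes A B c :: real
  assumes "A \<ge> 0" "B \<ge> 0" and *: "\<And>k. k > 0 \<Longrightarrow> 2 * c \<le> k * A + B / k"
  shows "c \<le> sqrt A * sqrt B"
proof (rule field_le_epsilon)
  fix e :: real assume "e > 0"
  define a b where "a = sqrt A" and "b = sqrt B"
  have ab: "a \<ge> 0" "b \<ge> 0" "A = a * a" "B = b * b"
    using assms by (auto simp: a_def b_def)
  define d where "d = min 1 (e / (a + b + 1))"
  have "d > 0" "d \<le> 1" unfolding d_def using ab \<open>e > 0\<close> by auto
  have d: "d * (a + b + 1) \<le> e"
  proof -
    have "d * (a + b + 1) \<le> e / (a + b + 1) * (a + b + 1)"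
      unfolding d_def using ab by (intro mult_right_mono) auto
    then show ?thesis using ab by simp
  qed
  have "2 * c \<le> (b + d) / (a + d) * A + B / ((b + d) / (a + d))"
    using ab \<open>d > 0\<close> by (intro *) (simp add: add_nonneg_pos)
  also have "(b + d) / (a + d) * A \<le> (b + d) * a"
    unfolding ab(3) using ab \<open>d > 0\<close>
    by (simp add: divide_simps add_nonneg_pos) (simp add: algebra_simps add_nonneg_nonneg)
  also have "B / ((b + d) / (a + d)) \<le> (a + d) * b"
    unfolding ab(4) using ab \<open>d > 0\<close>
    by (simp add: divide_simps add_nonneg_pos) (simp add: algebra_simps add_nonneg_nonneg)
  finally have "2 * c \<le> 2 * (a * b) + d * (a + b)" by (simp add: algebra_simps)
  moreover have "d * (a + b) \<le> d * (a + b + 1)" using \<open>d > 0\<close> by simp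
  ultimately have "c \<le> a * b + e"
    using d \<open>e > 0\<close> by linarith
  then show "c \<le> sqrt A * sqrt B + e" by (simp add: a_def b_def)
qed

lemma weighted_Young:
  fixes a b k :: real
  assumes "k > 0"
  shows "2 * (a * b) \<le> k * a\<^sup>2 + b\<^sup>2 / k"
proof -
  have "0 \<le> (k * a - b)\<^sup>2 / k" using assms by simp
  also have "\<dots> = k * a\<^sup>2 + b\<^sup>2 / k - 2 * (a * b)"
    using assms by (simp add: field_simps power2_eq_square)
  finally show ?thesis by simp
qed

lemma L2_Cauchy_Schwarz:
  assumes f: "f \<in> L2 T" and g: "g \<in> L2 T"
  shows "integrable (Xi T) (\<lambda>t. norm (f t) * norm (g t))"
    "(LINT t|Xi T. norm (f t) * norm (g t)) \<le> L2_norm T f * L2_norm T g"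
proof -
  have i: "integrable (Xi T) (\<lambda>t. k * (norm (f t))\<^sup>2 + (norm (g t))\<^sup>2 / k)" for k
    using L2D(3)[OF f] L2D(3)[OF g] by auto
  show int: "integrable (Xi T) (\<lambda>t. norm (f t) * norm (g t))"
  proof (rule Bochner_Integration.integrable_bound[OF i[of 1]])
    show "(\<lambda>t. norm (f t) * norm (g t)) \<in> borel_measurable (Xi T)"
      using L2D(2)[OF f] L2D(2)[OF g] by measurable
    have "norm (norm (f t) * norm (g t)) \<le> norm (1 * (norm (f t))\<^sup>2 + (norm (g t))\<^sup>2 / 1)" for t
    proof -
      have "0 \<le> norm (f t) * norm (g t)" by simp
      then show ?thesis using weighted_Young[of 1 "norm (f t)" "norm (g t)"]
        unfolding real_norm_def by (smt (verit) div_by_1)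
    qed
    then show "AE t in Xi T. norm (norm (f t) * norm (g t)) \<le> norm (1 * (norm (f t))\<^sup>2 + (norm (g t))\<^sup>2 / 1)"
      by simp
  qed
  show "(LINT t|Xi T. norm (f t) * norm (g t)) \<le> L2_norm T f * L2_norm T g"
    unfolding L2_norm_def
  proof (rule le_sqrt_mult_sqrt)
    fix k :: real assume "k > 0"
    have "2 * (LINT t|Xi T. norm (f t) * norm (g t)) = (LINT t|Xi T. 2 * (norm (f t) * norm (g t)))"
      by simp
    also have "\<dots> \<le> (LINT t|Xi T. k * (norm (f t))\<^sup>2 + (norm (g t))\<^sup>2 / k)"
      using int i weighted_Young[OF \<open>k > 0\<close>] by (intro integral_mono) auto
    also have "\<dots> = k * (LINT t|Xi T. (norm (f t))\<^sup>2) + (LINT t|Xi T. (norm (g t))\<^sup>2) / k"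
      using L2D(3)[OF f] L2D(3)[OF g] by simp
    finally show "2 * (LINT t|Xi T. norm (f t) * norm (g t))
      \<le> k * (LINT t|Xi T. (norm (f t))\<^sup>2) + (LINT t|Xi T. (norm (g t))\<^sup>2) / k" .
  qed auto
qed

lemma L2_norm_triangle:
  assumes f: "f \<in> L2 T" and g: "g \<in> L2 T"
  shows "L2_norm T (\<lambda>t. f t + g t) \<le> L2_norm T f + L2_norm T g"
proof (rule power2_le_imp_le)
  have "(L2_norm T (\<lambda>t. f t + g t))\<^sup>2 = (LINT t|Xi T. (norm (f t + g t))\<^sup>2)"
    by (rule L2_norm_power2)
  also have "\<dots> \<le> (LINT t|Xi T. (norm (f t))\<^sup>2 + 2 * (norm (f t) * norm (g t)) + (norm (g t))\<^sup>2)"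
  proof (rule integral_mono)
    show "integrable (Xi T) (\<lambda>t. (norm (f t + g t))\<^sup>2)"
      using L2D(3)[OF L2_add[OF f g]] .
    show "integrable (Xi T) (\<lambda>t. (norm (f t))\<^sup>2 + 2 * (norm (f t) * norm (g t)) + (norm (g t))\<^sup>2)"
      using L2D(3)[OF f] L2D(3)[OF g] L2_Cauchy_Schwarz(1)[OF f g] by auto
    show "(norm (f t + g t))\<^sup>2 \<le> (norm (f t))\<^sup>2 + 2 * (norm (f t) * norm (g t)) + (norm (g t))\<^sup>2" for t
      using power_mono[OF norm_triangle_ineq[of "f t" "g t"] norm_ge_zero, of 2]
      by (simp add: power2_sum algebra_simps)
  qed
  also have "\<dots> = (L2_norm T f)\<^sup>2 + 2 * (LINT t|Xi T. norm (f t) * norm (g t)) + (L2_norm T g)\<^sup>2"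
    unfolding L2_norm_power2 using L2D(3)[OF f] L2D(3)[OF g] L2_Cauchy_Schwarz(1)[OF f g] by simp
  also have "\<dots> \<le> (L2_norm T f + L2_norm T g)\<^sup>2"
    using L2_Cauchy_Schwarz(2)[OF f g] by (simp add: power2_sum)
  finally show "(L2_norm T (\<lambda>t. f t + g t))\<^sup>2 \<le> (L2_norm T f + L2_norm T g)\<^sup>2" .
qed (simp add: L2_norm_nonneg)

lemma L2_pairing:
  fixes g :: "real \<Rightarrow> 'v::real_normed_vector \<Rightarrow>\<^sub>L real"
  assumes g: "g \<in> L2 T" and w: "w \<in> L2 T"
  shows "integrable (Xi T) (\<lambda>t. blinfun_apply (g t) (w t))"
    "\<bar>LINT t|Xi T. blinfun_apply (g t) (w t)\<bar> \<le> L2_norm T g * L2_norm T w"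
proof -
  have "strongly_measurable (Xi T) (\<lambda>t. blinfun_apply (g t) (w t))"
    by (rule strongly_measurable_compose2[OF L2D(1)[OF g] L2D(1)[OF w]]) (rule blinfun.tendsto)
  then have meas: "(\<lambda>t. blinfun_apply (g t) (w t)) \<in> borel_measurable (Xi T)"
    by (rule strongly_measurable_imp_borel_measurable) simp
  have le: "norm (blinfun_apply (g t) (w t)) \<le> norm (g t) * norm (w t)" for t
    by (rule norm_blinfun)
  show int: "integrable (Xi T) (\<lambda>t. blinfun_apply (g t) (w t))"
    by (rule Bochner_Integration.integrable_bound[OF L2_Cauchy_Schwarz(1)[OF g w] meas])
       (use le in auto)
  have "\<bar>LINT t|Xi T. blinfun_apply (g t) (w t)\<bar> \<le> (LINT t|Xi T. norm (blinfun_apply (g t) (w t)))"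
    using integral_norm_bound[of "Xi T" "\<lambda>t. blinfun_apply (g t) (w t)"] by simp
  also have "\<dots> \<le> (LINT t|Xi T. norm (g t) * norm (w t))"
    using int L2_Cauchy_Schwarz(1)[OF g w] le by (intro integral_mono) auto
  also have "\<dots> \<le> L2_norm T g * L2_norm T w"
    by (rule L2_Cauchy_Schwarz(2)[OF g w])
  finally show "\<bar>LINT t|Xi T. blinfun_apply (g t) (w t)\<bar> \<le> L2_norm T g * L2_norm T w" .
qed

lemma continuous_in_L2:
  fixes f :: "real \<Rightarrow> real"
  assumes "continuous_on UNIV f"
  shows "f \<in> L2 T"
proof -
  have "f \<in> borel_measurable lborel"
    using assms by (simp add: borel_measurable_continuous_onI)
  then have meas: "f \<in> borel_measurable (Xi T)"
    by (meson measurable_completion measurable_restrict_space1)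
  obtain B where "\<forall>x\<in>{0..T}. norm (f x) \<le> B"
    using assms compact_continuous_image[of "{0..T}" f] compact_imp_bounded bounded_iff
    by (metis compact_Icc continuous_on_subset image_eqI subset_UNIV)
  then have "(norm (f x))\<^sup>2 \<le> B\<^sup>2" if "x \<in> {0<..<T}" for x
    using that by (intro power_mono) auto
  with meas show ?thesis
    using finite_measure.integrable_const[OF finite_measure_Xi, of T "B\<^sup>2"]
    by (intro L2I[where h="\<lambda>_. B\<^sup>2"] borel_measurable_imp_strongly_measurable AE_I2) auto
qed

lemma L2_real_scaleR_const:
  fixes f :: "real \<Rightarrow> real" and v :: "'b::real_normed_vector"
  assumes "f \<in> L2 T"
  shows "(\<lambda>t. f t *\<^sub>R v) \<in> L2 T" "L2_norm T (\<lambda>t. f t *\<^sub>R v) = norm v * L2_norm T f"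
proof -
  show "(\<lambda>t. f t *\<^sub>R v) \<in> L2 T"
  proof (rule L2I)
    show "strongly_measurable (Xi T) (\<lambda>t. f t *\<^sub>R v)"
      by (rule strongly_measurable_compose[OF L2D(1)[OF assms]]) (auto intro: tendsto_intros)
    show "integrable (Xi T) (\<lambda>t. (norm (f t))\<^sup>2 * (norm v)\<^sup>2)"
      using L2D(3)[OF assms] by auto
  qed (simp add: power_mult_distrib)
  show "L2_norm T (\<lambda>t. f t *\<^sub>R v) = norm v * L2_norm T f"
    by (simp add: L2_norm_def power_mult_distrib real_sqrt_mult)
qed

lemma L2_norm_tendsto_0:
  fixes f :: "nat \<Rightarrow> real \<Rightarrow> 'b::real_normed_vector"
  assumes f: "\<And>n. f n \<in> L2 T" and h: "integrable (Xi T) h"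
    and lim: "AE t in Xi T. (\<lambda>n. f n t) \<longlonglongrightarrow> 0"
    and dom: "\<And>n t. (norm (f n t))\<^sup>2 \<le> h t"
  shows "(\<lambda>n. L2_norm T (f n)) \<longlonglongrightarrow> 0"
proof -
  have "(\<lambda>n. LINT t|Xi T. (norm (f n t))\<^sup>2) \<longlonglongrightarrow> (LINT t|Xi T. 0)"
  proof (rule integral_dominated_convergence[OF _ _ h])
    show "(\<lambda>t. (norm (f n t))\<^sup>2) \<in> borel_measurable (Xi T)" for n
      using L2D(3)[OF f] by auto
    show "AE t in Xi T. (\<lambda>n. (norm (f n t))\<^sup>2) \<longlonglongrightarrow> 0"
      using lim by eventually_elim (auto intro: tendsto_eq_intros)
  qed (use dom in auto)
  then show ?thesis
    unfolding L2_norm_def using tendsto_real_sqrt by fastforce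
qed

section \<open>Density of continuous functions\<close>

definition continuous_approximable :: "real \<Rightarrow> (real \<Rightarrow> 'b::real_normed_vector) \<Rightarrow> bool" where
  "continuous_approximable T f \<longleftrightarrow> f \<in> L2 T \<and>
     (\<forall>e>0. \<exists>y\<in>L2 T. continuous_on UNIV y \<and> L2_norm T (\<lambda>t. f t - y t) < e)"

lemma continuous_approximable_add:
  assumes f: "continuous_approximable T f" and g: "continuous_approximable T g"
  shows "continuous_approximable T (\<lambda>t. f t + g t)"
  unfolding continuous_approximable_def
proof (intro conjI allI impI)
  show "(\<lambda>t. f t + g t) \<in> L2 T"
    using f g L2_add unfolding continuous_approximable_def by blast
  fix e :: real assume "e > 0"
  obtain y z where y: "y \<in> L2 T" "continuous_on UNIV y" "L2_norm T (\<lambda>t. f t - y t) < e/2"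
    and z: "z \<in> L2 T" "continuous_on UNIV z" "L2_norm T (\<lambda>t. g t - z t) < e/2"
    using f g \<open>e > 0\<close> unfolding continuous_approximable_def by (meson half_gt_zero)
  have "L2_norm T (\<lambda>t. (f t - y t) + (g t - z t)) \<le> L2_norm T (\<lambda>t. f t - y t) + L2_norm T (\<lambda>t. g t - z t)"
    using f g y z unfolding continuous_approximable_def by (intro L2_norm_triangle L2_diff) auto
  then show "\<exists>y\<in>L2 T. continuous_on UNIV y \<and> L2_norm T (\<lambda>t. f t + g t - y t) < e"
    using y z by (intro bexI[of _ "\<lambda>t. y t + z t"] conjI continuous_on_add L2_add)
      (auto simp: algebra_simps)
qed

lemma continuous_approximable_limit:
  assumes f: "f \<in> L2 T" and s: "\<And>n. continuous_approximable T (s n)"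
    and lim: "(\<lambda>n. L2_norm T (\<lambda>t. s n t - f t)) \<longlonglongrightarrow> 0"
  shows "continuous_approximable T f"
  unfolding continuous_approximable_def
proof (intro conjI allI impI f)
  fix e :: real assume "e > 0"
  then have "eventually (\<lambda>n. L2_norm T (\<lambda>t. s n t - f t) < e/2) sequentially"
    using order_tendstoD(2)[OF lim, of "e/2"] by auto
  then obtain n where n: "L2_norm T (\<lambda>t. s n t - f t) < e/2"
    by (auto simp: eventually_sequentially)
  obtain y where y: "y \<in> L2 T" "continuous_on UNIV y" "L2_norm T (\<lambda>t. s n t - y t) < e/2"
    using s[of n] \<open>e > 0\<close> unfolding continuous_approximable_def by (meson half_gt_zero)
  have "L2_norm T (\<lambda>t. (f t - s n t) + (s n t - y t)) \<le> L2_norm T (\<lambda>t. f t - s n t) + L2_norm T (\<lambda>t. s n t - y t)"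
    using f s y unfolding continuous_approximable_def by (intro L2_norm_triangle L2_diff) auto
  then show "\<exists>y\<in>L2 T. continuous_on UNIV y \<and> L2_norm T (\<lambda>t. f t - y t) < e"
    using y n L2_norm_diff_commute[of T "s n" f] by (intro bexI[of _ y]) auto
qed

text \<open>
  The indicator of a measurable set is an almost everywhere limit of continuous functions, which may
  be truncated to values in \<open>[0,1]\<close>.
\<close>

lemma continuous_approximable_indicator:
  fixes v :: "'b::real_normed_vector"
  assumes E: "E \<in> sets lebesgue"
  shows "continuous_approximable T (\<lambda>t. indicator E t *\<^sub>R v)"
proof -
  have ind: "(indicator E :: real \<Rightarrow> real) \<in> L2 T"
  proof (rule L2I[where h="\<lambda>_. 1"])
    show "strongly_measurable (Xi T) (indicator E :: real \<Rightarrow> real)"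
      by (intro borel_measurable_imp_strongly_measurable measurable_restrict_space1) (use E in auto)
    show "integrable (Xi T) (\<lambda>_. 1::real)"
      by (rule finite_measure.integrable_const[OF finite_measure_Xi])
  qed (auto simp: indicator_def)
  have "(indicator E :: real \<Rightarrow> real) measurable_on UNIV"
    using E by (intro lebesgue_measurable_imp_measurable_on) auto
  then obtain N g where N: "negligible N" and g: "\<And>n::nat. continuous_on UNIV (g n)"
    "\<And>x. x \<notin> N \<Longrightarrow> (\<lambda>n. g n x) \<longlonglongrightarrow> indicat_real E x"
    unfolding measurable_on_def by auto
  define k where "k n x = max 0 (min 1 (g n x))" for n x
  have k_cont: "continuous_on UNIV (k n)" for n
    unfolding k_def by (intro continuous_intros g(1))
  have "(\<lambda>n. L2_norm T (\<lambda>t. k n t - indicator E t)) \<longlonglongrightarrow> 0"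
  proof (rule L2_norm_tendsto_0[where h="\<lambda>_. 1"])
    show "(\<lambda>t. k n t - indicator E t) \<in> L2 T" for n
      by (intro L2_diff continuous_in_L2 k_cont ind)
    show "integrable (Xi T) (\<lambda>_. 1::real)"
      by (rule finite_measure.integrable_const[OF finite_measure_Xi])
    have "(\<lambda>n. k n t - indicator E t) \<longlonglongrightarrow> 0" if "t \<notin> N" for t
    proof -
      have "(\<lambda>n. k n t) \<longlonglongrightarrow> max 0 (min 1 (indicator E t))"
        unfolding k_def by (intro tendsto_intros g(2) that)
      then have "(\<lambda>n. k n t) \<longlonglongrightarrow> indicator E t"
        by (simp add: indicator_def split: if_splits)
      then show ?thesis by (simp add: LIM_zero_iff)
    qed
    then show "AE t in Xi T. (\<lambda>n. k n t - indicator E t) \<longlonglongrightarrow> 0"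
      using N unfolding negligible_iff_null_sets AE_restrict_space_iff[of "{0<..<T}" lebesgue, simplified]
      by (auto intro!: AE_I'[of N])
    have "\<bar>k n t - indicator E t\<bar> \<le> 1" for n t
      by (auto simp: k_def indicator_def)
    then show "(norm (k n t - indicator E t))\<^sup>2 \<le> 1" for n t
      by (metis abs_ge_zero power_le_one real_norm_def)
  qed
  then have "(\<lambda>n. norm v * L2_norm T (\<lambda>t. k n t - indicator E t)) \<longlonglongrightarrow> norm v * 0"
    by (intro tendsto_intros)
  then have "(\<lambda>n. L2_norm T (\<lambda>t. (k n t - indicator E t) *\<^sub>R v)) \<longlonglongrightarrow> 0"
    by (subst L2_real_scaleR_const(2)) (auto intro: L2_diff continuous_in_L2 k_cont ind)
  moreover have "continuous_approximable T (\<lambda>t. k n t *\<^sub>R v)" for n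
    unfolding continuous_approximable_def
  proof (intro conjI allI impI)
    show kn: "(\<lambda>t. k n t *\<^sub>R v) \<in> L2 T"
      by (intro L2_real_scaleR_const continuous_in_L2 k_cont)
    show "\<exists>y\<in>L2 T. continuous_on UNIV y \<and> L2_norm T (\<lambda>t. k n t *\<^sub>R v - y t) < e" if "e > 0" for e
      using kn k_cont that
      by (intro bexI[of _ "\<lambda>t. k n t *\<^sub>R v"]) (auto simp: L2_norm_def intro!: continuous_intros)
  qed
  ultimately show ?thesis
    by (intro continuous_approximable_limit[where s="\<lambda>n t. k n t *\<^sub>R v",
        OF L2_real_scaleR_const(1)[OF ind]])
       (simp_all add: scaleR_left_diff_distrib)
qed

lemma continuous_approximable_simple_function:
  fixes s :: "real \<Rightarrow> 'b::real_normed_vector"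
  assumes s: "simple_function (Xi T) s"
  shows "continuous_approximable T s"
proof -
  let ?E = "\<lambda>v. s -` {v} \<inter> {0<..<T}"
  have E: "?E v \<in> sets lebesgue" if "v \<in> s ` {0<..<T}" for v
  proof -
    have "?E v \<in> sets (Xi T)"
      using s that unfolding simple_function_def by auto
    then show ?thesis
      using sets_restrict_space_iff[of "{0<..<T}" lebesgue] by simp
  qed
  have "continuous_approximable T (\<lambda>t. \<Sum>v\<in>F. indicator (?E v) t *\<^sub>R v)"
    if "finite F" "F \<subseteq> s ` {0<..<T}" for F
    using that
  proof (induction F)
    case empty
    have "continuous_approximable T (\<lambda>t. indicator {} t *\<^sub>R (0::'b))"
      by (rule continuous_approximable_indicator) simp
    then show ?case by simp
  next
    case (insert v F)
    then have "continuous_approximable T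
        (\<lambda>t. indicator (?E v) t *\<^sub>R v + (\<Sum>v\<in>F. indicator (?E v) t *\<^sub>R v))"
      by (intro continuous_approximable_add continuous_approximable_indicator E) auto
    then show ?case
      unfolding sum.insert[OF insert.hyps] .
  qed
  then have sum: "continuous_approximable T (\<lambda>t. \<Sum>v\<in>s ` {0<..<T}. indicator (?E v) t *\<^sub>R v)" (is "continuous_approximable T ?s")
    using s unfolding simple_function_def by simp
  have eq: "?s t = s t" if "t \<in> {0<..<T}" for t
  proof -
    have "?s t = (\<Sum>v\<in>s ` {0<..<T}. if v = s t then v else 0)"
      by (rule sum.cong) (use that in \<open>auto simp: indicator_def\<close>)
    then show ?thesis
      using s that unfolding simple_function_def by simp
  qed
  show ?thesis
  proof (rule continuous_approximable_limit[OF _ sum])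
    have "strongly_measurable (Xi T) s"
      unfolding strongly_measurable_def using s by (intro exI[of _ "\<lambda>_. s"]) auto
    moreover have "integrable (Xi T) (\<lambda>t. (norm (?s t))\<^sup>2)"
      using sum L2D(3) unfolding continuous_approximable_def by blast
    ultimately show "s \<in> L2 T"
      by (rule L2I) (use eq in auto)
    have "L2_norm T (\<lambda>t. ?s t - s t) = L2_norm T (\<lambda>t. 0 :: 'b)"
      unfolding L2_norm_def
      by (intro arg_cong[of _ _ sqrt] Bochner_Integration.integral_cong refl) (use eq in auto)
    then show "(\<lambda>n. L2_norm T (\<lambda>t. ?s t - s t)) \<longlonglongrightarrow> 0"
      by (simp add: L2_norm_def)
  qed
qed

text \<open>
  Where an approximating simple function is larger than \<open>2 \<parallel>f\<parallel>\<close> it is replaced by 0. It stays simple,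
  because \<open>\<parallel>f\<parallel>\<close> is measurable, and dominated convergence becomes applicable.
\<close>

lemma continuous_dense_in_L2:
  fixes f :: "real \<Rightarrow> 'b::real_normed_vector"
  assumes f: "f \<in> L2 T" and "e > 0"
  obtains y where "y \<in> L2 T" "continuous_on UNIV y" "L2_norm T (\<lambda>t. f t - y t) < e"
proof -
  obtain s where s: "\<And>i::nat. simple_function (Xi T) (s i)" "AE t in Xi T. (\<lambda>i. s i t) \<longlonglongrightarrow> f t"
    using L2D(1)[OF f] unfolding strongly_measurable_def by blast
  define r where "r i t = (if norm (s i t) \<le> 2 * norm (f t) then s i t else 0)" for i t
  have r_simple: "simple_function (Xi T) (r i)" for i
  proof -
    have "(\<lambda>t. norm (s i t)) \<in> borel_measurable (Xi T)"
      using simple_function_compose1[OF s(1), of norm] by (rule borel_measurable_simple_function)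
    then have "{t \<in> space (Xi T). norm (s i t) \<le> 2 * norm (f t)} \<in> sets (Xi T)"
      using L2D(2)[OF f] by measurable
    then show ?thesis
      unfolding r_def by (intro simple_function_If s(1) simple_function_const)
  qed
  have appr: "continuous_approximable T (r i)" for i
    by (rule continuous_approximable_simple_function[OF r_simple])
  have "(\<lambda>n. L2_norm T (\<lambda>t. r n t - f t)) \<longlonglongrightarrow> 0"
  proof (rule L2_norm_tendsto_0[where h="\<lambda>t. 9 * (norm (f t))\<^sup>2"])
    show "(\<lambda>t. r n t - f t) \<in> L2 T" for n
      using appr f L2_diff unfolding continuous_approximable_def by blast
    show "integrable (Xi T) (\<lambda>t. 9 * (norm (f t))\<^sup>2)"
      using L2D(3)[OF f] by simp
    show "AE t in Xi T. (\<lambda>n. r n t - f t) \<longlonglongrightarrow> 0"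
      using s(2)
    proof eventually_elim
      case (elim t)
      have "(\<lambda>n. r n t) \<longlonglongrightarrow> f t"
      proof (cases "f t = 0")
        case True
        then have "r n t = 0" for n by (auto simp: r_def)
        then show ?thesis using True by simp
      next
        case False
        have "eventually (\<lambda>n. norm (s n t) < 2 * norm (f t)) sequentially"
          using False by (intro order_tendstoD(2)[OF tendsto_norm[OF elim]]) auto
        then have "eventually (\<lambda>n. s n t = r n t) sequentially"
          by eventually_elim (auto simp: r_def)
        then show ?thesis by (rule Lim_transform_eventually[OF elim])
      qed
      then show ?case by (simp add: LIM_zero_iff)
    qed
    show "(norm (r n t - f t))\<^sup>2 \<le> 9 * (norm (f t))\<^sup>2" for n t
    proof -
      have "norm (r n t - f t) \<le> norm (r n t) + norm (f t)" by (rule norm_triangle_ineq4)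
      also have "\<dots> \<le> 3 * norm (f t)" by (auto simp: r_def)
      finally have "(norm (r n t - f t))\<^sup>2 \<le> (3 * norm (f t))\<^sup>2" by (intro power_mono) auto
      then show ?thesis by (simp add: power_mult_distrib)
    qed
  qed
  then have "continuous_approximable T f"
    by (rule continuous_approximable_limit[OF f appr])
  then show thesis
    using that \<open>e > 0\<close> unfolding continuous_approximable_def by blast
qed

section \<open>Partitions and integrals over subintervals\<close>

lemma AE_lebesgue_on_iff:
  assumes "S \<in> sets lebesgue"
  shows "(AE t in lebesgue_on S. P t) \<longleftrightarrow> (\<exists>N. negligible N \<and> (\<forall>t\<in>S - N. P t))"
proof -
  have "(AE t in lebesgue_on S. P t) \<longleftrightarrow> (AE t in lebesgue. t \<in> S \<longrightarrow> P t)"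
    using assms by (intro AE_restrict_space_iff) simp
  also have "\<dots> \<longleftrightarrow> (\<exists>N. negligible N \<and> (\<forall>t\<in>S - N. P t))"
  proof
    assume "AE t in lebesgue. t \<in> S \<longrightarrow> P t"
    then have "negligible {t. \<not> (t \<in> S \<longrightarrow> P t)}"
      unfolding completion.AE_iff_null_sets negligible_iff_null_sets by simp
    then show "\<exists>N. negligible N \<and> (\<forall>t\<in>S - N. P t)" by blast
  next
    assume "\<exists>N. negligible N \<and> (\<forall>t\<in>S - N. P t)"
    then obtain N where "negligible N" "\<forall>t\<in>S - N. P t" by blast
    then show "AE t in lebesgue. t \<in> S \<longrightarrow> P t"
      unfolding negligible_iff_null_sets by (intro AE_I'[of N]) auto
  qed
  finally show ?thesis .
qed

lemma Xi_integrable_iff: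
  fixes f :: "real \<Rightarrow> real"
  shows "integrable (Xi T) f \<longleftrightarrow> f absolutely_integrable_on {0..T}"
proof -
  have "integrable (Xi T) f \<longleftrightarrow> f absolutely_integrable_on {0<..<T}"
    unfolding set_integrable_def by (intro integrable_restrict_space) simp
  then show ?thesis
    by (simp only: absolutely_integrable_on_Icc_iff_Ioo)
qed

lemma Xi_integral:
  fixes f :: "real \<Rightarrow> real"
  assumes "integrable (Xi T) f"
  shows "(LINT t|Xi T. f t) = integral {0..T} f"
  using lebesgue_integral_eq_integral[OF assms] by (simp add: integral_open_interval_real)

lemma exists_value_below_average:
  fixes q :: "real \<Rightarrow> real"
  assumes q: "q absolutely_integrable_on {c..d}" and "c < d" and N: "negligible N"
  obtains r where "r \<in> {c<..<d} - N" "(d - c) * q r \<le> integral {c..d} q"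
proof (rule ccontr)
  assume "\<not> thesis"
  then have gt: "(d - c) * q r > integral {c..d} q" if "r \<in> {c<..<d} - N" for r
    using that \<open>\<And>r. _ \<Longrightarrow> _ \<Longrightarrow> thesis\<close> by force
  define p where "p r = q r - integral {c..d} q / (d - c)" for r
  have p_abs: "p absolutely_integrable_on {c..d}"
    unfolding p_def
    by (rule set_integral_diff(1)[OF q absolutely_integrable_continuous_real[OF continuous_on_const]])
  then have p_int: "integrable (lebesgue_on {c..d}) p"
    by (rule absolutely_integrable_imp_integrable) simp
  have p_pos: "p r > 0" if "r \<in> {c..d} - (N \<union> {c, d})" for r
    using gt[of r] that \<open>c < d\<close> by (auto simp: p_def field_simps)
  have N': "negligible (N \<union> {c, d})" using N by simp
  have "integral\<^sup>L (lebesgue_on {c..d}) p = integral {c..d} p"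
    by (rule lebesgue_integral_eq_integral[OF p_int]) simp
  also have "\<dots> = 0"
    unfolding p_def using set_lebesgue_integral_eq_integral(1)[OF q] \<open>c < d\<close>
    by (subst integral_diff) auto
  finally have "integral\<^sup>L (lebesgue_on {c..d}) p = 0" .
  moreover have "AE r in lebesgue_on {c..d}. 0 \<le> p r"
    using N' p_pos by (subst AE_lebesgue_on_iff) (simp, meson N' less_imp_le)
  ultimately have "AE r in lebesgue_on {c..d}. p r = 0"
    using integral_nonneg_eq_0_iff_AE[OF p_int] by simp
  then obtain M where M: "negligible M" "\<And>r. r \<in> {c..d} - M \<Longrightarrow> p r = 0"
    by (subst (asm) AE_lebesgue_on_iff) auto
  have "{c..d} \<subseteq> M \<union> (N \<union> {c, d})"
    using M(2) p_pos by fastforce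
  then have "negligible {c..d}"
    using M(1) N' negligible_Un negligible_subset by blast
  then show False
    using negligible_interval(1)[of c d] \<open>c < d\<close> by (simp add: box_real)
qed

text \<open>
  The points \<open>x k\<close> are values of \<open>r\<close> in consecutive cells of length \<open>h\<close>, with \<open>a\<close> and \<open>b\<close> added at the
  ends. In each cell \<open>r\<close> is chosen with \<open>h q(r)\<close> at most the integral of \<open>q\<close> over the cell. Steps have
  length at most \<open>2h\<close> and each interior point belongs to two steps, whence the factor 4; the two
  prescribed end points, where \<open>q\<close> cannot be controlled, contribute \<open>2h (q(a) + q(b))\<close>, which is small
  for small \<open>h\<close>.
\<close>

lemma good_partition:
  fixes q :: "real \<Rightarrow> real"
  assumes q: "q absolutely_integrable_on {a..b}" "\<And>t. q t \<ge> 0" and "a < b" and "\<delta> > 0"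
    and N: "negligible N" "a \<notin> N" "b \<notin> N"
  obtains x and m :: nat where "x 0 = a" "x m = b" "\<forall>k<m. x k \<le> x (Suc k)"
    "\<forall>k<m. x (Suc k) \<le> x k + \<delta>" "\<forall>k\<le>m. x k \<in> {a..b} - N"
    "(\<Sum>k<m. (x (Suc k) - x k) * (q (x k) + q (x (Suc k)))) \<le> 4 * integral {a..b} q + \<delta>"
proof -
  \<comment> \<open>\<open>n\<close> is so large that \<open>2 h \<le> \<delta>\<close> and \<open>2 h (q a + q b) \<le> \<delta>\<close>\<close>
  define n where "n = nat \<lceil>max (2 * (b - a) / \<delta>) (2 * (b - a) * (q a + q b) / \<delta>)\<rceil> + 1"
  define h where "h = (b - a) / real n"
  have n: "real n \<ge> 2 * (b - a) / \<delta>" "real n \<ge> 2 * (b - a) * (q a + q b) / \<delta>" "n > 0"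
    unfolding n_def by linarith+
  have h: "h > 0" "2 * h \<le> \<delta>" "2 * h * (q a + q b) \<le> \<delta>" "a + real n * h = b"
    using n \<open>a < b\<close> \<open>\<delta> > 0\<close> by (auto simp: h_def field_simps)
  define J where "J i = {a + real i * h..a + real (Suc i) * h}" for i
  have J: "J i \<subseteq> {a..b}" if "i < n" for i
  proof -
    have "real (Suc i) * h \<le> real n * h"
      using that h(1) by (intro mult_right_mono) auto
    moreover have "0 \<le> real i * h" using h(1) by simp
    ultimately show ?thesis using h(4) by (auto simp: J_def)
  qed
  have "\<exists>r. r \<in> {a + real i * h<..<a + real (Suc i) * h} - N \<and> h * q r \<le> integral (J i) q" if "i < n" for i
  proof -
    have "q absolutely_integrable_on {a + real i * h..a + real (Suc i) * h}"
      using J[OF that] unfolding J_def by (rule absolutely_integrable_on_subinterval[OF q(1)])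
    moreover have "a + real i * h < a + real (Suc i) * h"
      using h(1) by (simp add: algebra_simps)
    ultimately obtain r where "r \<in> {a + real i * h<..<a + real (Suc i) * h} - N"
      "(a + real (Suc i) * h - (a + real i * h)) * q r \<le> integral (J i) q"
      unfolding J_def using exists_value_below_average N(1) by metis
    moreover have "a + real (Suc i) * h - (a + real i * h) = h"
      by (simp add: algebra_simps)
    ultimately show ?thesis by metis
  qed
  then obtain r where r: "\<And>i. i < n \<Longrightarrow> r i \<in> {a + real i * h<..<a + real (Suc i) * h} - N"
    "\<And>i. i < n \<Longrightarrow> h * q (r i) \<le> integral (J i) q"
    by metis
  define x where "x k = (if k = 0 then a else if k \<le> n then r (k - 1) else b)" for k
  have index_cases: "k = 0 \<or> (\<exists>i. k = Suc i \<and> i < n) \<or> k = Suc n" if "k \<le> Suc n" for k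
    using that by (cases k) (auto simp: le_less)
  have x_upper: "x k \<le> a + real k * h" if "k \<le> Suc n" for k
  proof -
    consider "k = 0" | i where "k = Suc i" "i < n" | "k = Suc n"
      using index_cases[OF \<open>k \<le> Suc n\<close>] by blast
    then show ?thesis
    proof cases
      case 2
      then show ?thesis using r(1)[of i] by (auto simp: x_def)
    next
      case 3
      then show ?thesis using h by (auto simp: x_def algebra_simps)
    qed (simp add: x_def)
  qed
  have x_lower: "a + real k * h \<le> x (Suc k)" if "k \<le> n" for k
  proof (cases "k < n")
    case True
    then show ?thesis using r(1)[of k] by (auto simp: x_def)
  next
    case False
    then show ?thesis using that h by (auto simp: x_def)
  qed
  have x_step: "x (Suc k) - x k \<le> 2 * h" if "k \<le> n" for k
  proof (cases k)
    case 0
    then show ?thesis using x_upper[of 1] h(1) n(3) by (simp add: x_def)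
  next
    case (Suc i)
    have "x (Suc k) \<le> a + real (Suc (Suc i)) * h" using x_upper[of "Suc k"] that Suc by simp
    moreover have "a + real i * h \<le> x k" using x_lower[of i] that Suc by simp
    ultimately show ?thesis by (simp add: algebra_simps)
  qed
  have x_in: "x k \<in> {a..b} - N" if "k \<le> Suc n" for k
  proof -
    consider "k = 0" | i where "k = Suc i" "i < n" | "k = Suc n"
      using index_cases[OF \<open>k \<le> Suc n\<close>] by blast
    then show ?thesis
    proof cases
      case 2
      then have "x k = r i" by (simp add: x_def)
      then show ?thesis using r(1)[OF 2(2)] J[OF 2(2)] by (auto simp: J_def)
    qed (use \<open>a < b\<close> N in \<open>auto simp: x_def\<close>)
  qed
  have J_sum: "(\<Sum>i<k. integral (J i) q) = integral {a..a + real k * h} q" if "k \<le> n" for k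
    using that
  proof (induction k)
    case (Suc k)
    have "{a..a + real (Suc k) * h} \<subseteq> {a..b}" using J[of k] Suc.prems h(1) by (auto simp: J_def)
    then have "q integrable_on {a..a + real (Suc k) * h}"
      using absolutely_integrable_on_subinterval[OF q(1)] set_lebesgue_integral_eq_integral(1) by blast
    then have "integral {a..a + real k * h} q + integral {a + real k * h..a + real (Suc k) * h} q
        = integral {a..a + real (Suc k) * h} q"
      using h(1) by (intro Henstock_Kurzweil_Integration.integral_combine) (auto simp: algebra_simps)
    then show ?case using Suc by (simp add: J_def)
  qed simp
  have "(\<Sum>k<Suc n. (x (Suc k) - x k) * (q (x k) + q (x (Suc k))))
      \<le> (\<Sum>k<Suc n. (2 * h) * (q (x k) + q (x (Suc k))))"
    using x_step q(2) by (intro sum_mono mult_right_mono add_nonneg_nonneg) auto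
  also have "\<dots> = (2 * h) * ((\<Sum>k<Suc n. q (x k)) + (\<Sum>k<Suc n. q (x (Suc k))))"
    unfolding sum.distrib[symmetric] sum_distrib_left ..
  also have "(\<Sum>k<Suc n. q (x k)) = q a + (\<Sum>i<n. q (r i))"
    unfolding sum.lessThan_Suc_shift by (auto simp: x_def intro!: sum.cong)
  also have "(\<Sum>k<Suc n. q (x (Suc k))) = (\<Sum>i<n. q (r i)) + q b"
    unfolding sum.lessThan_Suc by (auto simp: x_def intro!: sum.cong)
  also have "(2 * h) * ((q a + (\<Sum>i<n. q (r i))) + ((\<Sum>i<n. q (r i)) + q b))
      = 2 * h * (q a + q b) + 4 * (\<Sum>i<n. h * q (r i))"
    by (simp add: sum_distrib_left[symmetric] algebra_simps)
  also have "(\<Sum>i<n. h * q (r i)) \<le> (\<Sum>i<n. integral (J i) q)"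
    by (intro sum_mono r(2)) auto
  also have "\<dots> = integral {a..b} q"
    using J_sum[of n] h(4) by simp
  finally have bound: "(\<Sum>k<Suc n. (x (Suc k) - x k) * (q (x k) + q (x (Suc k)))) \<le> 4 * integral {a..b} q + \<delta>"
    using h(3) by linarith
  show thesis
  proof (rule that[of x "Suc n"])
    show "\<forall>k<Suc n. x k \<le> x (Suc k)"
      using x_upper x_lower by (metis less_Suc_eq_le less_imp_le order_trans)
    show "\<forall>k<Suc n. x (Suc k) \<le> x k + \<delta>"
      using x_step h(2) by (smt (verit) less_Suc_eq_le)
    show "\<forall>k\<le>Suc n. x k \<in> {a..b} - N"
      using x_in by blast
  qed (use bound in \<open>auto simp: x_def\<close>)
qed

lemma sum_integral_partition:
  fixes f :: "real \<Rightarrow> real"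
  assumes "f integrable_on {x 0..x m}" "\<And>k. k < m \<Longrightarrow> x k \<le> x (Suc k)"
  shows "x 0 \<le> x m \<and> (\<Sum>k<m. integral {x k..x (Suc k)} f) = integral {x 0..x m} f"
  using assms
proof (induction m)
  case (Suc m)
  have le: "x m \<le> x (Suc m)" using Suc.prems(2) by simp
  have "f integrable_on {x 0..x m}"
    by (rule integrable_subinterval_real[OF Suc.prems(1)]) (use le in auto)
  with Suc have IH: "x 0 \<le> x m" "(\<Sum>k<m. integral {x k..x (Suc k)} f) = integral {x 0..x m} f"
    by auto
  then show ?case
    using le Henstock_Kurzweil_Integration.integral_combine[OF IH(1) le Suc.prems(1)] by simp
qed simp

lemma integral_Cauchy_Schwarz:
  fixes p q :: "real \<Rightarrow> real"
  assumes "(\<lambda>t. (p t)\<^sup>2) integrable_on S" "(\<lambda>t. (q t)\<^sup>2) integrable_on S" "(\<lambda>t. p t * q t) integrable_on S"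
  shows "integral S (\<lambda>t. p t * q t) \<le> sqrt (integral S (\<lambda>t. (p t)\<^sup>2)) * sqrt (integral S (\<lambda>t. (q t)\<^sup>2))"
proof (rule le_sqrt_mult_sqrt)
  fix k :: real assume "k > 0"
  have "2 * integral S (\<lambda>t. p t * q t) = integral S (\<lambda>t. 2 * (p t * q t))"
    by simp
  also have "\<dots> \<le> integral S (\<lambda>t. k * (p t)\<^sup>2 + (q t)\<^sup>2 / k)"
    using assms weighted_Young[OF \<open>k > 0\<close>]
    by (intro integral_le integrable_add integrable_on_mult_right integrable_on_divide) auto
  also have "\<dots> = k * integral S (\<lambda>t. (p t)\<^sup>2) + integral S (\<lambda>t. (q t)\<^sup>2) / k"
    using assms by (subst integral_add) (auto intro: integrable_on_mult_right integrable_on_divide)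
  finally show "2 * integral S (\<lambda>t. p t * q t) \<le> k * integral S (\<lambda>t. (p t)\<^sup>2) + integral S (\<lambda>t. (q t)\<^sup>2) / k" .
next
  show "integral S (\<lambda>t. (p t)\<^sup>2) \<ge> 0" by (rule integral_nonneg[OF assms(1)]) simp
  show "integral S (\<lambda>t. (q t)\<^sup>2) \<ge> 0" by (rule integral_nonneg[OF assms(2)]) simp
qed

section \<open>The continuous representative of an element of \<open>X\<close>\<close>

lemma V_to_Vdual_apply: "blinfun_apply (V_to_Vdual \<iota> a) v = inner (blinfun_apply \<iota> a) (blinfun_apply \<iota> v)"
  by (simp add: V_to_Vdual_def H_to_Vdual_def)

lemma L2_products_integrable:
  assumes "f \<in> L2 T" "k \<in> L2 T" "{s..t} \<subseteq> {0..T}"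
  shows "(\<lambda>\<tau>. norm (f \<tau>) * norm (k \<tau>)) integrable_on {s..t}"
    "(\<lambda>\<tau>. (norm (f \<tau>))\<^sup>2) absolutely_integrable_on {s..t}"
proof -
  show "(\<lambda>\<tau>. norm (f \<tau>) * norm (k \<tau>)) integrable_on {s..t}"
    using L2_Cauchy_Schwarz(1)[OF assms(1,2)] absolutely_integrable_on_subinterval[OF _ assms(3)]
      set_lebesgue_integral_eq_integral(1) unfolding Xi_integrable_iff by blast
  show "(\<lambda>\<tau>. (norm (f \<tau>))\<^sup>2) absolutely_integrable_on {s..t}"
    using L2D(3)[OF assms(1)] absolutely_integrable_on_subinterval[OF _ assms(3)]
    unfolding Xi_integrable_iff by blast
qed

lemma L2_pairing_integrable:
  fixes g :: "real \<Rightarrow> 'v::real_normed_vector \<Rightarrow>\<^sub>L real"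
  assumes "g \<in> L2 T" "y \<in> L2 T" "{s..t} \<subseteq> {0..T}"
  shows "(\<lambda>\<tau>. blinfun_apply (g \<tau>) (y \<tau>)) integrable_on {s..t}"
  using L2_pairing(1)[OF assms(1,2)] absolutely_integrable_on_subinterval[OF _ assms(3)]
    set_lebesgue_integral_eq_integral(1) unfolding Xi_integrable_iff by blast

lemma L2_pairing_interval_bound:
  fixes g :: "real \<Rightarrow> 'v::real_normed_vector \<Rightarrow>\<^sub>L real"
  assumes "g \<in> L2 T" "y \<in> L2 T" "{s..t} \<subseteq> {0..T}"
  shows "\<bar>integral {s..t} (\<lambda>\<tau>. blinfun_apply (g \<tau>) (y \<tau>))\<bar>
    \<le> sqrt (integral {s..t} (\<lambda>\<tau>. (norm (g \<tau>))\<^sup>2)) * sqrt (integral {s..t} (\<lambda>\<tau>. (norm (y \<tau>))\<^sup>2))"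
proof -
  have "norm (integral {s..t} (\<lambda>\<tau>. blinfun_apply (g \<tau>) (y \<tau>)))
      \<le> integral {s..t} (\<lambda>\<tau>. norm (g \<tau>) * norm (y \<tau>))"
    by (rule integral_norm_bound_integral[OF L2_pairing_integrable[OF assms]
          L2_products_integrable(1)[OF assms] norm_blinfun])
  also have "\<dots> \<le> sqrt (integral {s..t} (\<lambda>\<tau>. (norm (g \<tau>))\<^sup>2)) * sqrt (integral {s..t} (\<lambda>\<tau>. (norm (y \<tau>))\<^sup>2))"
    using L2_products_integrable(1)[OF assms] assms(3)
      set_lebesgue_integral_eq_integral(1)[OF L2_products_integrable(2)[OF assms(1,1,3)]]
      set_lebesgue_integral_eq_integral(1)[OF L2_products_integrable(2)[OF assms(2,2,3)]]
    by (intro integral_Cauchy_Schwarz)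
  finally show ?thesis by simp
qed

lemma test_function_continuous:
  assumes "\<phi> \<in> test_functions T"
  shows "continuous_on S \<phi>" "continuous_on S (deriv \<phi>)"
proof -
  have "((deriv ^^ k) \<phi>) differentiable (at x)" for k x
    using assms unfolding test_functions_def by blast
  from this[of 0] this[of 1] show "continuous_on S \<phi>" "continuous_on S (deriv \<phi>)"
    by (auto intro!: continuous_at_imp_continuous_on differentiable_imp_continuous_within)
qed

text \<open>
  A nonempty open set is not negligible.
\<close>

lemma closure_interval_minus_negligible:
  fixes a b :: real
  assumes N: "negligible N" and "a < b"
  shows "closure ({a<..<b} - N) = {a..b}"
proof
  show "closure ({a<..<b} - N) \<subseteq> {a..b}"
    by (rule closure_minimal) auto
  have "{a<..<b} \<subseteq> closure ({a<..<b} - N)"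
  proof
    fix x assume x: "x \<in> {a<..<b}"
    show "x \<in> closure ({a<..<b} - N)"
      unfolding closure_iff_nhds_not_empty
    proof (intro allI impI)
      fix A V assume "V \<subseteq> A" "open V" "x \<in> V"
      then have "\<not> negligible ({a<..<b} \<inter> V)"
        using x by (intro open_not_negligible) auto
      then have "\<not> {a<..<b} \<inter> V \<subseteq> N"
        using N negligible_subset by blast
      then show "({a<..<b} - N) \<inter> A \<noteq> {}"
        using \<open>V \<subseteq> A\<close> by blast
    qed
  qed
  then have "closure {a<..<b} \<subseteq> closure ({a<..<b} - N)"
    by (simp add: closure_minimal)
  then show "{a..b} \<subseteq> closure ({a<..<b} - N)"
    using closure_greaterThanLessThan[OF \<open>a < b\<close>] by simp
qed

context
  fixes \<iota> :: "'v::{real_inner,complete_space} \<Rightarrow>\<^sub>L 'h::{real_inner,complete_space}"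
    and T :: real and w :: "real \<Rightarrow> 'v" and g :: "real \<Rightarrow> 'v \<Rightarrow>\<^sub>L real"
  assumes w: "w \<in> L2 T" and \<iota>w: "(\<lambda>t. V_to_Vdual \<iota> (w t)) \<in> L2 T"
    and g: "g \<in> L2 T" and weak: "weak_deriv T (\<lambda>t. V_to_Vdual \<iota> (w t)) g"
begin

lemma increments_against_vector:
  obtains N where "negligible N"
    "\<And>s t. \<lbrakk>s \<in> {0<..<T} - N; t \<in> {0<..<T} - N; s \<le> t\<rbrakk> \<Longrightarrow>
      inner (\<iota> (w t) - \<iota> (w s)) (\<iota> v) = integral {s..t} (\<lambda>\<tau>. g \<tau> v)"
proof (rule weak_derivative_increments)
  show f: "(\<lambda>t. inner (\<iota> (w t)) (\<iota> v)) absolutely_integrable_on {0..T}"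
    using L2_pairing(1)[OF \<iota>w L2_const[of v]] by (simp add: V_to_Vdual_apply Xi_integrable_iff)
  show \<gamma>: "(\<lambda>t. g t v) absolutely_integrable_on {0..T}"
    using L2_pairing(1)[OF g L2_const[of v]] by (simp add: Xi_integrable_iff)
  fix \<phi> assume \<phi>: "\<phi> \<in> test_functions T"
  have "(LINT t|Xi T. deriv \<phi> t * inner (\<iota> (w t)) (\<iota> v)) = - (LINT t|Xi T. \<phi> t * g t v)"
    using weak \<phi> unfolding weak_deriv_def V_to_Vdual_apply by blast
  then show "integral {0..T} (\<lambda>t. deriv \<phi> t * inner (\<iota> (w t)) (\<iota> v)) = - integral {0..T} (\<lambda>t. \<phi> t * g t v)"
    using absolutely_integrable_continuous_mult[OF f test_function_continuous(2)[OF \<phi>]]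
      absolutely_integrable_continuous_mult[OF \<gamma> test_function_continuous(1)[OF \<phi>]]
    by (simp add: Xi_integral Xi_integrable_iff)
qed (use that in \<open>auto simp: inner_diff_left\<close>)

text \<open>
  For each fixed \<open>v\<close> the increments of \<open>\<langle>\<iota> w, \<iota> v\<rangle>\<close> are known off a null set that depends on \<open>v\<close>. A
  single null set serves all values \<open>v\<close> of the simple functions that approximate \<open>w\<close>, since there are
  countably many of them, and both sides are continuous in \<open>v\<close>.
\<close>

lemma increments_against_values:
  obtains N where "negligible N"
    "\<And>r s t. \<lbrakk>r \<in> {0<..<T} - N; s \<in> {0<..<T} - N; t \<in> {0<..<T} - N; s \<le> t\<rbrakk> \<Longrightarrow>
      inner (\<iota> (w t) - \<iota> (w s)) (\<iota> (w r)) = integral {s..t} (\<lambda>\<tau>. g \<tau> (w r))"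
proof -
  obtain z where z: "\<And>i::nat. simple_function (Xi T) (z i)" "AE t in Xi T. (\<lambda>i. z i t) \<longlonglongrightarrow> w t"
    using L2D(1)[OF w] unfolding strongly_measurable_def by blast
  define D where "D = (\<Union>i. z i ` {0<..<T})"
  have "countable D"
    unfolding D_def using z(1) by (intro countable_UN) (auto simp: simple_function_def intro: countable_finite)
  obtain N0 where N0: "negligible N0" "\<And>t. t \<in> {0<..<T} - N0 \<Longrightarrow> (\<lambda>i. z i t) \<longlonglongrightarrow> w t"
    using z(2) by (auto simp: AE_lebesgue_on_iff)
  have "\<exists>N. negligible N \<and> (\<forall>s t. s \<in> {0<..<T} - N \<longrightarrow> t \<in> {0<..<T} - N \<longrightarrow> s \<le> t \<longrightarrow>
      inner (\<iota> (w t) - \<iota> (w s)) (\<iota> v) = integral {s..t} (\<lambda>\<tau>. g \<tau> v))" for v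
    using increments_against_vector[of v] by metis
  then obtain N where N: "\<And>v. negligible (N v)"
    "\<And>v s t. \<lbrakk>s \<in> {0<..<T} - N v; t \<in> {0<..<T} - N v; s \<le> t\<rbrakk> \<Longrightarrow>
      inner (\<iota> (w t) - \<iota> (w s)) (\<iota> v) = integral {s..t} (\<lambda>\<tau>. g \<tau> v)"
    by metis
  show thesis
  proof (rule that[of "N0 \<union> (\<Union>v\<in>D. N v)"])
    show "negligible (N0 \<union> (\<Union>v\<in>D. N v))"
      using N0(1) N(1) \<open>countable D\<close> by (intro negligible_Un negligible_countable_Union) auto
    fix r s t assume r: "r \<in> {0<..<T} - (N0 \<union> (\<Union>v\<in>D. N v))"
      and s: "s \<in> {0<..<T} - (N0 \<union> (\<Union>v\<in>D. N v))" and t: "t \<in> {0<..<T} - (N0 \<union> (\<Union>v\<in>D. N v))"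
      and "s \<le> t"
    have sub: "{s..t} \<subseteq> {0..T}" using s t by auto
    have lim: "(\<lambda>i. z i r) \<longlonglongrightarrow> w r" using N0(2) r by auto
    have "inner (\<iota> (w t) - \<iota> (w s)) (\<iota> (z i r)) = integral {s..t} (\<lambda>\<tau>. g \<tau> (z i r))" for i
      using N(2)[of s "z i r" t] r s t \<open>s \<le> t\<close> unfolding D_def by blast
    moreover have "(\<lambda>i. inner (\<iota> (w t) - \<iota> (w s)) (\<iota> (z i r))) \<longlonglongrightarrow> inner (\<iota> (w t) - \<iota> (w s)) (\<iota> (w r))"
      by (intro tendsto_intros lim)
    moreover have "(\<lambda>i. integral {s..t} (\<lambda>\<tau>. g \<tau> (z i r))) \<longlonglongrightarrow> integral {s..t} (\<lambda>\<tau>. g \<tau> (w r))"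
    proof (rule LIM_zero_cancel, rule Lim_null_comparison)
      have "norm (integral {s..t} (\<lambda>\<tau>. g \<tau> (z i r)) - integral {s..t} (\<lambda>\<tau>. g \<tau> (w r)))
        \<le> sqrt (integral {s..t} (\<lambda>\<tau>. (norm (g \<tau>))\<^sup>2)) * sqrt ((t - s) * (norm (z i r - w r))\<^sup>2)" for i
        using L2_pairing_interval_bound[OF g L2_const[of "z i r - w r"] sub] \<open>s \<le> t\<close>
        by (simp add: blinfun.diff_right Henstock_Kurzweil_Integration.integral_diff
            L2_pairing_integrable[OF g L2_const sub])
      then show "\<forall>\<^sub>F i in sequentially. norm (integral {s..t} (\<lambda>\<tau>. g \<tau> (z i r)) - integral {s..t} (\<lambda>\<tau>. g \<tau> (w r)))
        \<le> sqrt (integral {s..t} (\<lambda>\<tau>. (norm (g \<tau>))\<^sup>2)) * sqrt ((t - s) * (norm (z i r - w r))\<^sup>2)"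
        by simp
      have "(\<lambda>i. sqrt (integral {s..t} (\<lambda>\<tau>. (norm (g \<tau>))\<^sup>2)) * sqrt ((t - s) * (norm (z i r - w r))\<^sup>2))
        \<longlonglongrightarrow> sqrt (integral {s..t} (\<lambda>\<tau>. (norm (g \<tau>))\<^sup>2)) * sqrt ((t - s) * (norm (w r - w r))\<^sup>2)"
        by (intro tendsto_intros lim)
      then show "(\<lambda>i. sqrt (integral {s..t} (\<lambda>\<tau>. (norm (g \<tau>))\<^sup>2)) * sqrt ((t - s) * (norm (z i r - w r))\<^sup>2))
        \<longlonglongrightarrow> 0" by simp
    qed
    ultimately show "inner (\<iota> (w t) - \<iota> (w s)) (\<iota> (w r)) = integral {s..t} (\<lambda>\<tau>. g \<tau> (w r))"
      using LIMSEQ_unique by simp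
  qed
qed

text \<open>
  The defect \<open>D s t\<close> of the identity on \<open>[s,t]\<close> is additive in the interval and equals
  \<open>\<integral>\<^sub>s\<^sup>t w'((w(s) - w) + (w(t) - w))\<close>. Take a continuous \<open>y\<close> close to \<open>w\<close> in \<open>L\<^sub>2\<close> and a fine
  partition adapted to \<open>q = \<parallel>w - y\<parallel>\<^sup>2\<close>. On each cell \<open>w\<close> differs from its end values by at most the
  deviations from \<open>y\<close> and the oscillation of \<open>y\<close>, so that the sum of the defects is small.
\<close>

lemma energy_identity_off_null_set:
  assumes N: "negligible N"
    "\<And>r s t. \<lbrakk>r \<in> {0<..<T} - N; s \<in> {0<..<T} - N; t \<in> {0<..<T} - N; s \<le> t\<rbrakk> \<Longrightarrow>
      inner (\<iota> (w t) - \<iota> (w s)) (\<iota> (w r)) = integral {s..t} (\<lambda>\<tau>. g \<tau> (w r))"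
    and a: "a \<in> {0<..<T} - N" and b: "b \<in> {0<..<T} - N" and "a < b"
  shows "(norm (\<iota> (w b)))\<^sup>2 - (norm (\<iota> (w a)))\<^sup>2 = 2 * integral {a..b} (\<lambda>\<tau>. g \<tau> (w \<tau>))"
proof -
  define D where "D s t = (norm (\<iota> (w t)))\<^sup>2 - (norm (\<iota> (w s)))\<^sup>2 - 2 * integral {s..t} (\<lambda>\<tau>. g \<tau> (w \<tau>))" for s t
  have D_eq: "D s t = integral {s..t} (\<lambda>\<tau>. g \<tau> ((w s - w \<tau>) + (w t - w \<tau>)))"
    if "s \<in> {0<..<T} - N" "t \<in> {0<..<T} - N" "s \<le> t" for s t
  proof -
    have sub: "{s..t} \<subseteq> {0..T}" using that by auto
    have "(norm (\<iota> (w t)))\<^sup>2 - (norm (\<iota> (w s)))\<^sup>2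
        = inner (\<iota> (w t) - \<iota> (w s)) (\<iota> (w s)) + inner (\<iota> (w t) - \<iota> (w s)) (\<iota> (w t))"
      by (simp add: power2_norm_eq_inner inner_diff_left inner_commute[of "\<iota> (w s)" "\<iota> (w t)"])
    also have "\<dots> = integral {s..t} (\<lambda>\<tau>. g \<tau> (w s)) + integral {s..t} (\<lambda>\<tau>. g \<tau> (w t))"
      using that N(2) by simp
    finally have "D s t = integral {s..t} (\<lambda>\<tau>. g \<tau> (w s)) + integral {s..t} (\<lambda>\<tau>. g \<tau> (w t))
        - integral {s..t} (\<lambda>\<tau>. 2 * g \<tau> (w \<tau>))"
      by (simp add: D_def)
    also have "\<dots> = integral {s..t} (\<lambda>\<tau>. (g \<tau> (w s) + g \<tau> (w t)) - 2 * g \<tau> (w \<tau>))"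
      using L2_pairing_integrable[OF g L2_const sub] L2_pairing_integrable[OF g w sub]
      by (subst Henstock_Kurzweil_Integration.integral_diff,
          auto simp: Henstock_Kurzweil_Integration.integral_add intro!: integrable_add)
    also have "\<dots> = integral {s..t} (\<lambda>\<tau>. g \<tau> ((w s - w \<tau>) + (w t - w \<tau>)))"
      by (rule integral_cong) (simp add: blinfun.add_right blinfun.diff_right)
    finally show ?thesis .
  qed
  define G where "G = integral {a..b} (\<lambda>\<tau>. (norm (g \<tau>))\<^sup>2)"
  have ab: "{a..b} \<subseteq> {0..T}" using a b by auto
  \<comment> \<open>\<open>\<eta>\<close> bounds \<open>\<parallel>w - y\<parallel>\<close> in \<open>L\<^sub>2\<close>, the oscillation of \<open>y\<close> on a cell, and the square root of the mesh\<close>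
  have key: "\<bar>D a b\<bar> \<le> sqrt G * sqrt (6 * (7 + 2 * (b - a)) * \<eta>\<^sup>2)" if "\<eta> > 0" for \<eta>
  proof -
    obtain y where y: "y \<in> L2 T" "continuous_on UNIV y" "L2_norm T (\<lambda>t. w t - y t) < \<eta>"
      using continuous_dense_in_L2[OF w \<open>\<eta> > 0\<close>] by blast
    define q where "q t = (norm (w t - y t))\<^sup>2" for t
    have q_abs: "q absolutely_integrable_on {0..T}"
      unfolding q_def using L2D(3)[OF L2_diff[OF w y(1)]] by (simp add: Xi_integrable_iff)
    have q_abs': "q absolutely_integrable_on {s..t}" if "{s..t} \<subseteq> {0..T}" for s t
      using absolutely_integrable_on_subinterval[OF q_abs that] .
    have q_int: "q integrable_on {s..t}" if "{s..t} \<subseteq> {0..T}" for s t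
      using q_abs'[OF that] by (rule set_lebesgue_integral_eq_integral(1))
    have q_nonneg: "q t \<ge> 0" for t by (simp add: q_def)
    have "integral {a..b} q \<le> integral {0..T} q"
      using q_nonneg by (intro integral_subset_le ab q_int) auto
    also have "\<dots> = (L2_norm T (\<lambda>t. w t - y t))\<^sup>2"
      unfolding L2_norm_power2 q_def[symmetric] using q_abs by (simp add: Xi_integral Xi_integrable_iff)
    also have "\<dots> \<le> \<eta>\<^sup>2"
      using y(3) by (intro power_mono L2_norm_nonneg) auto
    finally have q_small: "integral {a..b} q \<le> \<eta>\<^sup>2" .
    have "uniformly_continuous_on {a..b} y"
      using y(2) by (intro compact_uniformly_continuous) (auto intro: continuous_on_subset)
    then obtain d where "d > 0" and d: "\<And>s t. \<lbrakk>s \<in> {a..b}; t \<in> {a..b}; dist t s < d\<rbrakk> \<Longrightarrow> dist (y t) (y s) < \<eta>"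
      using \<open>\<eta> > 0\<close> unfolding uniformly_continuous_on_def by metis
    have \<delta>: "min (d/2) (\<eta>\<^sup>2) > 0" and ends: "a \<notin> N" "b \<notin> N"
      using \<open>d > 0\<close> \<open>\<eta> > 0\<close> a b by auto
    obtain x m where x': "x 0 = a" "x m = b" "\<forall>k<m. x k \<le> x (Suc k)"
      "\<forall>k<m. x (Suc k) \<le> x k + min (d/2) (\<eta>\<^sup>2)" "\<forall>k\<le>m. x k \<in> {a..b} - N"
      "(\<Sum>k<m. (x (Suc k) - x k) * (q (x k) + q (x (Suc k)))) \<le> 4 * integral {a..b} q + min (d/2) (\<eta>\<^sup>2)"
      by (rule good_partition[OF q_abs'[OF ab] q_nonneg \<open>a < b\<close> \<delta> N(1) ends])
    note x = x'(1,2) x'(3-5)[rule_format] x'(6)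
    have x_good: "x k \<in> {0<..<T} - N" if "k \<le> m" for k
      using x(5)[OF that] a b by auto
    have x_sub: "{x k..x (Suc k)} \<subseteq> {a..b}" if "k < m" for k
      using x(5)[of k] x(5)[of "Suc k"] that by auto
    have telescope: "D a b = (\<Sum>k<m. D (x k) (x (Suc k)))"
    proof -
      have "(\<Sum>k<m. integral {x k..x (Suc k)} (\<lambda>\<tau>. g \<tau> (w \<tau>))) = integral {a..b} (\<lambda>\<tau>. g \<tau> (w \<tau>))"
        using sum_integral_partition[of "\<lambda>\<tau>. g \<tau> (w \<tau>)" x m] x(1-3) L2_pairing_integrable[OF g w ab] by auto
      moreover have "(\<Sum>k<m. (norm (\<iota> (w (x (Suc k)))))\<^sup>2 - (norm (\<iota> (w (x k))))\<^sup>2)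
          = (norm (\<iota> (w b)))\<^sup>2 - (norm (\<iota> (w a)))\<^sup>2"
        using sum_lessThan_telescope[of "\<lambda>k. (norm (\<iota> (w (x k))))\<^sup>2" m] x(1,2) by simp
      ultimately show ?thesis
        unfolding D_def sum_subtractf[of _ "\<lambda>k. 2 * _ k"] by (simp add: sum_distrib_left[symmetric])
    qed
    have piece: "\<bar>D s t\<bar> \<le> \<kappa> * integral {s..t} (\<lambda>\<tau>. (norm (g \<tau>))\<^sup>2)
        + 3 / (2 * \<kappa>) * ((t - s) * (q s + q t + 2 * \<eta>\<^sup>2) + 2 * integral {s..t} q)"
      if \<kappa>: "\<kappa> > 0" and s: "s \<in> {a..b} - N" and t: "t \<in> {a..b} - N" and "s \<le> t" "t - s < d" for \<kappa> s t
    proof -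
      have sub: "{s..t} \<subseteq> {0..T}" using s t ab by auto
      have z: "(norm (w p - w \<tau>))\<^sup>2 \<le> 3 * (q p + \<eta>\<^sup>2 + q \<tau>)" if "p \<in> {s, t}" "\<tau> \<in> {s..t}" for p \<tau>
      proof -
        have "dist (y p) (y \<tau>) < \<eta>"
          using that s t \<open>t - s < d\<close> by (intro d) (auto simp: dist_real_def)
        moreover have "norm (w p - w \<tau>) \<le> norm (w p - y p) + norm (y p - y \<tau>) + norm (w \<tau> - y \<tau>)"
          by norm
        ultimately have "norm (w p - w \<tau>) \<le> norm (w p - y p) + \<eta> + norm (w \<tau> - y \<tau>)"
          by (simp add: dist_norm)
        then have "(norm (w p - w \<tau>))\<^sup>2 \<le> (norm (w p - y p) + \<eta> + norm (w \<tau> - y \<tau>))\<^sup>2"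
          by (intro power_mono) auto
        also have "\<dots> \<le> 3 * (q p + \<eta>\<^sup>2 + q \<tau>)"
          using sum_squares_bound[of "norm (w p - y p)" \<eta>] sum_squares_bound[of "norm (w p - y p)" "norm (w \<tau> - y \<tau>)"]
            sum_squares_bound[of \<eta> "norm (w \<tau> - y \<tau>)"]
          unfolding q_def by (simp add: power2_eq_square algebra_simps)
        finally show ?thesis .
      qed
      define bd where "bd \<tau> = \<kappa> * (norm (g \<tau>))\<^sup>2 + 3 / (2 * \<kappa>) * (q s + q t + 2 * \<eta>\<^sup>2 + 2 * q \<tau>)" for \<tau>
      have bd_int: "((\<lambda>\<tau>. bd \<tau>) has_integral (\<kappa> * integral {s..t} (\<lambda>\<tau>. (norm (g \<tau>))\<^sup>2)
          + 3 / (2 * \<kappa>) * ((t - s) * (q s + q t + 2 * \<eta>\<^sup>2) + 2 * integral {s..t} q))) {s..t}"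
        unfolding bd_def
        using has_integral_const_real[of "q s + q t + 2 * \<eta>\<^sup>2" s t] \<open>s \<le> t\<close>
        by (intro has_integral_add has_integral_mult_right integrable_integral q_int sub
            set_lebesgue_integral_eq_integral(1)[OF L2_products_integrable(2)[OF g g sub]]) auto
      have "D s t = integral {s..t} (\<lambda>\<tau>. g \<tau> ((w s - w \<tau>) + (w t - w \<tau>)))"
        by (rule D_eq) (use s t \<open>s \<le> t\<close> a b in auto)
      also have "norm \<dots> \<le> integral {s..t} bd"
      proof (rule integral_norm_bound_integral)
        show "(\<lambda>\<tau>. g \<tau> ((w s - w \<tau>) + (w t - w \<tau>))) integrable_on {s..t}"
          by (rule L2_pairing_integrable[OF g L2_add[OF L2_diff[OF L2_const w] L2_diff[OF L2_const w]] sub])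
        show "bd integrable_on {s..t}" using bd_int by blast
        fix \<tau> assume \<tau>: "\<tau> \<in> {s..t}"
        have "norm (g \<tau> ((w s - w \<tau>) + (w t - w \<tau>))) \<le> norm (g \<tau>) * norm ((w s - w \<tau>) + (w t - w \<tau>))"
          by (rule norm_blinfun)
        also have "\<dots> \<le> norm (g \<tau>) * (norm (w s - w \<tau>) + norm (w t - w \<tau>))"
          by (intro mult_left_mono norm_triangle_ineq) simp
        also have "\<dots> \<le> \<kappa> * (norm (g \<tau>))\<^sup>2 + ((norm (w s - w \<tau>))\<^sup>2 + (norm (w t - w \<tau>))\<^sup>2) / (2 * \<kappa>)"
          using weighted_Young[OF \<kappa>, of "norm (g \<tau>)" "norm (w s - w \<tau>)"]
            weighted_Young[OF \<kappa>, of "norm (g \<tau>)" "norm (w t - w \<tau>)"] \<kappa>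
          by (simp add: distrib_left add_divide_distrib)
        also have "\<dots> \<le> \<kappa> * (norm (g \<tau>))\<^sup>2 + (3 * (q s + q t + 2 * \<eta>\<^sup>2 + 2 * q \<tau>)) / (2 * \<kappa>)"
          using z[of s \<tau>] z[of t \<tau>] \<tau> \<kappa> by (intro add_left_mono divide_right_mono) auto
        also have "\<dots> = bd \<tau>" by (simp add: bd_def)
        finally show "norm (g \<tau> ((w s - w \<tau>) + (w t - w \<tau>))) \<le> bd \<tau>" .
      qed
      finally show ?thesis
        using integral_unique[OF bd_int] by simp
    qed
    show ?thesis
    proof (rule le_sqrt_mult_sqrt)
      show "0 \<le> G"
        unfolding G_def
        by (intro integral_nonneg set_lebesgue_integral_eq_integral(1)[OF L2_products_integrable(2)[OF g g ab]]) simp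
      show "0 \<le> 6 * (7 + 2 * (b - a)) * \<eta>\<^sup>2" using \<open>a < b\<close> by simp
      fix k :: real assume "k > 0"
      define \<kappa> where "\<kappa> = k / 2"
      have \<kappa>: "\<kappa> > 0" using \<open>k > 0\<close> by (simp add: \<kappa>_def)
      let ?I = "\<lambda>f j. integral {x j..x (Suc j)} f"
      have sum_I: "(\<Sum>j<m. ?I f j) = integral {a..b} f" if "f integrable_on {a..b}" for f :: "real \<Rightarrow> real"
        using sum_integral_partition[of f x m] x(1-3) that by auto
      have "\<bar>D a b\<bar> \<le> (\<Sum>j<m. \<bar>D (x j) (x (Suc j))\<bar>)"
        unfolding telescope by (rule sum_abs)
      also have "\<dots> \<le> (\<Sum>j<m. \<kappa> * ?I (\<lambda>\<tau>. (norm (g \<tau>))\<^sup>2) j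
          + 3 / (2 * \<kappa>) * ((x (Suc j) - x j) * (q (x j) + q (x (Suc j)) + 2 * \<eta>\<^sup>2) + 2 * ?I q j))"
      proof (rule sum_mono)
        fix j assume "j \<in> {..<m}"
        then have j: "j < m" by simp
        have "x (Suc j) \<le> x j + d / 2" using x(4)[OF j] by simp
        then show "\<bar>D (x j) (x (Suc j))\<bar> \<le> \<kappa> * ?I (\<lambda>\<tau>. (norm (g \<tau>))\<^sup>2) j
          + 3 / (2 * \<kappa>) * ((x (Suc j) - x j) * (q (x j) + q (x (Suc j)) + 2 * \<eta>\<^sup>2) + 2 * ?I q j)"
          using x(3)[OF j] x(5)[of j] x(5)[of "Suc j"] j \<open>d > 0\<close> by (intro piece \<kappa>) auto
      qed
      also have "\<dots> = \<kappa> * (\<Sum>j<m. ?I (\<lambda>\<tau>. (norm (g \<tau>))\<^sup>2) j)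
          + 3 / (2 * \<kappa>) * ((\<Sum>j<m. (x (Suc j) - x j) * (q (x j) + q (x (Suc j))))
            + 2 * \<eta>\<^sup>2 * (\<Sum>j<m. x (Suc j) - x j) + 2 * (\<Sum>j<m. ?I q j))"
        unfolding sum_distrib_left sum.distrib[symmetric]
        by (intro sum.cong refl) (simp add: algebra_simps)
      also have "(\<Sum>j<m. ?I (\<lambda>\<tau>. (norm (g \<tau>))\<^sup>2) j) = G"
        unfolding G_def
        by (intro sum_I set_lebesgue_integral_eq_integral(1)[OF L2_products_integrable(2)[OF g g ab]])
      also have "(\<Sum>j<m. x (Suc j) - x j) = b - a"
        using sum_lessThan_telescope[of x m] x(1,2) by simp
      also have "(\<Sum>j<m. ?I q j) = integral {a..b} q"
        by (intro sum_I q_int ab)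
      also have "\<kappa> * G + 3 / (2 * \<kappa>) * ((\<Sum>j<m. (x (Suc j) - x j) * (q (x j) + q (x (Suc j))))
            + 2 * \<eta>\<^sup>2 * (b - a) + 2 * integral {a..b} q)
          \<le> \<kappa> * G + 3 / (2 * \<kappa>) * ((4 * \<eta>\<^sup>2 + \<eta>\<^sup>2) + 2 * \<eta>\<^sup>2 * (b - a) + 2 * \<eta>\<^sup>2)"
        using x(6) q_small \<kappa> by (intro add_left_mono mult_left_mono add_mono) auto
      finally have "\<bar>D a b\<bar> \<le> \<kappa> * G + 3 / (2 * \<kappa>) * ((4 * \<eta>\<^sup>2 + \<eta>\<^sup>2) + 2 * \<eta>\<^sup>2 * (b - a) + 2 * \<eta>\<^sup>2)" .
      then have "2 * \<bar>D a b\<bar> \<le> 2 * (\<kappa> * G + 3 / (2 * \<kappa>) * ((4 * \<eta>\<^sup>2 + \<eta>\<^sup>2) + 2 * \<eta>\<^sup>2 * (b - a) + 2 * \<eta>\<^sup>2))"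
        by (rule mult_left_mono) simp
      also have "\<dots> = k * G + 6 * (7 + 2 * (b - a)) * \<eta>\<^sup>2 / k"
        using \<open>k > 0\<close> by (simp add: \<kappa>_def field_simps)
      finally show "2 * \<bar>D a b\<bar> \<le> k * G + 6 * (7 + 2 * (b - a)) * \<eta>\<^sup>2 / k" .
    qed
  qed
  define C where "C = sqrt G * sqrt (6 * (7 + 2 * (b - a)))"
  have "\<bar>D a b\<bar> \<le> 0 + e" if "e > 0" for e
  proof -
    have "\<bar>D a b\<bar> \<le> sqrt G * sqrt (6 * (7 + 2 * (b - a)) * (e / (\<bar>C\<bar> + 1))\<^sup>2)"
      by (rule key) (use that in \<open>simp add: add_nonneg_pos\<close>)
    also have "\<dots> = C * (e / (\<bar>C\<bar> + 1))"
      using that by (simp add: C_def real_sqrt_mult)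
    also have "\<dots> \<le> e"
    proof -
      have "C * e \<le> (\<bar>C\<bar> + 1) * e" using that by (intro mult_right_mono) auto
      then show ?thesis by (simp add: divide_simps mult.commute)
    qed
    finally show ?thesis by simp
  qed
  then have "\<bar>D a b\<bar> \<le> 0" by (rule field_le_epsilon)
  then have "D a b = 0" by simp
  then show ?thesis by (simp add: D_def)
qed

text \<open>
  For \<open>s < t\<close> choose \<open>r\<close> in between with \<open>(t - s) \<parallel>w(r)\<parallel>\<^sup>2 \<le> \<integral>\<^sub>s\<^sup>t \<parallel>w\<parallel>\<^sup>2\<close>. The energy identity gives
  \<open>\<parallel>\<iota> w(t) - \<iota> w(r)\<parallel>\<^sup>2 = 2 \<integral>\<^sub>r\<^sup>t w'(w - w(r))\<close>, where the constant \<open>w(r)\<close> costs no more than \<open>w\<close>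
  itself, and the same holds on \<open>[s,r]\<close>. The resulting bound involves \<open>s\<close> and \<open>t\<close> only through
  \<open>\<integral>\<^sub>s\<^sup>t \<parallel>w'\<parallel>\<^sup>2\<close>, which is uniformly small for close \<open>s\<close> and \<open>t\<close>.
\<close>

lemma uniformly_continuous_off_null_set:
  assumes N: "negligible N"
    "\<And>r s t. \<lbrakk>r \<in> {0<..<T} - N; s \<in> {0<..<T} - N; t \<in> {0<..<T} - N; s \<le> t\<rbrakk> \<Longrightarrow>
      inner (\<iota> (w t) - \<iota> (w s)) (\<iota> (w r)) = integral {s..t} (\<lambda>\<tau>. g \<tau> (w r))"
  shows "uniformly_continuous_on ({0<..<T} - N) (\<lambda>t. \<iota> (w t))"
proof -
  define W where "W = L2_norm T w"
  define F where "F t = integral {0..t} (\<lambda>\<tau>. (norm (g \<tau>))\<^sup>2)" for t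
  have g2: "(\<lambda>\<tau>. (norm (g \<tau>))\<^sup>2) integrable_on {s..t}" if "{s..t} \<subseteq> {0..T}" for s t
    using set_lebesgue_integral_eq_integral(1)[OF L2_products_integrable(2)[OF g g that]] .
  have w2: "(\<lambda>\<tau>. (norm (w \<tau>))\<^sup>2) integrable_on {s..t}" if "{s..t} \<subseteq> {0..T}" for s t
    using set_lebesgue_integral_eq_integral(1)[OF L2_products_integrable(2)[OF w w that]] .
  have w2_le: "integral {s..t} (\<lambda>\<tau>. (norm (w \<tau>))\<^sup>2) \<le> W\<^sup>2" if "{s..t} \<subseteq> {0..T}" for s t
  proof -
    have "integral {s..t} (\<lambda>\<tau>. (norm (w \<tau>))\<^sup>2) \<le> integral {0..T} (\<lambda>\<tau>. (norm (w \<tau>))\<^sup>2)"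
      by (intro integral_subset_le that w2) auto
    then show ?thesis
      unfolding W_def L2_norm_power2 using L2D(3)[OF w] by (simp add: Xi_integral)
  qed
  have W: "W \<ge> 0" by (simp add: W_def L2_norm_nonneg)
  have energy: "(norm (\<iota> (w b)))\<^sup>2 - (norm (\<iota> (w a)))\<^sup>2 = 2 * integral {a..b} (\<lambda>\<tau>. g \<tau> (w \<tau>))"
    if "a \<in> {0<..<T} - N" "b \<in> {0<..<T} - N" "a \<le> b" for a b
    using energy_identity_off_null_set[OF N that(1,2)] that(3) by (cases "a = b") auto
  have step: "(norm (\<iota> (w q) - \<iota> (w p)))\<^sup>2 = 2 * integral {p..q} (\<lambda>\<tau>. g \<tau> (w \<tau> - w p))"
     "(norm (\<iota> (w q) - \<iota> (w p)))\<^sup>2 = 2 * integral {p..q} (\<lambda>\<tau>. g \<tau> (w q - w \<tau>))"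
    if p: "p \<in> {0<..<T} - N" and q: "q \<in> {0<..<T} - N" and "p \<le> q" for p q
  proof -
    have sub: "{p..q} \<subseteq> {0..T}" using p q by auto
    have "(norm (\<iota> (w q) - \<iota> (w p)))\<^sup>2 = ((norm (\<iota> (w q)))\<^sup>2 - (norm (\<iota> (w p)))\<^sup>2)
        - 2 * inner (\<iota> (w q) - \<iota> (w p)) (\<iota> (w p))"
      by (simp add: power2_norm_eq_inner algebra_simps inner_commute)
    also have "\<dots> = 2 * integral {p..q} (\<lambda>\<tau>. g \<tau> (w \<tau>)) - 2 * integral {p..q} (\<lambda>\<tau>. g \<tau> (w p))"
      using energy[OF p q \<open>p \<le> q\<close>] N(2)[OF p p q \<open>p \<le> q\<close>] by simp
    also have "\<dots> = 2 * integral {p..q} (\<lambda>\<tau>. g \<tau> (w \<tau> - w p))"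
      unfolding blinfun.diff_right
      by (simp add: Henstock_Kurzweil_Integration.integral_diff L2_pairing_integrable[OF g L2_const sub]
          L2_pairing_integrable[OF g w sub])
    finally show "(norm (\<iota> (w q) - \<iota> (w p)))\<^sup>2 = 2 * integral {p..q} (\<lambda>\<tau>. g \<tau> (w \<tau> - w p))" .
    have "(norm (\<iota> (w q) - \<iota> (w p)))\<^sup>2 = 2 * inner (\<iota> (w q) - \<iota> (w p)) (\<iota> (w q))
        - ((norm (\<iota> (w q)))\<^sup>2 - (norm (\<iota> (w p)))\<^sup>2)"
      by (simp add: power2_norm_eq_inner algebra_simps inner_commute)
    also have "\<dots> = 2 * integral {p..q} (\<lambda>\<tau>. g \<tau> (w q)) - 2 * integral {p..q} (\<lambda>\<tau>. g \<tau> (w \<tau>))"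
      using energy[OF p q \<open>p \<le> q\<close>] N(2)[OF q p q \<open>p \<le> q\<close>] by simp
    also have "\<dots> = 2 * integral {p..q} (\<lambda>\<tau>. g \<tau> (w q - w \<tau>))"
      unfolding blinfun.diff_right
      by (simp add: Henstock_Kurzweil_Integration.integral_diff L2_pairing_integrable[OF g L2_const sub]
          L2_pairing_integrable[OF g w sub])
    finally show "(norm (\<iota> (w q) - \<iota> (w p)))\<^sup>2 = 2 * integral {p..q} (\<lambda>\<tau>. g \<tau> (w q - w \<tau>))" .
  qed
  \<comment> \<open>the two halves \<open>[s,r]\<close> and \<open>[r,t]\<close> each contribute at most \<open>sqrt (4 W sqrt (F t - F s))\<close>\<close>
  have modulus: "norm (\<iota> (w t) - \<iota> (w s)) \<le> 2 * sqrt (4 * W * sqrt (F t - F s))"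
    if s: "s \<in> {0<..<T} - N" and t: "t \<in> {0<..<T} - N" and "s < t" for s t
  proof -
    have st: "{s..t} \<subseteq> {0..T}" using s t by auto
    have F: "integral {s..t} (\<lambda>\<tau>. (norm (g \<tau>))\<^sup>2) = F t - F s"
      using Henstock_Kurzweil_Integration.integral_combine[of 0 s t "\<lambda>\<tau>. (norm (g \<tau>))\<^sup>2"] g2[of 0 t] s t \<open>s < t\<close>
      by (auto simp: F_def)
    obtain r where r: "r \<in> {s<..<t} - N" "(t - s) * (norm (w r))\<^sup>2 \<le> integral {s..t} (\<lambda>\<tau>. (norm (w \<tau>))\<^sup>2)"
      using exists_value_below_average[OF L2_products_integrable(2)[OF w w st] \<open>s < t\<close> N(1)] by blast
    have r': "r \<in> {0<..<T} - N" using r(1) s t by auto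
    have bound: "\<bar>integral {p..q} (\<lambda>\<tau>. g \<tau> (y \<tau>))\<bar> \<le> sqrt (F t - F s) * (2 * W)"
      if pq: "{p..q} \<subseteq> {s..t}" "p \<le> q" and y: "y \<in> L2 T" "\<And>\<tau>. (norm (y \<tau>))\<^sup>2 \<le> 2 * (norm (w \<tau>))\<^sup>2 + 2 * (norm (w r))\<^sup>2"
      for p q y
    proof -
      have sub: "{p..q} \<subseteq> {0..T}" using pq(1) st by blast
      have "\<bar>integral {p..q} (\<lambda>\<tau>. g \<tau> (y \<tau>))\<bar>
          \<le> sqrt (integral {p..q} (\<lambda>\<tau>. (norm (g \<tau>))\<^sup>2)) * sqrt (integral {p..q} (\<lambda>\<tau>. (norm (y \<tau>))\<^sup>2))"
        by (rule L2_pairing_interval_bound[OF g y(1) sub])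
      also have "\<dots> \<le> sqrt (F t - F s) * sqrt ((2 * W)\<^sup>2)"
      proof (intro mult_mono real_sqrt_le_mono)
        show "integral {p..q} (\<lambda>\<tau>. (norm (g \<tau>))\<^sup>2) \<le> F t - F s"
          unfolding F[symmetric] by (intro integral_subset_le g2 sub st pq) auto
        have "integral {p..q} (\<lambda>\<tau>. (norm (y \<tau>))\<^sup>2)
            \<le> integral {p..q} (\<lambda>\<tau>. 2 * (norm (w \<tau>))\<^sup>2 + 2 * (norm (w r))\<^sup>2)"
          using y(2) by (intro integral_le integrable_add integrable_on_mult_right w2 sub integrable_const_ivl
              set_lebesgue_integral_eq_integral(1)[OF L2_products_integrable(2)[OF y(1) y(1) sub]]) auto
        also have "\<dots> = 2 * integral {p..q} (\<lambda>\<tau>. (norm (w \<tau>))\<^sup>2) + (q - p) * (2 * (norm (w r))\<^sup>2)"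
          using w2[OF sub] pq(2) by (subst Henstock_Kurzweil_Integration.integral_add)
            (auto intro!: integrable_on_mult_right)
        also have "\<dots> \<le> 2 * W\<^sup>2 + (t - s) * (2 * (norm (w r))\<^sup>2)"
          using pq w2_le[OF sub] by (intro add_mono mult_left_mono mult_right_mono) auto
        also have "\<dots> \<le> (2 * W)\<^sup>2"
          using r(2) w2_le[OF st] by (simp add: power_mult_distrib)
        finally show "integral {p..q} (\<lambda>\<tau>. (norm (y \<tau>))\<^sup>2) \<le> (2 * W)\<^sup>2" .
        show "0 \<le> sqrt (integral {p..q} (\<lambda>\<tau>. (norm (y \<tau>))\<^sup>2))"
          by (intro real_sqrt_ge_zero integral_nonneg
              set_lebesgue_integral_eq_integral(1)[OF L2_products_integrable(2)[OF y(1) y(1) sub]]) simp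
        show "0 \<le> sqrt (F t - F s)"
          unfolding F[symmetric] by (intro real_sqrt_ge_zero integral_nonneg g2 st) simp
      qed
      also have "sqrt ((2 * W)\<^sup>2) = 2 * W" using W by (simp only: real_sqrt_abs)
      finally show ?thesis .
    qed
    have diff_bound: "(norm (x - y))\<^sup>2 \<le> 2 * (norm x)\<^sup>2 + 2 * (norm y)\<^sup>2" for x y :: 'v
      using norm_add_power2_le[of x "- y"] by simp
    have "(norm (\<iota> (w t) - \<iota> (w r)))\<^sup>2 \<le> 4 * W * sqrt (F t - F s)"
      using bound[of r t "\<lambda>\<tau>. w \<tau> - w r"] step(1)[OF r' t] r(1) L2_diff[OF w L2_const[of "w r"]] diff_bound
      by (auto simp: algebra_simps)
    then have 1: "norm (\<iota> (w t) - \<iota> (w r)) \<le> sqrt (4 * W * sqrt (F t - F s))"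
      by (rule real_le_rsqrt)
    have "(norm (\<iota> (w r) - \<iota> (w s)))\<^sup>2 \<le> 4 * W * sqrt (F t - F s)"
      using bound[of s r "\<lambda>\<tau>. w r - w \<tau>"] step(2)[OF s r'] r(1) L2_diff[OF L2_const[of "w r"] w] diff_bound[of "w r"]
      by (auto simp: algebra_simps)
    then have 2: "norm (\<iota> (w r) - \<iota> (w s)) \<le> sqrt (4 * W * sqrt (F t - F s))"
      by (rule real_le_rsqrt)
    have "norm (\<iota> (w t) - \<iota> (w s)) \<le> norm (\<iota> (w t) - \<iota> (w r)) + norm (\<iota> (w r) - \<iota> (w s))"
      using norm_triangle_ineq[of "\<iota> (w t) - \<iota> (w r)" "\<iota> (w r) - \<iota> (w s)"] by simp
    then show ?thesis using 1 2 by simp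
  qed
  show ?thesis
    unfolding uniformly_continuous_on_def
  proof (intro allI impI)
    fix e :: real assume "e > 0"
    have "((\<lambda>x. 2 * sqrt (4 * W * sqrt x)) \<longlongrightarrow> 2 * sqrt (4 * W * sqrt 0)) (at 0)"
      by (intro tendsto_intros)
    then have "eventually (\<lambda>x. 2 * sqrt (4 * W * sqrt x) < e) (at 0)"
      using \<open>e > 0\<close> by (intro order_tendstoD(2)) auto
    then obtain d where d: "d > 0" "\<And>x. x \<noteq> 0 \<Longrightarrow> dist x 0 < d \<Longrightarrow> 2 * sqrt (4 * W * sqrt x) < e"
      unfolding eventually_at by auto
    have "continuous_on {0..T} F"
      unfolding F_def by (intro indefinite_integral_continuous_1 g2) simp
    then have "uniformly_continuous_on {0..T} F"
      by (intro compact_uniformly_continuous) auto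
    then obtain \<delta> where \<delta>: "\<delta> > 0" "\<And>s t. \<lbrakk>s \<in> {0..T}; t \<in> {0..T}; dist t s < \<delta>\<rbrakk> \<Longrightarrow> dist (F t) (F s) < d"
      using d(1) unfolding uniformly_continuous_on_def by metis
    have close: "dist (\<iota> (w t)) (\<iota> (w s)) < e"
      if "s \<in> {0<..<T} - N" "t \<in> {0<..<T} - N" "dist t s < \<delta>" "s < t" for s t
    proof -
      have "dist (F t) (F s) < d" using \<delta>(2)[of s t] that by auto
      then have "2 * sqrt (4 * W * sqrt (F t - F s)) < e"
        using d(2)[of "F t - F s"] \<open>e > 0\<close> by (cases "F t - F s = 0") (auto simp: dist_real_def)
      then show ?thesis using modulus[OF that(1,2,4)] by (simp add: dist_norm)
    qed
    have "dist (\<iota> (w t)) (\<iota> (w s)) < e"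
      if "s \<in> {0<..<T} - N" "t \<in> {0<..<T} - N" "dist t s < \<delta>" for s t
      using close[of s t] close[of t s] that \<open>e > 0\<close> by (cases s t rule: linorder_cases) (auto simp: dist_commute)
    then show "\<exists>d>0. \<forall>x\<in>{0<..<T} - N. \<forall>x'\<in>{0<..<T} - N. dist x' x < d \<longrightarrow> dist (\<iota> (w x')) (\<iota> (w x)) < e"
      using \<delta>(1) by blast
  qed
qed

text \<open>
  The energy identity extends to the end points because
  \<open>\<parallel>c(t)\<parallel>\<^sup>2 - 2 \<integral>\<^sub>0\<^sup>t w'(w)\<close> is continuous on \<open>[0,T]\<close> and constant on a dense subset.
\<close>

lemma continuous_representative_exists:
  assumes "T > 0"
  obtains c where "continuous_on {0..T} c" "AE t in Xi T. c t = \<iota> (w t)"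
    "(norm (c T))\<^sup>2 - (norm (c 0))\<^sup>2 = 2 * (LINT t|Xi T. g t (w t))"
proof -
  obtain N where N: "negligible N"
    "\<And>r s t. \<lbrakk>r \<in> {0<..<T} - N; s \<in> {0<..<T} - N; t \<in> {0<..<T} - N; s \<le> t\<rbrakk> \<Longrightarrow>
      inner (\<iota> (w t) - \<iota> (w s)) (\<iota> (w r)) = integral {s..t} (\<lambda>\<tau>. g \<tau> (w r))"
    using increments_against_values by metis
  have dense: "closure ({0<..<T} - N) = {0..T}"
    by (rule closure_interval_minus_negligible[OF N(1) \<open>T > 0\<close>])
  obtain c where c: "uniformly_continuous_on {0..T} c" "\<And>t. t \<in> {0<..<T} - N \<Longrightarrow> \<iota> (w t) = c t"
  proof (rule uniformly_continuous_on_extension_on_closure)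
    show "uniformly_continuous_on ({0<..<T} - N) (\<lambda>t. \<iota> (w t))"
      by (rule uniformly_continuous_off_null_set[OF N])
    fix c assume *: "uniformly_continuous_on (closure ({0<..<T} - N)) c"
      "\<And>t. t \<in> {0<..<T} - N \<Longrightarrow> \<iota> (w t) = c t"
    show thesis
      by (rule that[OF _ *(2)]) (use *(1) dense in auto)
  qed
  have c_cont: "continuous_on {0..T} c"
    by (rule uniformly_continuous_imp_continuous[OF c(1)])
  define P where "P t = (norm (c t))\<^sup>2 - 2 * integral {0..t} (\<lambda>\<tau>. g \<tau> (w \<tau>))" for t
  have pair: "(\<lambda>\<tau>. g \<tau> (w \<tau>)) integrable_on {0..t}" if "t \<le> T" for t
    using that by (intro L2_pairing_integrable[OF g w]) auto
  have P_cont: "continuous_on (closure ({0<..<T} - N)) P"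
    unfolding dense P_def by (intro continuous_intros c_cont indefinite_integral_continuous_1 pair) simp
  have P_eq: "P t = P s" if s: "s \<in> {0<..<T} - N" and t: "t \<in> {0<..<T} - N" and "s < t" for s t
  proof -
    have "integral {0..s} (\<lambda>\<tau>. g \<tau> (w \<tau>)) + integral {s..t} (\<lambda>\<tau>. g \<tau> (w \<tau>)) = integral {0..t} (\<lambda>\<tau>. g \<tau> (w \<tau>))"
      using s t \<open>s < t\<close> by (intro Henstock_Kurzweil_Integration.integral_combine pair) auto
    then show ?thesis
      using energy_identity_off_null_set[OF N s t \<open>s < t\<close>] c(2)[OF s] c(2)[OF t] by (simp add: P_def)
  qed
  obtain s where s: "s \<in> {0<..<T} - N"
    using dense \<open>T > 0\<close> by (metis all_not_in_conv atLeastatMost_empty_iff2 closure_empty less_imp_le)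
  have const: "P t = P s" if "t \<in> {0<..<T} - N" for t
    using P_eq[of s t] P_eq[of t s] s that by (cases s t rule: linorder_cases) auto
  have "P t = P s" if "t \<in> {0..T}" for t
    using continuous_constant_on_closure[OF P_cont const, of t] that unfolding dense by simp
  from this[of 0] this[of T] have "P 0 = P T" using \<open>T > 0\<close> by simp
  then have "(norm (c T))\<^sup>2 - (norm (c 0))\<^sup>2 = 2 * integral {0..T} (\<lambda>\<tau>. g \<tau> (w \<tau>))"
    by (simp add: P_def)
  then show thesis
    using c(2) N(1) L2_pairing(1)[OF g w]
    by (intro that[OF c_cont]) (auto simp: AE_lebesgue_on_iff Xi_integral intro!: exI[of _ N])
qed

end

section \<open>The time derivative and the traces on \<open>X\<close>\<close>

lemma X_spaceD:
  assumes "w \<in> X_space \<iota> T"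
  shows "w \<in> L2 T" "(\<lambda>t. V_to_Vdual \<iota> (w t)) \<in> L2 T" "time_deriv \<iota> T w \<in> L2 T"
    "weak_deriv T (\<lambda>t. V_to_Vdual \<iota> (w t)) (time_deriv \<iota> T w)"
proof -
  show "w \<in> L2 T" "(\<lambda>t. V_to_Vdual \<iota> (w t)) \<in> L2 T"
    using assms by (auto simp: X_space_def H1_dual_def)
  have "\<exists>g. g \<in> L2 T \<and> weak_deriv T (\<lambda>t. V_to_Vdual \<iota> (w t)) g"
    using assms by (auto simp: X_space_def H1_dual_def)
  then have "time_deriv \<iota> T w \<in> L2 T \<and> weak_deriv T (\<lambda>t. V_to_Vdual \<iota> (w t)) (time_deriv \<iota> T w)"
    unfolding time_deriv_def by (rule someI_ex)
  then show "time_deriv \<iota> T w \<in> L2 T" "weak_deriv T (\<lambda>t. V_to_Vdual \<iota> (w t)) (time_deriv \<iota> T w)"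
    by auto
qed

lemma weak_deriv_diff:
  fixes f g f' g' :: "real \<Rightarrow> 'v::real_normed_vector \<Rightarrow>\<^sub>L real"
  assumes "f \<in> L2 T" "g \<in> L2 T" "weak_deriv T f g" "f' \<in> L2 T" "g' \<in> L2 T" "weak_deriv T f' g'"
  shows "weak_deriv T (\<lambda>t. f t - f' t) (\<lambda>t. g t - g' t)"
  unfolding weak_deriv_def
proof (intro ballI allI)
  fix \<phi> v assume \<phi>: "\<phi> \<in> test_functions T"
  have int: "integrable (Xi T) (\<lambda>t. \<psi> t * blinfun_apply (h t) v)"
    if "continuous_on {0..T} \<psi>" "h \<in> L2 T" for \<psi> :: "real \<Rightarrow> real" and h :: "real \<Rightarrow> 'v \<Rightarrow>\<^sub>L real"
    using absolutely_integrable_continuous_mult[OF _ that(1)] L2_pairing(1)[OF that(2) L2_const[of v]]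
    unfolding Xi_integrable_iff by blast
  note int' = int[OF test_function_continuous(1)[OF \<phi>]] int[OF test_function_continuous(2)[OF \<phi>]]
  show "(LINT t|Xi T. deriv \<phi> t * blinfun_apply (f t - f' t) v) = - (LINT t|Xi T. \<phi> t * blinfun_apply (g t - g' t) v)"
    using assms(3,6) \<phi> int' assms(1,2,4,5)
    by (simp add: weak_deriv_def blinfun.diff_left right_diff_distrib)
qed

text \<open>
  The integral of \<open>h(t) v\<close> over \<open>[x,y]\<close> vanishes for almost all \<open>x\<close> and \<open>y\<close>; let \<open>y\<close> decrease to a
  Lebesgue point \<open>x\<close>.
\<close>

lemma weak_deriv_zero_imp_zero:
  fixes h :: "real \<Rightarrow> 'v::real_normed_vector \<Rightarrow>\<^sub>L real"
  assumes h: "h \<in> L2 T" and weak: "weak_deriv T (\<lambda>t. 0) h"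
  shows "AE t in Xi T. blinfun_apply (h t) v = 0"
proof -
  have \<gamma>: "(\<lambda>t. h t v) absolutely_integrable_on {0..T}"
    using L2_pairing(1)[OF h L2_const[of v]] by (simp add: Xi_integrable_iff)
  obtain N where N: "negligible N"
    "\<And>s t. \<lbrakk>s \<in> {0<..<T} - N; t \<in> {0<..<T} - N; s \<le> t\<rbrakk> \<Longrightarrow> 0 - 0 = integral {s..t} (\<lambda>t. h t v)"
  proof (rule weak_derivative_increments[where f="\<lambda>_. 0", OF _ \<gamma>])
    fix \<phi> assume \<phi>: "\<phi> \<in> test_functions T"
    have "(LINT t|Xi T. \<phi> t * h t v) = 0"
      using weak \<phi> by (simp add: weak_deriv_def)
    then show "integral {0..T} (\<lambda>t. deriv \<phi> t * 0) = - integral {0..T} (\<lambda>t. \<phi> t * h t v)"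
      using absolutely_integrable_continuous_mult[OF \<gamma> test_function_continuous(1)[OF \<phi>]]
      by (simp add: Xi_integral Xi_integrable_iff)
  qed auto
  obtain M where M: "negligible M" "\<And>x. x \<in> {0..<T} - M \<Longrightarrow>
       ((\<lambda>\<epsilon>. (1 / \<epsilon>) * integral {x..x + \<epsilon>} (\<lambda>t. \<bar>h t v - h x v\<bar>)) \<longlongrightarrow> 0) (at_right 0)"
  proof (rule lebesgue_points[OF \<gamma>])
    fix M assume "negligible M" and "\<And>x. x \<in> {0..<T} - M \<Longrightarrow>
       ((\<lambda>\<epsilon>. (1 / \<epsilon>) * integral {x..x + \<epsilon>} (\<lambda>t. \<bar>h t v - h x v\<bar>)) \<longlongrightarrow> 0) (at_right 0)"
    then show thesis by (rule that)
  qed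
  have "h x v = 0" if x: "x \<in> {0<..<T} - (N \<union> M)" for x
  proof -
    have "\<bar>h x v\<bar> \<le> 0 + e" if "e > 0" for e
    proof -
      have "eventually (\<lambda>\<epsilon>. (1 / \<epsilon>) * integral {x..x + \<epsilon>} (\<lambda>t. \<bar>h t v - h x v\<bar>) < e) (at_right 0)"
        using M(2)[of x] x \<open>e > 0\<close> by (intro order_tendstoD(2)) auto
      then obtain d where d: "d > 0" "\<And>\<epsilon>. 0 < \<epsilon> \<Longrightarrow> \<epsilon> < d \<Longrightarrow>
          (1 / \<epsilon>) * integral {x..x + \<epsilon>} (\<lambda>t. \<bar>h t v - h x v\<bar>) < e"
        unfolding eventually_at_right_field by auto
      have "x < min (x + d) T" using d(1) x by auto
      then have "\<not> negligible {x<..<min (x + d) T}"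
        by (intro open_not_negligible) auto
      then have "\<not> {x<..<min (x + d) T} \<subseteq> N"
        using N(1) negligible_subset by blast
      then obtain y where "y \<in> {x<..<min (x + d) T}" "y \<notin> N" by blast
      then have y: "x < y" "y < x + d" "y < T" "y \<notin> N" by auto
      define \<epsilon> where "\<epsilon> = y - x"
      have \<epsilon>: "0 < \<epsilon>" "\<epsilon> < d" "x + \<epsilon> = y" using y by (auto simp: \<epsilon>_def)
      have sub: "{x..y} \<subseteq> {0..T}" using x y by auto
      have int: "(\<lambda>t. h t v) integrable_on {x..y}"
        using L2_pairing_integrable[OF h L2_const sub] .
      have "\<epsilon> * h x v = - integral {x..y} (\<lambda>t. h t v - h x v)"
        using N(2)[of x y] x y \<epsilon>
        by (simp add: Henstock_Kurzweil_Integration.integral_diff[OF int integrable_const_ivl])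
      then have "\<bar>\<epsilon> * h x v\<bar> = norm (integral {x..y} (\<lambda>t. h t v - h x v))"
        by simp
      then have "\<epsilon> * \<bar>h x v\<bar> = norm (integral {x..y} (\<lambda>t. h t v - h x v))"
        using \<epsilon>(1) by (simp add: abs_mult)
      also have "\<dots> \<le> integral {x..y} (\<lambda>t. \<bar>h t v - h x v\<bar>)"
      proof (rule integral_norm_bound_integral)
        have "(\<lambda>t. h t v - h x v) absolutely_integrable_on {x..y}"
          by (intro set_integral_diff(1) absolutely_integrable_on_subinterval[OF \<gamma> sub]
              absolutely_integrable_continuous_real[OF continuous_on_const])
        then show "(\<lambda>t. h t v - h x v) integrable_on {x..y}" "(\<lambda>t. \<bar>h t v - h x v\<bar>) integrable_on {x..y}"
          by (auto simp: absolutely_integrable_on_def)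
      qed simp
      also have "\<dots> \<le> \<epsilon> * e"
        using d(2)[OF \<epsilon>(1,2)] \<epsilon>(1,3) by (simp add: field_simps)
      finally show ?thesis using \<epsilon>(1) by simp
    qed
    then show ?thesis using field_le_epsilon[of "\<bar>h x v\<bar>" 0] by simp
  qed
  then show ?thesis
    using negligible_Un[OF N(1) M(1)] unfolding AE_lebesgue_on_iff[OF sets_Xi] by blast
qed

text \<open>
  The functional \<open>h(t) = g(t) - g'(t)\<close> vanishes at each fixed \<open>v\<close> for almost every \<open>t\<close>. For
  nonseparable \<open>V\<close> these null sets cannot be united over all \<open>v\<close>, but it suffices to take the countably
  many values of simple functions converging to \<open>y\<close>.
\<close>

lemma weak_deriv_unique:
  fixes f g g' :: "real \<Rightarrow> 'v::real_normed_vector \<Rightarrow>\<^sub>L real"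
  assumes f: "f \<in> L2 T" and g: "g \<in> L2 T" "weak_deriv T f g" "g' \<in> L2 T" "weak_deriv T f g'"
    and y: "y \<in> L2 T"
  shows "(LINT t|Xi T. blinfun_apply (g t) (y t)) = (LINT t|Xi T. blinfun_apply (g' t) (y t))"
proof -
  define h where "h t = g t - g' t" for t
  have h: "h \<in> L2 T" unfolding h_def by (rule L2_diff[OF g(1,3)])
  have "weak_deriv T (\<lambda>t. 0) h"
    using weak_deriv_diff[OF f g(1,2) f g(3,4)] by (simp add: h_def[abs_def])
  then have zero: "AE t in Xi T. h t v = 0" for v
    by (rule weak_deriv_zero_imp_zero[OF h])
  obtain z where z: "\<And>i::nat. simple_function (Xi T) (z i)" "AE t in Xi T. (\<lambda>i. z i t) \<longlonglongrightarrow> y t"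
    using L2D(1)[OF y] unfolding strongly_measurable_def by blast
  define D where "D = (\<Union>i. z i ` {0<..<T})"
  have "countable D"
    unfolding D_def using z(1) by (intro countable_UN) (auto simp: simple_function_def intro: countable_finite)
  then have "AE t in Xi T. \<forall>v\<in>D. h t v = 0"
    using zero by (simp add: AE_ball_countable)
  moreover have "AE t in Xi T. t \<in> {0<..<T}"
    by (rule AE_I2) simp
  ultimately have "AE t in Xi T. blinfun_apply (g t) (y t) = blinfun_apply (g' t) (y t)"
    using z(2)
  proof eventually_elim
    case (elim t)
    have "(\<lambda>i. h t (z i t)) \<longlonglongrightarrow> h t (y t)"
      by (intro tendsto_intros elim(3))
    moreover have "h t (z i t) = 0" for i using elim(1,2) unfolding D_def by blast
    ultimately have "h t (y t) = 0" by (simp add: LIMSEQ_const_iff)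
    then show ?case by (simp add: h_def blinfun.diff_left)
  qed
  then show ?thesis
    by (rule integral_cong_AE[rotated 2])
       (use L2_pairing(1)[OF g(1) y] L2_pairing(1)[OF g(3) y] in auto)
qed

lemma V_to_Vdual_diff: "V_to_Vdual \<iota> (a - b) = V_to_Vdual \<iota> a - V_to_Vdual \<iota> b"
  by (rule blinfun_eqI) (simp add: V_to_Vdual_apply blinfun.diff_left blinfun.diff_right inner_diff_left)

text \<open>
  As \<open>time_deriv\<close> is an arbitrary choice of a weak derivative, linearity of \<open>d_t\<close> is a consequence of
  uniqueness.
\<close>

lemma X_space_diff:
  assumes u: "u \<in> X_space \<iota> T" and v: "v \<in> X_space \<iota> T"
  shows "(\<lambda>t. u t - v t) \<in> X_space \<iota> T"
    "y \<in> Y_space T \<Longrightarrow> d_t \<iota> T (\<lambda>t. u t - v t) y = d_t \<iota> T u y - d_t \<iota> T v y"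
proof -
  note U = X_spaceD[OF u] and V = X_spaceD[OF v]
  have weak: "weak_deriv T (\<lambda>t. V_to_Vdual \<iota> (u t - v t)) (\<lambda>t. time_deriv \<iota> T u t - time_deriv \<iota> T v t)"
    unfolding V_to_Vdual_diff by (rule weak_deriv_diff[OF U(2,3,4) V(2,3,4)])
  have dual: "(\<lambda>t. V_to_Vdual \<iota> (u t - v t)) \<in> L2 T"
    unfolding V_to_Vdual_diff by (rule L2_diff[OF U(2) V(2)])
  show X: "(\<lambda>t. u t - v t) \<in> X_space \<iota> T"
    unfolding X_space_def H1_dual_def
    using L2_diff[OF U(1) V(1)] dual weak L2_diff[OF U(3) V(3)] by blast
  assume y: "y \<in> Y_space T"
  have "(LINT t|Xi T. time_deriv \<iota> T (\<lambda>t. u t - v t) t (y t))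
      = (LINT t|Xi T. (time_deriv \<iota> T u t - time_deriv \<iota> T v t) (y t))"
    by (rule weak_deriv_unique[OF dual X_spaceD(3,4)[OF X] L2_diff[OF U(3) V(3)] weak y])
  then show "d_t \<iota> T (\<lambda>t. u t - v t) y = d_t \<iota> T u y - d_t \<iota> T v y"
    using y L2_pairing(1)[OF U(3) y] L2_pairing(1)[OF V(3) y]
    by (simp add: d_t_def blinfun.diff_left)
qed

lemma d_t_in_Y_dual:
  assumes "w \<in> X_space \<iota> T"
  shows "d_t \<iota> T w \<in> Y_dual T"
proof -
  let ?g = "time_deriv \<iota> T w"
  note g = X_spaceD(3)[OF assms]
  have "\<bar>d_t \<iota> T w y\<bar> \<le> L2_norm T ?g * Y_norm T y" if "y \<in> Y_space T" for y
    using L2_pairing(2)[OF g that] that by (simp add: d_t_def)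
  moreover have "d_t \<iota> T w (\<lambda>t. x t + y t) = d_t \<iota> T w x + d_t \<iota> T w y"
    if "x \<in> Y_space T" "y \<in> Y_space T" for x y
    using that L2_pairing(1)[OF g] L2_add[OF that] by (simp add: d_t_def blinfun.add_right)
  moreover have "d_t \<iota> T w (\<lambda>t. c *\<^sub>R y t) = c * d_t \<iota> T w y" if "y \<in> Y_space T" for c y
    using that L2_scaleR[OF that] by (simp add: d_t_def blinfun.scaleR_right)
  moreover have "d_t \<iota> T w \<in> extensional (Y_space T)"
    by (simp add: d_t_def)
  ultimately show ?thesis unfolding dual_space_def by blast
qed

text \<open>
  Two continuous representatives agree off a null set, hence on a dense subset of \<open>[0,T]\<close>.
\<close>

lemma time_trace_eqI:
  assumes "T > 0" and c: "continuous_on {0..T} c" "AE s in Xi T. c s = blinfun_apply \<iota> (w s)"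
    and t: "t \<in> {0..T}"
  shows "time_trace \<iota> T t w = c t"
proof -
  define c' where "c' = (SOME c. continuous_on {0..T} c \<and> (AE s in Xi T. c s = blinfun_apply \<iota> (w s)))"
  have c': "continuous_on {0..T} c' \<and> (AE s in Xi T. c' s = blinfun_apply \<iota> (w s))"
    unfolding c'_def by (rule someI[of _ c]) (use c in simp)
  have "AE s in Xi T. c s = c' s"
    using c(2) conjunct2[OF c'] by eventually_elim simp
  then obtain N where N: "negligible N" "\<And>s. s \<in> {0<..<T} - N \<Longrightarrow> c s = c' s"
    by (auto simp: AE_lebesgue_on_iff)
  have closure: "closure ({0<..<T} - N) = {0..T}"
    by (rule closure_interval_minus_negligible[OF N(1) \<open>T > 0\<close>])
  have "c t - c' t = 0"
    by (rule continuous_constant_on_closure[where S="{0<..<T} - N" and f="\<lambda>t. c t - c' t"])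
       (use closure c(1) c' N(2) t in \<open>auto intro!: continuous_on_diff\<close>)
  then show ?thesis by (simp add: time_trace_def c'_def)
qed

lemma X_trace:
  assumes "T > 0" and w: "w \<in> X_space \<iota> T"
  obtains c where "continuous_on {0..T} c" "AE s in Xi T. c s = blinfun_apply \<iota> (w s)"
    "\<And>t. t \<in> {0..T} \<Longrightarrow> time_trace \<iota> T t w = c t"
    "(norm (c T))\<^sup>2 - (norm (c 0))\<^sup>2 = 2 * d_t \<iota> T w w"
proof (rule continuous_representative_exists[OF X_spaceD[OF w] \<open>T > 0\<close>])
  fix c assume c: "continuous_on {0..T} c" "AE s in Xi T. c s = blinfun_apply \<iota> (w s)"
    "(norm (c T))\<^sup>2 - (norm (c 0))\<^sup>2 = 2 * (LINT t|Xi T. time_deriv \<iota> T w t (w t))"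
  show thesis
    using that[OF c(1,2) time_trace_eqI[OF \<open>T > 0\<close> c(1,2)]] c(3) X_spaceD(1)[OF w] by (simp add: d_t_def)
qed

lemma integration_by_parts_X:
  assumes "T > 0" and w: "w \<in> X_space \<iota> T"
  shows "2 * d_t \<iota> T w w = (norm (time_trace \<iota> T T w))\<^sup>2 - (norm (time_trace \<iota> T 0 w))\<^sup>2"
  by (rule X_trace[OF assms]) (use assms(1) in simp)

lemma time_trace_diff:
  assumes "T > 0" and u: "u \<in> X_space \<iota> T" and v: "v \<in> X_space \<iota> T" and t: "t \<in> {0..T}"
  shows "time_trace \<iota> T t (\<lambda>t. u t - v t) = time_trace \<iota> T t u - time_trace \<iota> T t v"
proof (rule X_trace[OF assms(1) u], rule X_trace[OF assms(1) v])
  fix c c' assume c: "continuous_on {0..T} c" "AE s in Xi T. c s = blinfun_apply \<iota> (u s)"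
    "\<And>t. t \<in> {0..T} \<Longrightarrow> time_trace \<iota> T t u = c t"
    and c': "continuous_on {0..T} c'" "AE s in Xi T. c' s = blinfun_apply \<iota> (v s)"
    "\<And>t. t \<in> {0..T} \<Longrightarrow> time_trace \<iota> T t v = c' t"
  have "AE s in Xi T. c s - c' s = blinfun_apply \<iota> (u s - v s)"
    using c(2) c'(2) by eventually_elim (simp add: blinfun.diff_right)
  then have "time_trace \<iota> T t (\<lambda>t. u t - v t) = c t - c' t"
    by (intro time_trace_eqI[OF \<open>T > 0\<close>] continuous_on_diff c(1) c'(1) t)
  then show ?thesis using c(3) c'(3) t by simp
qed

lemma X_norm_minus_commute:
  assumes "T > 0" and u: "u \<in> X_space \<iota> T" and v: "v \<in> X_space \<iota> T"
  shows "X_norm \<iota> T (\<lambda>t. u t - v t) = X_norm \<iota> T (\<lambda>t. v t - u t)"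
proof -
  have "Y_dual_norm T (d_t \<iota> T (\<lambda>t. u t - v t)) = Y_dual_norm T (d_t \<iota> T (\<lambda>t. v t - u t))"
    unfolding dual_norm_def
    by (intro SUP_cong refl) (simp add: X_space_diff(2)[OF u v] X_space_diff(2)[OF v u])
  then show ?thesis
    unfolding X_norm_def using assms(1)
    by (simp add: L2_norm_diff_commute[of T u v] time_trace_diff[OF assms(1) u v] time_trace_diff[OF assms(1) v u]
        norm_minus_commute)
qed

section \<open>Functionals on \<open>Y\<close>\<close>

lemma Y_dual_bdd_above:
  fixes f :: "(real \<Rightarrow> 'v::{real_inner,complete_space}) \<Rightarrow> real"
  assumes "f \<in> Y_dual T"
  shows "bdd_above ((\<lambda>x. \<bar>f x\<bar>) ` {x \<in> Y_space T. Y_norm T x \<le> 1})"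
proof -
  obtain C where C: "\<And>x. x \<in> Y_space T \<Longrightarrow> \<bar>f x\<bar> \<le> C * Y_norm T x"
    using assms unfolding dual_space_def by blast
  show ?thesis
  proof (rule bdd_aboveI2)
    fix x :: "real \<Rightarrow> 'v" assume x: "x \<in> {x \<in> Y_space T. Y_norm T x \<le> 1}"
    have "\<bar>f x\<bar> \<le> C * Y_norm T x" using C x by blast
    also have "\<dots> \<le> \<bar>C\<bar> * 1"
      using x L2_norm_nonneg[of T x] by (intro mult_mono) auto
    finally show "\<bar>f x\<bar> \<le> \<bar>C\<bar>" by simp
  qed
qed

text \<open>
  Since \<open>Y_norm\<close> is only a seminorm on functions, elements with norm 0 cannot be normalised; there the
  functional vanishes because it is bounded.
\<close>

lemma Y_dual_bound:
  fixes f :: "(real \<Rightarrow> 'v::{real_inner,complete_space}) \<Rightarrow> real"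
    and x :: "real \<Rightarrow> 'v"
  assumes f: "f \<in> Y_dual T" and x: "x \<in> Y_space T"
  shows "\<bar>f x\<bar> \<le> Y_dual_norm T f * Y_norm T x"
proof -
  obtain C where C: "\<And>x. x \<in> Y_space T \<Longrightarrow> \<bar>f x\<bar> \<le> C * Y_norm T x"
    and scale: "\<And>c x. x \<in> Y_space T \<Longrightarrow> f (\<lambda>t. c *\<^sub>R x t) = c * f x"
    using f unfolding dual_space_def by blast
  show ?thesis
  proof (cases "Y_norm T x = 0")
    case True
    then show ?thesis using C[OF x] by simp
  next
    case False
    then have pos: "Y_norm T x > 0" using L2_norm_nonneg[of T x] by simp
    let ?z = "\<lambda>t. (1 / Y_norm T x) *\<^sub>R x t"
    have z: "?z \<in> Y_space T" "Y_norm T ?z \<le> 1"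
      using L2_scaleR[OF x] pos unfolding L2_norm_scaleR by auto
    have "\<bar>f ?z\<bar> \<le> Y_dual_norm T f"
      unfolding dual_norm_def using z by (intro cSUP_upper Y_dual_bdd_above[OF f]) auto
    then show ?thesis
      using scale[OF x] pos by (simp add: abs_mult field_simps)
  qed
qed

lemma Y_dual_norm_le:
  fixes f :: "(real \<Rightarrow> 'v::{real_inner,complete_space}) \<Rightarrow> real"
  assumes "\<And>x. x \<in> Y_space T \<Longrightarrow> \<bar>f x\<bar> \<le> C * Y_norm T x" "C \<ge> 0"
  shows "Y_dual_norm T f \<le> C"
  unfolding dual_norm_def
proof (rule cSUP_least)
  show "{x :: real \<Rightarrow> 'v. x \<in> Y_space T \<and> Y_norm T x \<le> 1} \<noteq> {}"
    using L2_const[of 0 T] by (auto simp: L2_norm_def intro!: exI[of _ "\<lambda>_. 0"])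
  fix x :: "real \<Rightarrow> 'v" assume x: "x \<in> {x \<in> Y_space T. Y_norm T x \<le> 1}"
  have "\<bar>f x\<bar> \<le> C * Y_norm T x" using assms(1) x by blast
  also have "\<dots> \<le> C * 1"
    using x assms(2) by (intro mult_left_mono) auto
  finally show "\<bar>f x\<bar> \<le> C" by simp
qed

lemma Y_dual_norm_nonneg:
  fixes f :: "(real \<Rightarrow> 'v::{real_inner,complete_space}) \<Rightarrow> real"
  assumes "f \<in> Y_dual T" shows "Y_dual_norm T f \<ge> 0"
proof -
  have "(\<lambda>t. 0) \<in> {x \<in> Y_space T. Y_norm T x \<le> 1}"
    using L2_const[of 0 T] by (simp add: L2_norm_def)
  then have "\<bar>f (\<lambda>t. 0)\<bar> \<le> Y_dual_norm T f"
    unfolding dual_norm_def by (intro cSUP_upper Y_dual_bdd_above[OF assms])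
  then show ?thesis by linarith
qed

lemma Y_dual_diff:
  fixes f :: "(real \<Rightarrow> 'v::{real_inner,complete_space}) \<Rightarrow> real"
    and x y :: "real \<Rightarrow> 'v"
  assumes "f \<in> Y_dual T" "x \<in> Y_space T" "y \<in> Y_space T"
  shows "f (\<lambda>t. x t - y t) = f x - f y"
proof -
  have add: "f (\<lambda>t. x t + z t) = f x + f z" if "z \<in> Y_space T" for z
    using assms(1,2) that unfolding dual_space_def by blast
  have scale: "f (\<lambda>t. (-1) *\<^sub>R y t) = (-1) * f y"
    using assms(1,3) unfolding dual_space_def by blast
  have "f (\<lambda>t. x t + (-1) *\<^sub>R y t) = f x + (-1) * f y"
    using add[OF L2_scaleR[OF assms(3), of "-1"]] unfolding scale .
  then show ?thesis by simp
qed

lemma lipschitz_A_bound: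
  assumes "maps_Y_to_Y_dual T A" "lipschitz_A T A L" and w: "w \<in> Y_space T" and v: "v \<in> Y_space T"
    and z: "z \<in> Y_space T"
  shows "\<bar>op_A T A w z - op_A T A v z\<bar> \<le> L * Y_norm T (\<lambda>t. w t - v t) * Y_norm T z"
proof -
  let ?f = "\<lambda>z\<in>Y_space T. op_A T A w z - op_A T A v z"
  have dual: "op_A T A w \<in> Y_dual T" "op_A T A v \<in> Y_dual T"
    using assms unfolding maps_Y_to_Y_dual_def by auto
  obtain C D where C: "\<And>x. x \<in> Y_space T \<Longrightarrow> \<bar>op_A T A w x\<bar> \<le> C * Y_norm T x"
    and D: "\<And>x. x \<in> Y_space T \<Longrightarrow> \<bar>op_A T A v x\<bar> \<le> D * Y_norm T x"
    using dual unfolding dual_space_def by blast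
  have bound: "\<bar>?f x\<bar> \<le> (C + D) * Y_norm T x" if "x \<in> Y_space T" for x
    using C[OF that] D[OF that] that by (simp add: distrib_right)
  have "?f \<in> Y_dual T"
    unfolding dual_space_def
  proof (intro CollectI conjI)
    show "\<exists>C. \<forall>x\<in>Y_space T. \<bar>?f x\<bar> \<le> C * Y_norm T x" using bound by blast
    have add: "op_A T A p (\<lambda>t. x t + y t) = op_A T A p x + op_A T A p y"
      if "p \<in> {w, v}" "x \<in> Y_space T" "y \<in> Y_space T" for p x y
      using dual that unfolding dual_space_def by blast
    have scale: "op_A T A p (\<lambda>t. c *\<^sub>R x t) = c * op_A T A p x"
      if "p \<in> {w, v}" "x \<in> Y_space T" for p c x
      using dual that unfolding dual_space_def by blast
    show "\<forall>x\<in>Y_space T. \<forall>y\<in>Y_space T. ?f (\<lambda>t. x t + y t) = ?f x + ?f y"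
      by (simp add: L2_add add)
    show "\<forall>c. \<forall>x\<in>Y_space T. ?f (\<lambda>t. c *\<^sub>R x t) = c * ?f x"
      by (simp add: L2_scaleR scale right_diff_distrib)
  qed simp
  then have "\<bar>?f z\<bar> \<le> Y_dual_norm T ?f * Y_norm T z"
    by (rule Y_dual_bound[OF _ z])
  also have "\<dots> \<le> L * Y_norm T (\<lambda>t. w t - v t) * Y_norm T z"
    using assms(2) w v unfolding lipschitz_A_def by (intro mult_right_mono L2_norm_nonneg) blast
  finally show ?thesis using z by simp
qed

section \<open>The error bounds\<close>

lemma weighted_sum_le_sqrt_mult_sqrt:
  fixes a b x y :: real
  shows "a * x + b * y \<le> sqrt (a\<^sup>2 + b\<^sup>2) * sqrt (x\<^sup>2 + y\<^sup>2)"
proof -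
  have "(a * x + b * y)\<^sup>2 \<le> (a\<^sup>2 + b\<^sup>2) * (x\<^sup>2 + y\<^sup>2)"
    using zero_le_power2[of "a * y - b * x"] by (simp add: power2_eq_square algebra_simps)
  then have "a * x + b * y \<le> sqrt ((a\<^sup>2 + b\<^sup>2) * (x\<^sup>2 + y\<^sup>2))"
    by (rule real_le_rsqrt)
  then show ?thesis by (simp add: real_sqrt_mult)
qed

lemma m_S_bounds:
  assumes "m > 0" "L > 0"
  shows "m_S L m > 0" "m_S L m \<le> 1" "m_S L m \<le> m" "m_S L m \<le> m / L\<^sup>2"
  using assms by (auto simp: m_S_def)

lemma X_norm_power2:
  "(X_norm \<iota> T w)\<^sup>2 = (Y_norm T w)\<^sup>2 + (Y_dual_norm T (d_t \<iota> T w))\<^sup>2 + (norm (time_trace \<iota> T T w))\<^sup>2"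
  unfolding X_norm_def by (intro real_sqrt_pow2 add_nonneg_nonneg zero_le_power2)

lemma X_norm_nonneg: "X_norm \<iota> T w \<ge> 0"
  unfolding X_norm_def by (intro real_sqrt_ge_zero add_nonneg_nonneg zero_le_power2)

lemma X_norm_components:
  assumes "w \<in> X_space \<iota> T"
  shows "Y_norm T w \<le> X_norm \<iota> T w" "Y_dual_norm T (d_t \<iota> T w) \<le> X_norm \<iota> T w"
    "(Y_norm T w)\<^sup>2 + (Y_dual_norm T (d_t \<iota> T w))\<^sup>2 \<le> (X_norm \<iota> T w)\<^sup>2"
  by (rule power2_le_imp_le[OF _ X_norm_nonneg], simp add: X_norm_power2)+
     (simp add: X_norm_power2)

text \<open>
  The identity \<open>\<parallel>\<gamma>\<^sub>0 w\<parallel>\<^sup>2 = \<parallel>\<gamma>\<^sub>T w\<parallel>\<^sup>2 - 2 (d\<^sub>t w)(w)\<close> and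
  \<open>2 \<parallel>d\<^sub>t w\<parallel> \<parallel>w\<parallel>\<^sub>Y \<le> \<parallel>d\<^sub>t w\<parallel>\<^sup>2 + \<parallel>w\<parallel>\<^sub>Y\<^sup>2\<close>.
\<close>

lemma initial_trace_le_X_norm:
  assumes "T > 0" and w: "w \<in> X_space \<iota> T"
  shows "norm (time_trace \<iota> T 0 w) \<le> X_norm \<iota> T w"
proof (rule power2_le_imp_le[OF _ X_norm_nonneg])
  have "- d_t \<iota> T w w \<le> Y_dual_norm T (d_t \<iota> T w) * Y_norm T w"
    using Y_dual_bound[OF d_t_in_Y_dual[OF w] X_spaceD(1)[OF w]] by linarith
  then show "(norm (time_trace \<iota> T 0 w))\<^sup>2 \<le> (X_norm \<iota> T w)\<^sup>2"
    using integration_by_parts_X[OF assms] sum_squares_bound[of "Y_dual_norm T (d_t \<iota> T w)" "Y_norm T w"]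
    unfolding X_norm_power2 by linarith
qed

lemma lin_subspace_diff:
  assumes S: "lin_subspace S" and x: "x \<in> S" and y: "y \<in> S"
  shows "(\<lambda>t. x t - y t) \<in> S"
proof -
  have add: "(\<lambda>t. x t + z t) \<in> S" if "z \<in> S" for z
    using S x that unfolding lin_subspace_def by blast
  have "(\<lambda>t. (-1) *\<^sub>R y t) \<in> S"
    using S y unfolding lin_subspace_def by blast
  from add[OF this] show ?thesis by simp
qed

theorem proposition6p7:
  fixes \<iota> :: "'v::{real_inner,complete_space} \<Rightarrow>\<^sub>L 'h::{real_inner,complete_space}"
    and T L_A m_A \<rho> :: real
    and A :: "real \<Rightarrow> 'v \<Rightarrow> 'v \<Rightarrow>\<^sub>L real"
    and X\<delta> Y\<delta> :: "(real \<Rightarrow> 'v) set"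
    and l :: "(real \<Rightarrow> 'v) \<Rightarrow> real"
    and u\<^sub>0 :: 'h
    and u u\<delta> \<theta>\<delta> \<theta>\<^sub>\<delta> :: "real \<Rightarrow> 'v"
  assumes "gelfand_triple \<iota>" and "T > 0"
    and "L_A > 0" and "m_A > 0"
    and "maps_Y_to_Y_dual T A"
    and "lipschitz_A T A L_A"
    and "strongly_monotone_A T A m_A"
    and "closed_subspace (X_space \<iota> T) (X_norm \<iota> T) X\<delta>" and "nontrivial_space T X\<delta>"
    and "closed_subspace (Y_space T) (Y_norm T) Y\<delta>" and "nontrivial_space T Y\<delta>"
    and "finite_dimensional T X\<delta> \<and> finite_dimensional T Y\<delta> \<or>
         X\<delta> = X_space \<iota> T \<and> Y\<delta> = Y_space T"
    and "X\<delta> \<subseteq> Y\<delta>"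
    and "l \<in> Y_dual T"
    and "u \<in> X_space \<iota> T"
    and "(\<lambda>v\<in>Y_space T. d_t \<iota> T u v + op_A T A u v) = l" and "time_trace \<iota> T 0 u = u\<^sub>0"
    and "\<theta>\<delta> \<in> Y\<delta>" and "u\<delta> \<in> X\<delta>"
    and "N_delta \<iota> T A Y\<delta> X\<delta> (\<theta>\<delta>, u\<delta>) =
         (restrict l Y\<delta>, (\<lambda>w\<in>X\<delta>. - (l w + inner u\<^sub>0 (time_trace \<iota> T 0 w))))"
    and "\<rho> > 0"
    and "\<theta>\<^sub>\<delta> \<in> Y_space T"
    and "op_A T A \<theta>\<^sub>\<delta> = (\<lambda>v\<in>Y_space T. l v - d_t \<iota> T u\<delta> v)"
    and "Y_norm T (\<lambda>t. \<theta>\<^sub>\<delta> t - \<theta>\<delta> t) \<le>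
         \<rho> * (Y_norm T (\<lambda>t. \<theta>\<delta> t - u\<delta> t)
               + sqrt (1 + L_A\<^sup>2) / m_A * norm (u\<^sub>0 - time_trace \<iota> T 0 u\<delta>))"
    and "u \<notin> X\<delta>"
  shows "m_A / sqrt (1 + L_A\<^sup>2 + m_A\<^sup>2) \<le>
           X_norm \<iota> T (\<lambda>t. u t - u\<delta> t) /
           sqrt ((Y_norm T (\<lambda>t. \<theta>\<delta> t - u\<delta> t))\<^sup>2 + (norm (u\<^sub>0 - time_trace \<iota> T 0 u\<delta>))\<^sup>2)
       \<and> X_norm \<iota> T (\<lambda>t. u t - u\<delta> t) /
           sqrt ((Y_norm T (\<lambda>t. \<theta>\<delta> t - u\<delta> t))\<^sup>2 + (norm (u\<^sub>0 - time_trace \<iota> T 0 u\<delta>))\<^sup>2)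
         \<le> L_Be_inv L_A m_A *
           sqrt (L_A\<^sup>2 * (\<rho> + 1)\<^sup>2 + (L_A * \<rho> * (sqrt (1 + L_A\<^sup>2) / m_A) + 1)\<^sup>2)"
proof -
  note T = assms(2) and L = assms(3) and m = assms(4) and maps = assms(5)
    and lip = assms(6) and mono = assms(7)
  define e where "e t = u t - u\<delta> t" for t
  \<comment> \<open>\<open>\<zeta>\<close> lifts the residual of \<open>u\<delta>\<close>: \<open>A \<theta>\<^sub>\<delta> - A u\<delta> = l - d\<^sub>t u\<delta> - A u\<delta>\<close>\<close>
  define \<zeta> where "\<zeta> t = \<theta>\<^sub>\<delta> t - u\<delta> t" for t
  define \<eta> where "\<eta> t = \<theta>\<delta> t - u\<delta> t" for t
  let ?E = "X_norm \<iota> T e" and ?ey = "Y_norm T e" and ?ed = "Y_dual_norm T (d_t \<iota> T e)"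
    and ?g = "norm (u\<^sub>0 - time_trace \<iota> T 0 u\<delta>)"
  have X\<delta>: "X\<delta> \<subseteq> X_space \<iota> T" and Y\<delta>: "Y\<delta> \<subseteq> Y_space T" "lin_subspace Y\<delta>"
    using assms(8,10) by (auto simp: closed_subspace_def)
  have uX: "u \<in> X_space \<iota> T" and u\<delta>X: "u\<delta> \<in> X_space \<iota> T"
    using assms(15,19) X\<delta> by auto
  have uY: "u \<in> Y_space T" and u\<delta>Y: "u\<delta> \<in> Y_space T" and \<theta>\<delta>Y: "\<theta>\<delta> \<in> Y_space T" and \<theta>Y: "\<theta>\<^sub>\<delta> \<in> Y_space T"
    using X_spaceD(1)[OF uX] X_spaceD(1)[OF u\<delta>X] assms(18,22) Y\<delta> by auto
  have eX: "e \<in> X_space \<iota> T" and eY: "e \<in> Y_space T"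
    using X_space_diff(1)[OF uX u\<delta>X] X_spaceD(1) unfolding e_def[abs_def] by blast+
  have \<zeta>Y: "\<zeta> \<in> Y_space T" and \<eta>Y: "\<eta> \<in> Y_space T"
    unfolding \<zeta>_def[abs_def] \<eta>_def[abs_def] by (rule L2_diff \<theta>Y \<theta>\<delta>Y u\<delta>Y)+
  have \<eta>Y\<delta>: "\<eta> \<in> Y\<delta>"
    unfolding \<eta>_def[abs_def] using lin_subspace_diff[OF Y\<delta>(2) assms(18)] assms(13,19) by blast
  have de: "d_t \<iota> T e y = d_t \<iota> T u y - d_t \<iota> T u\<delta> y" if "y \<in> Y_space T" for y
    using X_space_diff(2)[OF uX u\<delta>X that] by (simp add: e_def[abs_def])
  have e_dual: "d_t \<iota> T e \<in> Y_dual T" by (rule d_t_in_Y_dual[OF eX])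
  have trace0: "norm (time_trace \<iota> T 0 e) = ?g"
    using time_trace_diff[OF T uX u\<delta>X, of 0] T assms(17) by (simp add: e_def[abs_def])
  have l_u: "l y = d_t \<iota> T u y + op_A T A u y" if "y \<in> Y_space T" for y
    using fun_cong[OF assms(16), of y] that by simp
  have l_\<theta>: "op_A T A \<theta>\<^sub>\<delta> y = l y - d_t \<iota> T u\<delta> y" if "y \<in> Y_space T" for y
    using fun_cong[OF assms(23), of y] that by simp
  have l_discrete: "op_A T A \<theta>\<delta> y + d_t \<iota> T u\<delta> y = l y" if "y \<in> Y\<delta>" for y
  proof -
    have "(\<lambda>v\<in>Y\<delta>. A_delta T A Y\<delta> \<theta>\<delta> v + d_t_delta \<iota> T Y\<delta> u\<delta> v) = restrict l Y\<delta>"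
      using arg_cong[OF assms(20), of fst] by (simp add: N_delta_def)
    from fun_cong[OF this, of y] show ?thesis
      using that by (simp add: A_delta_def d_t_delta_def)
  qed
  have de_A: "d_t \<iota> T e y = op_A T A \<theta>\<^sub>\<delta> y - op_A T A u y" if "y \<in> Y_space T" for y
    using de[OF that] l_u[OF that] l_\<theta>[OF that] by simp
  have nonneg: "?ey \<ge> 0" "?ed \<ge> 0" "Y_norm T \<eta> \<ge> 0" "Y_norm T \<zeta> \<ge> 0" "?E \<ge> 0"
    by (auto simp: L2_norm_nonneg X_norm_nonneg Y_dual_norm_nonneg[OF e_dual])
  note comps = X_norm_components[OF eX]
  have g_le: "?g \<le> ?E"
    using initial_trace_le_X_norm[OF T eX] by (simp add: trace0)

  have \<eta>_le: "m_A * Y_norm T \<eta> \<le> ?ed + L_A * ?ey"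
  proof (cases "Y_norm T \<eta> = 0")
    case False
    have "m_A * (Y_norm T \<eta>)\<^sup>2 \<le> op_A T A \<theta>\<delta> \<eta> - op_A T A u\<delta> \<eta>"
      using mono \<theta>\<delta>Y u\<delta>Y unfolding strongly_monotone_A_def \<eta>_def[abs_def] by blast
    also have "\<dots> = d_t \<iota> T e \<eta> + (op_A T A u \<eta> - op_A T A u\<delta> \<eta>)"
      using l_discrete[OF \<eta>Y\<delta>] l_u[OF \<eta>Y] de[OF \<eta>Y] by simp
    also have "\<dots> \<le> ?ed * Y_norm T \<eta> + L_A * ?ey * Y_norm T \<eta>"
      using Y_dual_bound[OF e_dual \<eta>Y] lipschitz_A_bound[OF maps lip uY u\<delta>Y \<eta>Y]
      unfolding e_def[abs_def] by linarith
    finally have "(m_A * Y_norm T \<eta>) * Y_norm T \<eta> \<le> (?ed + L_A * ?ey) * Y_norm T \<eta>"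
      by (simp add: power2_eq_square algebra_simps)
    then show ?thesis using False nonneg(3) by simp
  qed (use nonneg L in simp)
  have lower: "m_A\<^sup>2 * ((Y_norm T \<eta>)\<^sup>2 + ?g\<^sup>2) \<le> (1 + L_A\<^sup>2 + m_A\<^sup>2) * ?E\<^sup>2"
  proof -
    have "?ed + L_A * ?ey \<le> sqrt (1 + L_A\<^sup>2) * sqrt (?ed\<^sup>2 + ?ey\<^sup>2)"
      using weighted_sum_le_sqrt_mult_sqrt[of 1 ?ed L_A ?ey] by simp
    with \<eta>_le have "m_A * Y_norm T \<eta> \<le> sqrt (1 + L_A\<^sup>2) * sqrt (?ed\<^sup>2 + ?ey\<^sup>2)" by linarith
    then have "(m_A * Y_norm T \<eta>)\<^sup>2 \<le> (sqrt (1 + L_A\<^sup>2) * sqrt (?ed\<^sup>2 + ?ey\<^sup>2))\<^sup>2"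
      using m nonneg by (intro power_mono) auto
    also have "\<dots> = (1 + L_A\<^sup>2) * (?ed\<^sup>2 + ?ey\<^sup>2)"
      by (simp add: power_mult_distrib)
    also have "\<dots> \<le> (1 + L_A\<^sup>2) * ?E\<^sup>2"
      using comps(3) by (intro mult_left_mono) auto
    finally have "m_A\<^sup>2 * (Y_norm T \<eta>)\<^sup>2 \<le> (1 + L_A\<^sup>2) * ?E\<^sup>2"
      by (simp add: power_mult_distrib)
    moreover have "m_A\<^sup>2 * ?g\<^sup>2 \<le> m_A\<^sup>2 * ?E\<^sup>2"
      using g_le by (intro mult_left_mono power_mono) auto
    ultimately show ?thesis by (simp add: algebra_simps)
  qed

  have stability: "m_S L_A m_A * ?E\<^sup>2 \<le> (L_A * Y_norm T \<zeta> + Y_norm T \<zeta> + ?g) * ?E"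
  proof -
    define z where "z t = u t - \<theta>\<^sub>\<delta> t" for t
    have zY: "z \<in> Y_space T" unfolding z_def[abs_def] by (rule L2_diff[OF uY \<theta>Y])
    have z_eq: "z = (\<lambda>t. e t - \<zeta> t)" by (simp add: z_def e_def \<zeta>_def fun_eq_iff)
    \<comment> \<open>here \<open>d\<^sub>t e = A \<theta>\<^sub>\<delta> - A u\<close> turns strong monotonicity into a bound for \<open>d\<^sub>t e\<close>\<close>
    have "?ed \<le> L_A * Y_norm T z"
    proof (rule Y_dual_norm_le)
      show "\<bar>d_t \<iota> T e y\<bar> \<le> L_A * Y_norm T z * Y_norm T y" if "y \<in> Y_space T" for y
        using lipschitz_A_bound[OF maps lip \<theta>Y uY that] de_A[OF that] L2_norm_diff_commute[of T \<theta>\<^sub>\<delta> u]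
        by (simp add: z_def[abs_def])
      show "0 \<le> L_A * Y_norm T z" using L by (simp add: L2_norm_nonneg)
    qed
    then have "?ed\<^sup>2 \<le> (L_A * Y_norm T z)\<^sup>2"
      using nonneg by (intro power_mono) auto
    then have "m_A / L_A\<^sup>2 * ?ed\<^sup>2 \<le> m_A / L_A\<^sup>2 * (L_A * Y_norm T z)\<^sup>2"
      using m by (intro mult_left_mono) auto
    also have "\<dots> = m_A * (Y_norm T z)\<^sup>2"
      using L by (simp add: power_mult_distrib)
    also have "\<dots> \<le> op_A T A u z - op_A T A \<theta>\<^sub>\<delta> z"
      using mono uY \<theta>Y unfolding strongly_monotone_A_def z_def[abs_def] by blast
    also have "\<dots> = - d_t \<iota> T e e + d_t \<iota> T e \<zeta>"
      using de_A[OF zY] Y_dual_diff[OF e_dual eY \<zeta>Y] by (simp add: z_eq)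
    finally have dt_part: "m_A / L_A\<^sup>2 * ?ed\<^sup>2 \<le> - d_t \<iota> T e e + d_t \<iota> T e \<zeta>" .
    have y_part: "m_A * ?ey\<^sup>2 \<le> op_A T A u e - op_A T A u\<delta> e"
      using mono uY u\<delta>Y unfolding strongly_monotone_A_def e_def[abs_def] by blast
    have "m_S L_A m_A * ?E\<^sup>2 \<le> m_A * ?ey\<^sup>2 + m_A / L_A\<^sup>2 * ?ed\<^sup>2 + 1 * (norm (time_trace \<iota> T T e))\<^sup>2"
      unfolding X_norm_power2 distrib_left using m_S_bounds[OF m L]
      by (intro add_mono mult_right_mono) auto
    \<comment> \<open>since \<open>\<parallel>\<gamma>\<^sub>T e\<parallel>\<^sup>2 - (d\<^sub>t e)(e) = (d\<^sub>t e)(e) + \<parallel>\<gamma>\<^sub>0 e\<parallel>\<^sup>2\<close> and \<open>d\<^sub>t e + A u = A \<theta>\<^sub>\<delta>\<close>\<close>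
    also have "\<dots> \<le> (op_A T A \<theta>\<^sub>\<delta> e - op_A T A u\<delta> e) + d_t \<iota> T e \<zeta> + ?g\<^sup>2"
      using dt_part y_part integration_by_parts_X[OF T eX] de_A[OF eY] unfolding trace0 by linarith
    also have "\<dots> \<le> L_A * Y_norm T \<zeta> * ?ey + ?ed * Y_norm T \<zeta> + ?g * ?g"
      using lipschitz_A_bound[OF maps lip \<theta>Y u\<delta>Y eY] Y_dual_bound[OF e_dual \<zeta>Y]
      unfolding \<zeta>_def[abs_def] power2_eq_square by linarith
    also have "\<dots> \<le> L_A * Y_norm T \<zeta> * ?E + ?E * Y_norm T \<zeta> + ?g * ?E"
      using comps g_le L nonneg by (intro add_mono mult_left_mono mult_right_mono) auto
    finally show ?thesis by (simp add: algebra_simps)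
  qed
  \<comment> \<open>replaces \<open>\<parallel>\<zeta>\<parallel>\<close> by the bound \<open>L_A \<parallel>\<zeta>\<parallel>\<close> of the residual divided by \<open>m_A\<close>, which gives the factor \<open>1 + 1 / m_A\<close>\<close>
  have \<zeta>_residual: "m_A * Y_norm T \<zeta> \<le> L_A * Y_norm T \<zeta>"
  proof (cases "Y_norm T \<zeta> = 0")
    case False
    have "m_A * (Y_norm T \<zeta>)\<^sup>2 \<le> op_A T A \<theta>\<^sub>\<delta> \<zeta> - op_A T A u\<delta> \<zeta>"
      using mono \<theta>Y u\<delta>Y unfolding strongly_monotone_A_def \<zeta>_def[abs_def] by blast
    also have "\<dots> \<le> L_A * Y_norm T \<zeta> * Y_norm T \<zeta>"
      using lipschitz_A_bound[OF maps lip \<theta>Y u\<delta>Y \<zeta>Y] unfolding \<zeta>_def[abs_def] by linarith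
    finally have "(m_A * Y_norm T \<zeta>) * Y_norm T \<zeta> \<le> (L_A * Y_norm T \<zeta>) * Y_norm T \<zeta>"
      by (simp add: power2_eq_square algebra_simps)
    then show ?thesis using False nonneg(4) by simp
  qed simp
  have E_le: "?E \<le> L_Be_inv L_A m_A * (L_A * Y_norm T \<zeta> + ?g)"
  proof -
    have mS: "m_S L_A m_A > 0" by (rule m_S_bounds[OF m L])
    have "m_S L_A m_A * ?E \<le> L_A * Y_norm T \<zeta> + Y_norm T \<zeta> + ?g"
    proof (cases "?E = 0")
      case True
      then show ?thesis using nonneg L by simp
    next
      case False
      have "(m_S L_A m_A * ?E) * ?E \<le> (L_A * Y_norm T \<zeta> + Y_norm T \<zeta> + ?g) * ?E"
        using stability by (simp add: power2_eq_square mult.assoc)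
      then show ?thesis using False nonneg(5) by simp
    qed
    also have "\<dots> \<le> L_A * Y_norm T \<zeta> + 1 / m_A * (L_A * Y_norm T \<zeta>) + ?g"
      using \<zeta>_residual m by (simp add: field_simps)
    also have "\<dots> \<le> (1 + 1 / m_A) * (L_A * Y_norm T \<zeta> + ?g)"
      using m by (simp add: distrib_left distrib_right)
    finally show ?thesis
      using mS by (simp add: L_Be_inv_def field_simps)
  qed
  define c where "c = sqrt (1 + L_A\<^sup>2) / m_A"
  define K where "K = sqrt (L_A\<^sup>2 * (\<rho> + 1)\<^sup>2 + (L_A * \<rho> * c + 1)\<^sup>2)"
  have \<zeta>_le: "Y_norm T \<zeta> \<le> (\<rho> + 1) * Y_norm T \<eta> + \<rho> * c * ?g"
  proof -
    have "Y_norm T (\<lambda>t. (\<theta>\<^sub>\<delta> t - \<theta>\<delta> t) + (\<theta>\<delta> t - u\<delta> t)) \<le> Y_norm T (\<lambda>t. \<theta>\<^sub>\<delta> t - \<theta>\<delta> t) + Y_norm T (\<lambda>t. \<theta>\<delta> t - u\<delta> t)"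
      by (rule L2_norm_triangle[OF L2_diff[OF \<theta>Y \<theta>\<delta>Y] L2_diff[OF \<theta>\<delta>Y u\<delta>Y]])
    then show ?thesis
      using assms(24) by (simp add: \<zeta>_def[abs_def] \<eta>_def[abs_def] c_def algebra_simps)
  qed
  have Be_pos: "L_Be_inv L_A m_A > 0"
    unfolding L_Be_inv_def using m_S_bounds(1)[OF m L] m by (simp add: add_pos_pos)
  have "L_A * Y_norm T \<zeta> + ?g \<le> L_A * ((\<rho> + 1) * Y_norm T \<eta> + \<rho> * c * ?g) + ?g"
    using \<zeta>_le L by (intro add_right_mono mult_left_mono) auto
  also have "\<dots> = (L_A * (\<rho> + 1)) * Y_norm T \<eta> + (L_A * \<rho> * c + 1) * ?g"
    by (simp add: algebra_simps)
  also have "\<dots> \<le> K * sqrt ((Y_norm T \<eta>)\<^sup>2 + ?g\<^sup>2)"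
    using weighted_sum_le_sqrt_mult_sqrt[of "L_A * (\<rho> + 1)" "Y_norm T \<eta>" "L_A * \<rho> * c + 1" ?g]
    by (simp add: K_def power_mult_distrib)
  finally have upper: "?E \<le> L_Be_inv L_A m_A * (K * sqrt ((Y_norm T \<eta>)\<^sup>2 + ?g\<^sup>2))"
    using E_le Be_pos by (meson less_imp_le mult_left_mono order_trans)

  \<comment> \<open>otherwise the constant sequence \<open>u\<delta>\<close> converges to \<open>u\<close> in \<open>X\<close>\<close>
  have den: "sqrt ((Y_norm T \<eta>)\<^sup>2 + ?g\<^sup>2) > 0"
  proof (rule ccontr)
    assume "\<not> ?thesis"
    then have "sqrt ((Y_norm T \<eta>)\<^sup>2 + ?g\<^sup>2) = 0"
      by (meson add_nonneg_nonneg not_less order_antisym real_sqrt_ge_zero zero_le_power2)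
    then have "?E = 0" using upper nonneg(5) by simp
    then have "X_norm \<iota> T (\<lambda>t. u\<delta> t - u t) = 0"
      using X_norm_minus_commute[OF T uX u\<delta>X] by (simp add: e_def[abs_def])
    then have "u \<in> X\<delta>"
      using assms(8,19) uX unfolding closed_subspace_def by (auto dest!: spec[of _ "\<lambda>_. u\<delta>"])
    then show False using assms(25) by simp
  qed
  have "m_A / sqrt (1 + L_A\<^sup>2 + m_A\<^sup>2) \<le> ?E / sqrt ((Y_norm T \<eta>)\<^sup>2 + ?g\<^sup>2)"
  proof -
    have pos: "sqrt (1 + L_A\<^sup>2 + m_A\<^sup>2) > 0"
      by (intro real_sqrt_gt_zero add_pos_nonneg) auto
    have "sqrt (m_A\<^sup>2 * ((Y_norm T \<eta>)\<^sup>2 + ?g\<^sup>2)) \<le> sqrt ((1 + L_A\<^sup>2 + m_A\<^sup>2) * ?E\<^sup>2)"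
      using lower by (rule real_sqrt_le_mono)
    then have "m_A * sqrt ((Y_norm T \<eta>)\<^sup>2 + ?g\<^sup>2) \<le> sqrt (1 + L_A\<^sup>2 + m_A\<^sup>2) * ?E"
      using m nonneg(5) by (simp add: real_sqrt_mult)
    then show ?thesis using den pos by (simp add: field_simps)
  qed
  moreover have "?E / sqrt ((Y_norm T \<eta>)\<^sup>2 + ?g\<^sup>2) \<le> L_Be_inv L_A m_A * K"
    using upper den by (simp add: pos_divide_le_eq mult.assoc)
  ultimately show ?thesis
    unfolding e_def[abs_def] \<eta>_def[abs_def] K_def c_def by blast
qed

end
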